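(* Let $\Phi:\mathbb{C}\to\mathbb{R}$ be a $C^2$-smooth function such that for every real $A>0$ there is a constant $C_A$ with $\Phi(z)\ge A\log|z|-C_A$ for all $z\in\mathbb{C}\setminus\{0\}$. Fix $\tau$ with $0<\tau<+\infty$ and a positive integer $n$. For integers $N\ge\max\{n,2\}$ put $\beta=\beta_N=(N-1)/\tau$. Then, as $N\to+\infty$, the $n$-point marginal distributions $\Pi^{(n)}_{N,\beta,\Phi}$ converge in the weak-star sense to the product measure $d\widehat\sigma(z_1)\cdots d\widehat\sigma(z_n)$, where $\widehat\sigma=\widehat\sigma_{\Phi,\tau}$ is the extremal measure; that is, for every bounded continuous $f:\mathbb{C}^n\to\mathbb{C}$, $$\int_{\mathbb{C}^n}f\,d\Pi^{(n)}_{N,\beta,\Phi}\to\int_{\mathbb{C}^n}f(z_1,\ldots,z_n)\,d\widehat\sigma(z_1)\cdots d\widehat\sigma(z_n)\quad\text{as }N\to+\infty.$$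
   Context: $\lambda_2$ is Lebesgue measure on $\mathbb{C}$. For $\beta>0$, $d\mu_{\beta,\Phi}(z)=e^{-\beta\Phi(z)}d\lambda_2(z)$. The van der Monde determinant is $\triangle(z_1,\ldots,z_N)=\prod_{1\le j<k\le N}(z_j-z_k)$. The probability measure $\Pi_{N,\beta,\Phi}$ on $\mathbb{C}^N$ is $$d\Pi_{N,\beta,\Phi}(z_1,\ldots,z_N)=\frac1{Z_N}|\triangle(z_1,\ldots,z_N)|^2\,d\mu_{\beta,\Phi}(z_1)\cdots d\mu_{\beta,\Phi}(z_N),$$ where $Z_N$ is the normalizing constant making the total mass $1$. For $1\le n\le N$, $\Pi^{(n)}_{N,\beta,\Phi}$ is the marginal distribution of the first $n$ coordinates $(z_1,\ldots,z_n)$ under $\Pi_{N,\beta,\Phi}$. For $\tau>0$, the extremal (equilibrium) measure $\widehat\sigma_{\Phi,\tau}$ is the unique compactly supported Borel probability measure $\sigma$ on $\mathbb{C}$ minimizing, among all compactly supported Borel probability measures on $\mathbb{C}$, the weighted energy $$\frac1{2\tau}\iint_{\mathbb{C}^2}\Big\{2\tau\log\frac1{|z-w|}+\Phi(z)+\Phi(w)\Big\}\,d\sigma(z)\,d\sigma(w)$$ (existence and uniqueness are known under the stated growth condition on $\Phi$). *)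

theory Defs
  imports "HOL-Probability.Probability"
begin

definition C2_smooth :: "(complex \<Rightarrow> real) \<Rightarrow> bool" where
  "C2_smooth \<Phi> \<longleftrightarrow>
    (\<exists>(\<Phi>' :: complex \<Rightarrow> complex \<Rightarrow>\<^sub>L real) (\<Phi>'' :: complex \<Rightarrow> complex \<Rightarrow>\<^sub>L complex \<Rightarrow>\<^sub>L real).
      (\<forall>z. (\<Phi> has_derivative blinfun_apply (\<Phi>' z)) (at z)) \<and>
      (\<forall>z. (\<Phi>' has_derivative blinfun_apply (\<Phi>'' z)) (at z)) \<and>
      continuous_on UNIV \<Phi>'')"

definition superlog_growth :: "(complex \<Rightarrow> real) \<Rightarrow> bool" where
  "superlog_growth \<Phi> \<longleftrightarrow> (\<forall>A>0. \<exists>C. \<forall>z. z \<noteq> 0 \<longrightarrow> \<Phi> z \<ge> A * ln (cmod z) - C)"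

definition weighted_measure :: "real \<Rightarrow> (complex \<Rightarrow> real) \<Rightarrow> complex measure" where
  "weighted_measure \<beta> \<Phi> = density lborel (\<lambda>z. ennreal (exp (- \<beta> * \<Phi> z)))"

text \<open>Points of $\mathbb{C}^N$ are functions on the index set \<open>{..<N}\<close>, so coordinates are numbered from 0.\<close>

definition vandermonde :: "nat \<Rightarrow> (nat \<Rightarrow> complex) \<Rightarrow> complex" where
  "vandermonde N z = (\<Prod>k<N. \<Prod>j<k. z j - z k)"

definition partition_function :: "nat \<Rightarrow> real \<Rightarrow> (complex \<Rightarrow> real) \<Rightarrow> ennreal" where
  "partition_function N \<beta> \<Phi> =
    (\<integral>\<^sup>+ z. ennreal ((cmod (vandermonde N z))\<^sup>2) \<partial>(\<Pi>\<^sub>M j\<in>{..<N}. weighted_measure \<beta> \<Phi>))"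

definition ensemble :: "nat \<Rightarrow> real \<Rightarrow> (complex \<Rightarrow> real) \<Rightarrow> (nat \<Rightarrow> complex) measure" where
  "ensemble N \<beta> \<Phi> =
    density (\<Pi>\<^sub>M j\<in>{..<N}. weighted_measure \<beta> \<Phi>)
      (\<lambda>z. ennreal ((cmod (vandermonde N z))\<^sup>2) / partition_function N \<beta> \<Phi>)"

definition marginal :: "nat \<Rightarrow> nat \<Rightarrow> real \<Rightarrow> (complex \<Rightarrow> real) \<Rightarrow> (nat \<Rightarrow> complex) measure" where
  "marginal n N \<beta> \<Phi> =
    distr (ensemble N \<beta> \<Phi>) (\<Pi>\<^sub>M j\<in>{..<n}. borel) (\<lambda>z. restrict z {..<n})"

definition compactly_supported_prob :: "complex measure \<Rightarrow> bool" where
  "compactly_supported_prob \<sigma> \<longleftrightarrow>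
    prob_space \<sigma> \<and> sets \<sigma> = sets borel \<and> (\<exists>K. compact K \<and> emeasure \<sigma> (- K) = 0)"

text \<open>Integral of an extended-real function as positive part minus negative part
  (the function \<open>e2ennreal\<close> truncates negative values to 0). It is meaningful when one of
  the two parts is finite. For the energy below, the negative part is finite because the
  measure has compact support.\<close>

definition ereal_integral :: "'a measure \<Rightarrow> ('a \<Rightarrow> ereal) \<Rightarrow> ereal" where
  "ereal_integral M f =
    enn2ereal (\<integral>\<^sup>+ x. e2ennreal (f x) \<partial>M) - enn2ereal (\<integral>\<^sup>+ x. e2ennreal (- f x) \<partial>M)"

text \<open>The kernel is infinite on the diagonal. This has to be said explicitly, since
  \<open>ln (1 / 0) = 0\<close> for the library logarithm.\<close>

definition energy_kernel :: "(complex \<Rightarrow> real) \<Rightarrow> real \<Rightarrow> complex \<Rightarrow> complex \<Rightarrow> ereal" where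
  "energy_kernel \<Phi> \<tau> z w =
    (if z = w then \<infinity> else ereal (2 * \<tau> * ln (1 / cmod (z - w)) + \<Phi> z + \<Phi> w))"

definition weighted_energy :: "(complex \<Rightarrow> real) \<Rightarrow> real \<Rightarrow> complex measure \<Rightarrow> ereal" where
  "weighted_energy \<Phi> \<tau> \<sigma> =
    ereal (1 / (2 * \<tau>)) * ereal_integral (\<sigma> \<Otimes>\<^sub>M \<sigma>) (\<lambda>(z, w). energy_kernel \<Phi> \<tau> z w)"

definition is_extremal_measure :: "(complex \<Rightarrow> real) \<Rightarrow> real \<Rightarrow> complex measure \<Rightarrow> bool" where
  "is_extremal_measure \<Phi> \<tau> \<sigma> \<longleftrightarrow>
    compactly_supported_prob \<sigma> \<and>
    (\<forall>\<nu>. compactly_supported_prob \<nu> \<longrightarrow> weighted_energy \<Phi> \<tau> \<sigma> \<le> weighted_energy \<Phi> \<tau> \<nu>)"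

end

theory Submission
  imports Defs
begin

text \<open>With \<open>Q = \<Phi> / (2 \<tau>)\<close> the density of the ensemble is proportional to \<open>exp (- H)\<close>, where \<open>H\<close> sums
  \<open>L(z, w) = - ln \<bar>z - w\<bar> + Q(z) + Q(w)\<close> over all ordered pairs of distinct particles. Jensen's inequality, applied
  to \<open>\<sigma>\<close> smoothed by averaging over small discs, bounds the partition function from below by
  \<open>exp (- N(N - 1)(I + o(1)))\<close>, \<open>I\<close> being the minimal energy, so with high probability
  \<open>H \<le> N(N - 1)(I + \<eta>)\<close>. The kernel \<open>- ln (\<bar>x\<bar>\<^sup>2 + a) / 2\<close> is a mixture of Gaussians up to a constant,
  hence positive definite on measures of total mass 0, and it is dominated by \<open>- ln \<bar>x\<bar>\<close>. Together with the
  Euler--Lagrange inequality for \<open>\<sigma>\<close>, low energy therefore makes the quadratic form of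
  (empirical measure) \<open>-\<close> (smoothed \<open>\<sigma>\<close>) small, and by Cauchy--Schwarz the empirical measure is weakly close
  to \<open>\<sigma>\<close>. By symmetry of the ensemble the \<open>n\<close>-point marginals agree, up to tuples with repetitions, with the
  expectations of \<open>n\<close>-fold products of the empirical measure; Stone--Weierstrass extends the convergence
  from products to all bounded continuous functions.\<close>

section \<open>Lebesgue measure on the plane\<close>

text \<open>The obstacle is the diagonal: point masses have infinite logarithmic energy, so
  particles and \<open>\<sigma>\<close> cannot be compared through - ln |x| itself. With a > 0
  inside the logarithm each self-interaction is - ln a / 2, a total of order 1 / N after division by
  N^2, harmless because a is fixed before N grows. Smoothing \<open>\<sigma>\<close> serves two
  ends: a bounded density trades the product measure for Lebesgue measure at one constant factor per
  particle, exponential in N against energies of order N^2, and the Euler--Lagrange inequality,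
  which admits only measures of finite energy, becomes an inequality at every point. Total mass 0 is
  forced because the Gaussian weight of the logarithm is 1 / t near t = 0, not integrable until a
  constant is subtracted; measures of mass 0 do not see constants. Weak closeness needs a positive
  definite kernel that can also act as a mollifier; the second difference of the regularised
  logarithm in its parameter decays fast enough for that. The choice (N - 1) / \<tau> spreads the
  potential exactly over pairs, since each particle lies in N - 1 of them.\<close>

lemma emeasure_lborel_ball_complex:
  assumes "0 \<le> r"
  shows "emeasure lborel (ball (c::complex) r) = ennreal (unit_ball_vol 2 * r\<^sup>2)"
    "emeasure lborel (cball (c::complex) r) = ennreal (unit_ball_vol 2 * r\<^sup>2)"
  using emeasure_ball[of r c] emeasure_cball[of r c] assms by (auto simp: DIM_complex)

lemma nn_integral_lborel_reflect:
  fixes h :: "complex \<Rightarrow> ennreal"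
  assumes [measurable]: "h \<in> borel_measurable borel"
  shows "(\<integral>\<^sup>+u. h (x - u) \<partial>lborel) = (\<integral>\<^sup>+u. h u \<partial>lborel)"
proof -
  have "lborel = distr lborel borel (\<lambda>u::complex. x - u)"
    using lborel_affine[of "-1" x] by (simp add: density_1)
  then have "(\<integral>\<^sup>+u. h u \<partial>lborel) = (\<integral>\<^sup>+u. h u \<partial>distr lborel borel (\<lambda>u::complex. x - u))"
    by simp
  also have "\<dots> = (\<integral>\<^sup>+u. h (x - u) \<partial>lborel)"
    by (rule nn_integral_distr) auto
  finally show ?thesis by simp
qed

lemma le_suminf_ennreal: "f n \<le> (\<Sum>n. f n :: ennreal)"
  using sum_le_suminf[of f "{n}"] by simp

text \<open>With n the integer part of |z|, the integrand is at most (1 + n)^-4 on the ball of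
  radius n + 1, whose area grows like (n + 1)^2; the series of 1 / (n + 1)^2 remains. This function
  later dominates the Gaussians, the test kernel and the Boltzmann factor of a single
  particle.\<close>

lemma nn_integral_inverse_power4_finite:
  "(\<integral>\<^sup>+z. ennreal (1 / (1 + cmod z) ^ 4) \<partial>lborel) < \<infinity>"
proof -
  define V where "V = unit_ball_vol (2::real)"
  have V: "V \<ge> 0" by (simp add: V_def)
  let ?g = "\<lambda>n (z::complex). ennreal (1 / (1 + real n) ^ 4) * indicator (ball 0 (real n + 1)) z"
  have le: "ennreal (1 / (1 + cmod z) ^ 4) \<le> (\<Sum>n. ?g n z)" for z :: complex
  proof -
    define n where "n = nat \<lfloor>cmod z\<rfloor>"
    have n: "real n \<le> cmod z" "cmod z < real n + 1" unfolding n_def by (auto simp: le_floor_iff)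
    have "ennreal (1 / (1 + cmod z) ^ 4) \<le> ?g n z"
      using n by (auto intro!: ennreal_leI divide_left_mono power_mono mult_pos_pos simp: add_pos_nonneg)
    also have "\<dots> \<le> (\<Sum>n. ?g n z)"
      by (rule le_suminf_ennreal)
    finally show ?thesis .
  qed
  have "(\<integral>\<^sup>+z. ennreal (1 / (1 + cmod z) ^ 4) \<partial>lborel) \<le> (\<integral>\<^sup>+z. (\<Sum>n. ?g n z) \<partial>lborel)"
    by (intro nn_integral_mono le)
  also have "\<dots> = (\<Sum>n. \<integral>\<^sup>+z. ?g n z \<partial>lborel)"
    by (intro nn_integral_suminf borel_measurable_times_ennreal borel_measurable_indicator) auto
  also have "\<dots> = (\<Sum>n. ennreal (V * (1 / (real (Suc n))\<^sup>2)))"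
  proof (intro suminf_cong)
    fix n
    have "(\<integral>\<^sup>+z. ?g n z \<partial>lborel) = ennreal (1 / (1 + real n) ^ 4) * ennreal (V * (real n + 1)\<^sup>2)"
      by (simp add: nn_integral_cmult_indicator emeasure_lborel_ball_complex V_def)
    also have "\<dots> = ennreal (1 / (1 + real n) ^ 4 * (V * (real n + 1)\<^sup>2))"
      using V by (subst ennreal_mult) auto
    also have "1 / (1 + real n) ^ 4 * (V * (real n + 1)\<^sup>2) = V * (1 / (real (Suc n))\<^sup>2)"
    proof -
      have "1 / x ^ 4 * (V * x\<^sup>2) = V * (1 / x\<^sup>2)" if "x > 0" for x :: real
        using that by (simp add: divide_simps power4_eq_xxxx power2_eq_square)
      from this[of "real n + 1"] show ?thesis by (simp add: add.commute)
    qed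
    finally show "(\<integral>\<^sup>+z. ?g n z \<partial>lborel) = ennreal (V * (1 / (real (Suc n))\<^sup>2))" .
  qed
  also have "\<dots> < \<infinity>"
  proof -
    have "summable (\<lambda>n. 1 / (real (Suc n))\<^sup>2)"
      using summable_Suc_iff[of "\<lambda>n. 1 / (real n)\<^sup>2"] inverse_power_summable[of 2, where 'a=real]
      by (simp add: inverse_eq_divide)
    then have "summable (\<lambda>n. V * (1 / (real (Suc n))\<^sup>2))" by (rule summable_mult)
    then show ?thesis using V by (subst suminf_ennreal2) auto
  qed
  finally show ?thesis .
qed

lemma integrable_inverse_power4:
  "integrable lborel (\<lambda>z::complex. 1 / (1 + cmod z) ^ 4)"
  using nn_integral_inverse_power4_finite by (intro integrableI_bounded) auto

text \<open>For x = a r^2 the exponential exp x dominates both 1 and x^2 / 2, hence 1 and a multiple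
  of r^4, while (1 + r)^4 is at most 8 (1 + r^4). This is the origin of the constant 8 + 8 (2 /
  a^2).\<close>

lemma integrable_gaussian_complex:
  assumes a: "0 < a"
  shows "integrable lborel (\<lambda>z::complex. exp (- a * (cmod z)\<^sup>2))"
proof (rule Bochner_Integration.integrable_bound)
  show "integrable lborel (\<lambda>z::complex. (8 + 16 / a\<^sup>2) * (1 / (1 + cmod z) ^ 4))"
    using integrable_inverse_power4 by (rule integrable_mult_right)
  have "exp (- a * r\<^sup>2) \<le> (8 + 16 / a\<^sup>2) * (1 / (1 + r) ^ 4)" if r: "0 \<le> r" for r :: real
  proof -
    have 1: "1 \<le> exp (a * r\<^sup>2)" using a by simp
    have 2: "(a * r\<^sup>2)\<^sup>2 / 2 \<le> exp (a * r\<^sup>2)"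
      using exp_lower_Taylor_quadratic[of "a * r\<^sup>2"] a by (smt (verit) zero_le_mult_iff zero_le_power2)
    have "r ^ 4 = 2 / a\<^sup>2 * ((a * r\<^sup>2)\<^sup>2 / 2)"
      using a by (simp add: field_simps power2_eq_square power4_eq_xxxx)
    also have "\<dots> \<le> 2 / a\<^sup>2 * exp (a * r\<^sup>2)" using 2 a by (intro mult_left_mono) auto
    finally have r4: "r ^ 4 \<le> 2 / a\<^sup>2 * exp (a * r\<^sup>2)" .
    have "(1 + r) ^ 4 \<le> 8 * (1 + r ^ 4)"
    proof -
      have "(1 + r)\<^sup>2 \<le> 2 * (1 + r\<^sup>2)" using zero_le_power2[of "r - 1"] by (simp add: power2_eq_square algebra_simps)
      then have "((1 + r)\<^sup>2)\<^sup>2 \<le> (2 * (1 + r\<^sup>2))\<^sup>2" by (intro power_mono) auto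
      also have "\<dots> = 4 * (1 + r\<^sup>2)\<^sup>2" by (simp add: power2_eq_square algebra_simps)
      also have "(1 + r\<^sup>2)\<^sup>2 \<le> 2 * (1 + r^4)"
        using zero_le_power2[of "r\<^sup>2 - 1"] by (simp add: power2_eq_square power4_eq_xxxx algebra_simps)
      finally show ?thesis by (simp add: power2_eq_square power4_eq_xxxx algebra_simps)
    qed
    also have "\<dots> \<le> 8 * (exp (a * r\<^sup>2) + 2 / a\<^sup>2 * exp (a * r\<^sup>2))"
      by (intro mult_left_mono add_mono 1 r4) auto
    also have "\<dots> = (8 + 16 / a\<^sup>2) * exp (a * r\<^sup>2)" by (simp add: field_simps)
    finally have "(1 + r) ^ 4 \<le> (8 + 16 / a\<^sup>2) * exp (a * r\<^sup>2)" .
    then have "(1 + r) ^ 4 * exp (- a * r\<^sup>2) \<le> (8 + 16 / a\<^sup>2) * exp (a * r\<^sup>2) * exp (- a * r\<^sup>2)"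
      by (intro mult_right_mono) auto
    then show ?thesis using r a by (simp add: exp_minus field_simps)
  qed
  then show "AE z in lborel. norm (exp (- a * (cmod z)\<^sup>2)) \<le> norm ((8 + 16 / a\<^sup>2) * (1 / (1 + cmod z) ^ 4))"
    by (simp add: abs_mult)
qed auto

text \<open>A dyadic decomposition: for |z| between (1/2)^(n+1) and (1/2)^n the integrand is at most
  2^(n+1), and the disc of radius (1/2)^n contributes 2 V (1/2)^n. This local integrability makes
  logarithmic potentials of bounded densities finite, uniformly in the point.\<close>

lemma nn_integral_inverse_norm_finite:
  "(\<integral>\<^sup>+z. ennreal (1 / cmod z) * indicator (cball 0 1) z \<partial>lborel) < \<infinity>"
proof -
  define V where "V = unit_ball_vol (2::real)"
  have V: "V \<ge> 0" by (simp add: V_def)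
  let ?g = "\<lambda>n (z::complex). ennreal (2 ^ Suc n) * indicator (cball 0 ((1/2) ^ n)) z"
  have le: "ennreal (1 / cmod z) * indicator (cball 0 1) z \<le> (\<Sum>n. ?g n z)" for z :: complex
  \<comment> \<open>The origin is harmless, since \<open>1 / 0 = 0\<close> there.\<close>
  proof (cases "z = 0 \<or> 1 < cmod z")
    case False
    then have z: "0 < cmod z" "cmod z \<le> 1" by auto
    obtain n where n: "cmod z \<le> (1/2) ^ n" "\<not> cmod z \<le> (1/2) ^ Suc n"
    proof -
      obtain m where "(1/2::real) ^ m < cmod z" using real_arch_pow_inv[of "cmod z" "1/2"] z by auto
      then have ex: "\<exists>m. \<not> cmod z \<le> (1/2) ^ m" by (auto simp: not_le)
      define m where "m = (LEAST m. \<not> cmod z \<le> (1/2) ^ m)"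
      have 1: "\<not> cmod z \<le> (1/2) ^ m" unfolding m_def using ex by (rule LeastI_ex)
      with z have "m \<noteq> 0" by (intro notI) auto
      then obtain k where k: "m = Suc k" by (cases m) auto
      then have "cmod z \<le> (1/2) ^ k"
        using not_less_Least[of k "\<lambda>m. \<not> cmod z \<le> (1/2) ^ m"] unfolding m_def by auto
      with 1 k that show ?thesis by auto
    qed
    have "1 / cmod z \<le> 2 ^ Suc n"
      using n z by (simp add: field_simps power_one_over)
    then have "ennreal (1 / cmod z) * indicator (cball 0 1) z \<le> ?g n z"
      using n z by (auto simp: ennreal_leI indicator_def)
    also have "\<dots> \<le> (\<Sum>n. ?g n z)"
      by (rule le_suminf_ennreal)
    finally show ?thesis .
  qed auto
  have "(\<integral>\<^sup>+z. ennreal (1 / cmod z) * indicator (cball 0 1) z \<partial>lborel) \<le> (\<integral>\<^sup>+z. (\<Sum>n. ?g n z) \<partial>lborel)"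
    by (intro nn_integral_mono le)
  also have "\<dots> = (\<Sum>n. \<integral>\<^sup>+z. ?g n z \<partial>lborel)"
    by (intro nn_integral_suminf borel_measurable_times_ennreal borel_measurable_indicator) auto
  also have "\<dots> = (\<Sum>n. ennreal (2 * V * (1/2) ^ n))"
  proof (intro suminf_cong)
    fix n
    have "(\<integral>\<^sup>+z. ?g n z \<partial>lborel) = ennreal (2 ^ Suc n) * ennreal (V * ((1/2) ^ n)\<^sup>2)"
      by (simp add: nn_integral_cmult_indicator emeasure_lborel_ball_complex V_def)
    also have "\<dots> = ennreal (2 ^ Suc n * (V * ((1/2) ^ n)\<^sup>2))"
      using V by (subst ennreal_mult) auto
    also have "2 ^ Suc n * (V * ((1/2) ^ n)\<^sup>2) = 2 * V * (1/2) ^ n"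
      by (simp add: field_simps power2_eq_square flip: power_mult_distrib)
    finally show "(\<integral>\<^sup>+z. ?g n z \<partial>lborel) = ennreal (2 * V * (1/2) ^ n)" .
  qed
  also have "\<dots> < \<infinity>"
    using V summable_geometric[of "1/2::real"] by (subst suminf_ennreal2) (auto intro!: summable_mult)
  finally show ?thesis .
qed

section \<open>Compactly supported probability measures\<close>

lemma compactly_supported_probD:
  assumes "compactly_supported_prob \<sigma>"
  shows "prob_space \<sigma>" "sets \<sigma> = sets borel" "\<exists>R>0. AE x in \<sigma>. cmod x \<le> R"
proof -
  show ps: "prob_space \<sigma>" and s: "sets \<sigma> = sets borel"
    using assms by (auto simp: compactly_supported_prob_def)
  obtain K where K: "compact K" "emeasure \<sigma> (- K) = 0"
    using assms by (auto simp: compactly_supported_prob_def)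
  obtain R where R: "R > 0" "\<And>x. x \<in> K \<Longrightarrow> cmod x \<le> R"
    using compact_imp_bounded[OF K(1)] by (auto simp: bounded_pos)
  have "- K \<in> sets \<sigma>" using K(1) s by (auto intro!: borel_open simp: compact_imp_closed open_Compl)
  with K have "- K \<in> null_sets \<sigma>" by (auto intro: null_setsI)
  then have "AE x in \<sigma>. cmod x \<le> R" by (rule AE_I') (use R in auto)
  with R show "\<exists>R>0. AE x in \<sigma>. cmod x \<le> R" by auto
qed

lemma compactly_supported_probI:
  assumes "prob_space \<sigma>" "sets \<sigma> = sets borel" "AE x in \<sigma>. cmod x \<le> R"
  shows "compactly_supported_prob \<sigma>"
proof -
  have "emeasure \<sigma> (- cball 0 R) = 0"
  proof -
    have "- cball 0 R \<in> sets \<sigma>" using assms(2) by simp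
    moreover have "AE x in \<sigma>. x \<notin> - cball 0 R" using assms(3) by eventually_elim auto
    ultimately show ?thesis using AE_iff_null_sets[of "- cball 0 R" \<sigma>] by (auto simp: null_sets_def)
  qed
  then show ?thesis using assms compact_cball unfolding compactly_supported_prob_def by blast
qed

lemma AE_pair_measure_fst_snd:
  assumes "prob_space \<alpha>" "prob_space \<beta>" "AE x in \<alpha>. P x" "AE y in \<beta>. P' y"
  shows "AE p in \<alpha> \<Otimes>\<^sub>M \<beta>. P (fst p) \<and> P' (snd p)"
proof -
  interpret a: prob_space \<alpha> by fact
  interpret b: prob_space \<beta> by fact
  interpret pair_prob_space \<alpha> \<beta> ..
  obtain A where A: "A \<in> null_sets \<alpha>" "{x\<in>space \<alpha>. \<not> P x} \<subseteq> A" using assms(3) by (auto elim!: AE_E)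
  obtain B where B: "B \<in> null_sets \<beta>" "{x\<in>space \<beta>. \<not> P' x} \<subseteq> B" using assms(4) by (auto elim!: AE_E)
  have 1: "A \<times> space \<beta> \<in> null_sets (\<alpha> \<Otimes>\<^sub>M \<beta>)"
    using A(1) by (auto simp: null_sets_def b.emeasure_pair_measure_Times)
  have 2: "space \<alpha> \<times> B \<in> null_sets (\<alpha> \<Otimes>\<^sub>M \<beta>)"
    using B(1) by (auto simp: null_sets_def b.emeasure_pair_measure_Times)
  have "(A \<times> space \<beta>) \<union> (space \<alpha> \<times> B) \<in> null_sets (\<alpha> \<Otimes>\<^sub>M \<beta>)" using 1 2 by auto
  then show ?thesis
    by (rule AE_I') (use A B in \<open>auto simp: space_pair_measure\<close>)
qed

section \<open>Positive definite radial kernels\<close>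

text \<open>Kernels are functions of the squared distance s: in this variable a Gaussian is exp (- t
  s), so mixtures of Gaussians are Laplace transforms.\<close>

definition ker_int :: "(real \<Rightarrow> real) \<Rightarrow> complex measure \<Rightarrow> complex measure \<Rightarrow> real" where
  "ker_int K \<alpha> \<beta> = (\<integral>p. K ((cmod (fst p - snd p))\<^sup>2) \<partial>(\<alpha> \<Otimes>\<^sub>M \<beta>))"

lemma measurable_radial_kernel:
  fixes K :: "real \<Rightarrow> real"
  assumes "continuous_on {0..} K"
  shows "(\<lambda>p::complex \<times> complex. K ((cmod (fst p - snd p))\<^sup>2)) \<in> borel_measurable (borel \<Otimes>\<^sub>M borel)"
proof -
  have "continuous_on UNIV (\<lambda>p::complex \<times> complex. K ((cmod (fst p - snd p))\<^sup>2))"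
    by (intro continuous_on_compose2[OF assms] continuous_intros) auto
  then show ?thesis by (simp add: borel_prod borel_measurable_continuous_onI)
qed

lemma AE_cmod_diff_bounded:
  assumes "compactly_supported_prob \<alpha>" "compactly_supported_prob \<beta>"
  obtains R where "0 < R" "AE p in \<alpha> \<Otimes>\<^sub>M \<beta>. (cmod (fst p - snd p))\<^sup>2 \<le> R"
proof -
  obtain R1 where R1: "R1 > 0" "AE x in \<alpha>. cmod x \<le> R1" using compactly_supported_probD[OF assms(1)] by auto
  obtain R2 where R2: "R2 > 0" "AE x in \<beta>. cmod x \<le> R2" using compactly_supported_probD[OF assms(2)] by auto
  have "AE p in \<alpha> \<Otimes>\<^sub>M \<beta>. cmod (fst p) \<le> R1 \<and> cmod (snd p) \<le> R2"
    using compactly_supported_probD[OF assms(1)] compactly_supported_probD[OF assms(2)] R1 R2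
    by (intro AE_pair_measure_fst_snd) auto
  then have "AE p in \<alpha> \<Otimes>\<^sub>M \<beta>. (cmod (fst p - snd p))\<^sup>2 \<le> (R1 + R2)\<^sup>2"
    by eventually_elim (intro power_mono order_trans[OF norm_triangle_ineq4] add_mono, auto)
  then show ?thesis using that[of "(R1 + R2)\<^sup>2"] R1 R2 by auto
qed

lemma integrable_radial_kernel:
  fixes K :: "real \<Rightarrow> real"
  assumes "compactly_supported_prob \<alpha>" "compactly_supported_prob \<beta>" and K: "continuous_on {0..} K"
  shows "integrable (\<alpha> \<Otimes>\<^sub>M \<beta>) (\<lambda>p. K ((cmod (fst p - snd p))\<^sup>2))"
proof -
  note A = compactly_supported_probD[OF assms(1)] and B = compactly_supported_probD[OF assms(2)]
  interpret pair_prob_space \<alpha> \<beta> using A(1) B(1) by (simp add: pair_prob_space_def pair_sigma_finite_def prob_space_imp_sigma_finite)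
  obtain R where R: "0 < R" "AE p in \<alpha> \<Otimes>\<^sub>M \<beta>. (cmod (fst p - snd p))\<^sup>2 \<le> R"
    using AE_cmod_diff_bounded[OF assms(1,2)] .
  have "compact (K ` {0..R})" by (intro compact_continuous_image continuous_on_subset[OF K]) auto
  then obtain M where M: "\<And>s. s \<in> {0..R} \<Longrightarrow> \<bar>K s\<bar> \<le> M"
    using compact_imp_bounded by (fastforce simp: bounded_iff)
  show ?thesis
  proof (rule P.integrable_const_bound[where B = M])
    show "AE p in \<alpha> \<Otimes>\<^sub>M \<beta>. norm (K ((cmod (fst p - snd p))\<^sup>2)) \<le> M"
      using R(2) by eventually_elim (use M in auto)
    show "(\<lambda>p. K ((cmod (fst p - snd p))\<^sup>2)) \<in> borel_measurable (\<alpha> \<Otimes>\<^sub>M \<beta>)"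
      using measurable_radial_kernel[OF K]
      by (subst measurable_cong_sets[OF sets_pair_measure_cong[OF A(2) B(2)] refl])
  qed
qed

text \<open>The parallelogram law around the midpoint. It factors the product of two Gaussians
  centred at x and y into a Gaussian of x - y and a Gaussian in u centred at the midpoint.\<close>

lemma midpoint_identity:
  fixes x y u :: complex
  shows "(cmod (x - u))\<^sup>2 + (cmod (y - u))\<^sup>2 = (cmod (x - y))\<^sup>2 / 2 + 2 * (cmod ((x + y) / 2 - u))\<^sup>2"
  unfolding cmod_power2 by (simp add: power2_eq_square field_simps)

lemma has_integral_lborel_reflect:
  fixes h :: "complex \<Rightarrow> real"
  assumes "integrable lborel h" "\<And>u. 0 \<le> h u"
  shows "integrable lborel (\<lambda>u. h (x - u))" "(\<integral>u. h (x - u) \<partial>lborel) = (\<integral>u. h u \<partial>lborel)"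
proof -
  have [measurable]: "h \<in> borel_measurable borel" using assms(1) by auto
  have "(\<integral>\<^sup>+u. ennreal (h (x - u)) \<partial>lborel) = (\<integral>\<^sup>+u. ennreal (h u) \<partial>lborel)"
    using nn_integral_lborel_reflect[of "\<lambda>u. ennreal (h u)" x] by simp
  also have "\<dots> = ennreal (\<integral>u. h u \<partial>lborel)"
    using assms by (intro nn_integral_eq_integral) auto
  finally have *: "(\<integral>\<^sup>+u. ennreal (h (x - u)) \<partial>lborel) = ennreal (\<integral>u. h u \<partial>lborel)" .
  have "has_bochner_integral lborel (\<lambda>u. h (x - u)) (\<integral>u. h u \<partial>lborel)"
    using * assms by (intro has_bochner_integral_nn_integral) (auto intro!: integral_nonneg_AE)
  then show "integrable lborel (\<lambda>u. h (x - u))" "(\<integral>u. h (x - u) \<partial>lborel) = (\<integral>u. h u \<partial>lborel)"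
    by (auto simp: has_bochner_integral_iff)
qed

text \<open>The factor \<open>1/2\<close> in the exponents makes the Gaussian kernel a convolution square.\<close>

lemma gaussian_ker_int:
  assumes "compactly_supported_prob \<alpha>" "compactly_supported_prob \<beta>" and t: "0 < t"
  defines "A \<equiv> \<lambda>\<alpha> u. \<integral>x. exp (- 2 * t * (cmod (x - u))\<^sup>2) \<partial>\<alpha>"
  shows "integrable lborel (\<lambda>u. A \<alpha> u * A \<beta> u)"
    and "(\<integral>u. A \<alpha> u * A \<beta> u \<partial>lborel) =
      (\<integral>v. exp (- (4 * t) * (cmod v)\<^sup>2) \<partial>lborel) * ker_int (\<lambda>s. exp (- t * s)) \<alpha> \<beta>"
proof -
  note a = compactly_supported_probD[OF assms(1)] and b = compactly_supported_probD[OF assms(2)]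
  note [measurable_cong] = a(2) b(2)
  interpret a: prob_space \<alpha> by (rule a(1))
  interpret b: prob_space \<beta> by (rule b(1))
  interpret ab: pair_prob_space \<alpha> \<beta> ..
  interpret Q: pair_sigma_finite "\<alpha> \<Otimes>\<^sub>M \<beta>" "lborel :: complex measure" ..
  define h where "h v = exp (- (4 * t) * (cmod v)\<^sup>2)" for v :: complex
  have h_int: "integrable lborel h" unfolding h_def using t by (intro integrable_gaussian_complex) auto
  have h_nn: "0 \<le> h v" for v by (simp add: h_def)
  define g where "g x u = exp (- 2 * t * (cmod (x - u))\<^sup>2)" for x u :: complex
  have g_mult: "g x u * g y u = exp (- t * (cmod (x - y))\<^sup>2) * h ((x + y) / 2 - u)" for x y u
  proof -
    have "g x u * g y u = exp (- 2 * t * ((cmod (x - u))\<^sup>2 + (cmod (y - u))\<^sup>2))"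
      by (simp add: g_def algebra_simps flip: exp_add)
    also have "\<dots> = exp (- t * (cmod (x - y))\<^sup>2) * h ((x + y) / 2 - u)"
      unfolding midpoint_identity h_def by (simp add: algebra_simps flip: exp_add)
    finally show ?thesis .
  qed
  define F where "F p u = g (fst p) u * g (snd p) u" for p u
  have F_eq: "F p u = exp (- t * (cmod (fst p - snd p))\<^sup>2) * h ((fst p + snd p) / 2 - u)" for p u
    unfolding F_def g_mult ..
  have [measurable]: "case_prod F \<in> borel_measurable ((\<alpha> \<Otimes>\<^sub>M \<beta>) \<Otimes>\<^sub>M lborel)"
    unfolding F_def g_def by measurable
  have F_nn: "0 \<le> F p u" for p u by (simp add: F_def g_def)
  have F1: "integrable lborel (F p)" for p
    unfolding F_eq by (intro integrable_mult_right has_integral_lborel_reflect h_int h_nn)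
  \<comment> \<open>The integral over u does not see where the Gaussian is centred, so of the pair p
    only the distance survives.\<close>
  have F2: "(\<integral>u. F p u \<partial>lborel) = (\<integral>v. h v \<partial>lborel) * exp (- t * (cmod (fst p - snd p))\<^sup>2)" for p
    unfolding F_eq using has_integral_lborel_reflect(2)[OF h_int h_nn] by simp
  have K: "integrable (\<alpha> \<Otimes>\<^sub>M \<beta>) (\<lambda>p. exp (- t * (cmod (fst p - snd p))\<^sup>2))"
    by (intro integrable_radial_kernel[OF assms(1,2), of "\<lambda>s. exp (- t * s)"] continuous_intros)
  have int: "integrable ((\<alpha> \<Otimes>\<^sub>M \<beta>) \<Otimes>\<^sub>M lborel) (case_prod F)"
  proof (rule Q.Fubini_integrable)
    show "AE p in \<alpha> \<Otimes>\<^sub>M \<beta>. integrable lborel (\<lambda>y. case_prod F (p, y))" using F1 by simp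
    show "integrable (\<alpha> \<Otimes>\<^sub>M \<beta>) (\<lambda>p. \<integral>y. norm (case_prod F (p, y)) \<partial>lborel)"
      using F_nn F2 K by simp
  qed measurable
  have inner: "(\<integral>p. F p u \<partial>(\<alpha> \<Otimes>\<^sub>M \<beta>)) = A \<alpha> u * A \<beta> u" for u
  proof -
    have [measurable]: "(\<lambda>x. g x u) \<in> borel_measurable borel" unfolding g_def by measurable
    have gb: "norm (g x u) \<le> 1" for x using t by (simp add: g_def)
    have 1: "integrable (\<alpha> \<Otimes>\<^sub>M \<beta>) (\<lambda>p. F p u)"
    proof (rule ab.P.integrable_const_bound[where B = 1])
      show "AE p in \<alpha> \<Otimes>\<^sub>M \<beta>. norm (F p u) \<le> 1"
        using gb by (auto simp: F_def abs_mult intro!: mult_le_one)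
    qed (auto simp: F_def g_def)
    have "(\<integral>p. F p u \<partial>(\<alpha> \<Otimes>\<^sub>M \<beta>)) = (\<integral>x. (\<integral>y. F (x, y) u \<partial>\<beta>) \<partial>\<alpha>)"
      using ab.integral_fst'[OF 1] by simp
    also have "\<dots> = A \<alpha> u * A \<beta> u" by (simp add: F_def A_def g_def)
    finally show ?thesis .
  qed
  show "integrable lborel (\<lambda>u. A \<alpha> u * A \<beta> u)"
    using Q.integrable_snd[OF int] by (simp add: inner)
  have "(\<integral>u. A \<alpha> u * A \<beta> u \<partial>lborel) = (\<integral>u. (\<integral>p. F p u \<partial>(\<alpha> \<Otimes>\<^sub>M \<beta>)) \<partial>lborel)"
    by (simp add: inner)
  also have "\<dots> = (\<integral>p. (\<integral>u. F p u \<partial>lborel) \<partial>(\<alpha> \<Otimes>\<^sub>M \<beta>))" by (rule Q.Fubini_integral[OF int])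
  also have "\<dots> = (\<integral>v. h v \<partial>lborel) * ker_int (\<lambda>s. exp (- t * s)) \<alpha> \<beta>"
    unfolding F2 ker_int_def by simp
  finally show "(\<integral>u. A \<alpha> u * A \<beta> u \<partial>lborel) =
      (\<integral>v. exp (- (4 * t) * (cmod v)\<^sup>2) \<partial>lborel) * ker_int (\<lambda>s. exp (- t * s)) \<alpha> \<beta>"
    by (simp add: h_def)
qed

lemma gaussian_mass_pos:
  assumes "0 < t" shows "0 < (\<integral>v. exp (- t * (cmod v)\<^sup>2) \<partial>lborel)"
proof (rule ccontr)
  assume "\<not> ?thesis"
  moreover have "0 \<le> (\<integral>v. exp (- t * (cmod v)\<^sup>2) \<partial>lborel)" by simp
  ultimately have "(\<integral>v. exp (- t * (cmod v)\<^sup>2) \<partial>lborel) = 0" by linarith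
  then have "AE v::complex in lborel. exp (- t * (cmod v)\<^sup>2) = 0"
    using integral_nonneg_eq_0_iff_AE[OF integrable_gaussian_complex[OF assms]] by simp
  then have "AE v::complex in lborel. False" by eventually_elim simp
  then show False
    by (simp add: eventually_False ae_filter_eq_bot_iff)
qed

lemma integral_double_sum:
  fixes c :: "'i \<Rightarrow> 'i \<Rightarrow> real"
  assumes "\<And>i j. i \<in> J \<Longrightarrow> j \<in> J \<Longrightarrow> integrable M (f i j)"
  shows "(\<integral>x. (\<Sum>i\<in>J. \<Sum>j\<in>J. c i j * f i j x) \<partial>M) = (\<Sum>i\<in>J. \<Sum>j\<in>J. c i j * (\<integral>x. f i j x \<partial>M))"
proof -
  have "(\<integral>x. (\<Sum>i\<in>J. \<Sum>j\<in>J. c i j * f i j x) \<partial>M) = (\<Sum>i\<in>J. (\<integral>x. (\<Sum>j\<in>J. c i j * f i j x) \<partial>M))"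
    using assms by (intro Bochner_Integration.integral_sum Bochner_Integration.integrable_sum integrable_mult_right)
  also have "\<dots> = (\<Sum>i\<in>J. \<Sum>j\<in>J. (\<integral>x. c i j * f i j x \<partial>M))"
    using assms by (intro sum.cong refl Bochner_Integration.integral_sum integrable_mult_right)
  finally show ?thesis by simp
qed

text \<open>The energy of the signed measure with weights c i on the probability measures \<alpha>
  i. A finite weighted family takes the place of a signed measure.\<close>

definition quad_form :: "(real \<Rightarrow> real) \<Rightarrow> 'i set \<Rightarrow> ('i \<Rightarrow> real) \<Rightarrow> ('i \<Rightarrow> complex measure) \<Rightarrow> real" where
  "quad_form K J c \<alpha> = (\<Sum>i\<in>J. \<Sum>j\<in>J. c i * c j * ker_int K (\<alpha> i) (\<alpha> j))"

text \<open>Up to the positive constant \<open>C\<close>, the form is the integral over u of the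
  square of the sum of c i A i u, because the Gaussian kernel is a convolution square.\<close>

lemma quad_form_gaussian_nonneg:
  assumes "finite J" "\<And>i. i \<in> J \<Longrightarrow> compactly_supported_prob (\<alpha> i)" "0 < t"
  shows "0 \<le> quad_form (\<lambda>s. exp (- t * s)) J c \<alpha>"
proof -
  define A where "A i u = (\<integral>x. exp (- 2 * t * (cmod (x - u))\<^sup>2) \<partial>\<alpha> i)" for i u
  define C where "C = (\<integral>v. exp (- (4 * t) * (cmod v)\<^sup>2) \<partial>lborel)"
  have C: "C > 0" unfolding C_def using assms(3) by (intro gaussian_mass_pos) auto
  have int: "integrable lborel (\<lambda>u. A i u * A j u)"
    and eq: "(\<integral>u. A i u * A j u \<partial>lborel) = C * ker_int (\<lambda>s. exp (- t * s)) (\<alpha> i) (\<alpha> j)" if "i \<in> J" "j \<in> J" for i j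
    using gaussian_ker_int[OF assms(2)[OF that(1)] assms(2)[OF that(2)] assms(3)] unfolding A_def C_def by auto
  have "0 \<le> (\<integral>u. (\<Sum>i\<in>J. c i * A i u)\<^sup>2 \<partial>lborel)" by simp
  also have "(\<lambda>u. (\<Sum>i\<in>J. c i * A i u)\<^sup>2) = (\<lambda>u. \<Sum>i\<in>J. \<Sum>j\<in>J. (c i * c j) * (A i u * A j u))"
    by (simp add: power2_eq_square sum_product mult_ac)
  also have "(\<integral>u. (\<Sum>i\<in>J. \<Sum>j\<in>J. (c i * c j) * (A i u * A j u)) \<partial>lborel)
      = (\<Sum>i\<in>J. \<Sum>j\<in>J. (c i * c j) * (\<integral>u. A i u * A j u \<partial>lborel))"
    using int by (rule integral_double_sum)
  also have "\<dots> = C * quad_form (\<lambda>s. exp (- t * s)) J c \<alpha>"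
    unfolding quad_form_def sum_distrib_left by (intro sum.cong refl) (simp add: eq)
  finally show ?thesis using C by (simp add: zero_le_mult_iff)
qed

text \<open>A mixture of Gaussians with an integrable, possibly signed, weight. Integrability
  excludes the logarithm itself, whose weight is 1 / t near 0, but admits differences of regularised
  logarithms. Continuity makes \<open>K\<close> bounded on the bounded range of squared distances
  between compact supports.\<close>

definition laplace_kernel :: "(real \<Rightarrow> real) \<Rightarrow> (real \<Rightarrow> real) \<Rightarrow> bool" where
  "laplace_kernel w K \<longleftrightarrow> integrable lborel w \<and> (\<forall>t\<le>0. w t = 0) \<and>
     (\<forall>s\<ge>0. K s = (\<integral>t. w t * exp (- t * s) \<partial>lborel)) \<and> continuous_on {0..} K"

text \<open>Fubini, with |w| as dominating function: where w does not vanish t is positive, and then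
  the Gaussian factor is at most 1.\<close>

lemma laplace_ker_int:
  assumes "compactly_supported_prob \<alpha>" "compactly_supported_prob \<beta>" and L: "laplace_kernel w K"
  shows "integrable lborel (\<lambda>t. w t * ker_int (\<lambda>s. exp (- t * s)) \<alpha> \<beta>)"
    and "(\<integral>t. w t * ker_int (\<lambda>s. exp (- t * s)) \<alpha> \<beta> \<partial>lborel) = ker_int K \<alpha> \<beta>"
proof -
  note a = compactly_supported_probD[OF assms(1)] and b = compactly_supported_probD[OF assms(2)]
  note [measurable_cong] = a(2) b(2)
  interpret a: prob_space \<alpha> by (rule a(1))
  interpret b: prob_space \<beta> by (rule b(1))
  interpret ab: pair_prob_space \<alpha> \<beta> ..
  interpret Q: pair_sigma_finite "\<alpha> \<Otimes>\<^sub>M \<beta>" "lborel :: real measure" ..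
  have w: "integrable lborel w" "\<And>t. t \<le> 0 \<Longrightarrow> w t = 0" "\<And>s. 0 \<le> s \<Longrightarrow> K s = (\<integral>t. w t * exp (- t * s) \<partial>lborel)"
    using L by (auto simp: laplace_kernel_def)
  have [measurable]: "w \<in> borel_measurable borel" using w(1) by auto
  define F where "F p t = w t * exp (- t * (cmod (fst p - snd p))\<^sup>2)" for p t
  have Fb: "norm (F p t) \<le> norm (w t)" for p t
    using w(2)[of t] by (cases "t \<le> 0") (auto simp: F_def abs_mult mult_left_le)
  have [measurable]: "case_prod F \<in> borel_measurable ((\<alpha> \<Otimes>\<^sub>M \<beta>) \<Otimes>\<^sub>M lborel)"
    unfolding F_def by measurable
  have [measurable]: "F p \<in> borel_measurable borel" for p unfolding F_def by measurable
  have F1: "integrable lborel (F p)" for p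
  proof (rule Bochner_Integration.integrable_bound[OF w(1)])
    show "F p \<in> borel_measurable lborel" by simp
    show "AE t in lborel. norm (F p t) \<le> norm (w t)" by (intro AE_I2 Fb)
  qed
  have int: "integrable ((\<alpha> \<Otimes>\<^sub>M \<beta>) \<Otimes>\<^sub>M lborel) (case_prod F)"
  proof (rule Q.Fubini_integrable)
    show "AE p in \<alpha> \<Otimes>\<^sub>M \<beta>. integrable lborel (\<lambda>y. case_prod F (p, y))" using F1 by simp
    show "integrable (\<alpha> \<Otimes>\<^sub>M \<beta>) (\<lambda>p. \<integral>y. norm (case_prod F (p, y)) \<partial>lborel)"
    proof (rule ab.P.integrable_const_bound)
      show "AE p in \<alpha> \<Otimes>\<^sub>M \<beta>. norm (\<integral>y. norm (case_prod F (p, y)) \<partial>lborel) \<le> (\<integral>t. norm (w t) \<partial>lborel)"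
      proof (intro AE_I2)
        fix p
        have "(\<integral>y. norm (case_prod F (p, y)) \<partial>lborel) \<le> (\<integral>t. norm (w t) \<partial>lborel)"
          unfolding prod.case by (intro integral_mono integrable_norm F1 w(1) Fb)
        then show "norm (\<integral>y. norm (case_prod F (p, y)) \<partial>lborel) \<le> (\<integral>t. norm (w t) \<partial>lborel)"
          by simp
      qed
    qed measurable
  qed measurable
  have F2: "(\<integral>p. F p t \<partial>(\<alpha> \<Otimes>\<^sub>M \<beta>)) = w t * ker_int (\<lambda>s. exp (- t * s)) \<alpha> \<beta>" for t
    unfolding F_def ker_int_def by simp
  show "integrable lborel (\<lambda>t. w t * ker_int (\<lambda>s. exp (- t * s)) \<alpha> \<beta>)"
    using Q.integrable_snd[OF int] unfolding F2 .
  show "(\<integral>t. w t * ker_int (\<lambda>s. exp (- t * s)) \<alpha> \<beta> \<partial>lborel) = ker_int K \<alpha> \<beta>"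
    using Q.Fubini_integral[OF int] unfolding F2 by (simp add: ker_int_def F_def w(3))
qed

lemma quad_form_laplace_nonneg:
  assumes "finite J" "\<And>i. i \<in> J \<Longrightarrow> compactly_supported_prob (\<alpha> i)" "laplace_kernel w K" "\<And>t. 0 \<le> w t"
  shows "0 \<le> quad_form K J c \<alpha>"
proof -
  let ?k = "\<lambda>t i j. ker_int (\<lambda>s. exp (- t * s)) (\<alpha> i) (\<alpha> j)"
  note L = laplace_ker_int[OF assms(2) assms(2) assms(3)]
  have "0 \<le> (\<integral>t. w t * quad_form (\<lambda>s. exp (- t * s)) J c \<alpha> \<partial>lborel)"
  proof (intro Bochner_Integration.integral_nonneg)
    fix t
    show "0 \<le> w t * quad_form (\<lambda>s. exp (- t * s)) J c \<alpha>"
      using quad_form_gaussian_nonneg[OF assms(1,2), where t = t] assms(3,4)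
      by (cases "t \<le> 0") (auto simp: laplace_kernel_def)
  qed
  also have "(\<lambda>t. w t * quad_form (\<lambda>s. exp (- t * s)) J c \<alpha>) = (\<lambda>t. \<Sum>i\<in>J. \<Sum>j\<in>J. (c i * c j) * (w t * ?k t i j))"
    unfolding quad_form_def sum_distrib_left by (simp add: mult_ac)
  also have "(\<integral>t. (\<Sum>i\<in>J. \<Sum>j\<in>J. (c i * c j) * (w t * ?k t i j)) \<partial>lborel)
      = (\<Sum>i\<in>J. \<Sum>j\<in>J. (c i * c j) * (\<integral>t. w t * ?k t i j \<partial>lborel))"
    using L(1) by (rule integral_double_sum)
  also have "\<dots> = quad_form K J c \<alpha>"
    unfolding quad_form_def by (intro sum.cong refl) (simp only: L(2))
  finally show ?thesis .
qed

section \<open>The regularised logarithm\<close>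

definition log_weight :: "real \<Rightarrow> real \<Rightarrow> real \<Rightarrow> real" where
  "log_weight c d t = (if t \<le> 0 then 0 else (exp (- c * t) - exp (- d * t)) / (2 * t))"

text \<open>At s = |x|^2 this is minus the logarithm of the square root of |x|^2 + a: the half
  undoes the square of the distance, and a > 0 removes the singularity.\<close>

definition reg_log :: "real \<Rightarrow> real \<Rightarrow> real" where
  "reg_log a s = - ln (s + a) / 2"

lemma continuous_on_reg_log: "0 < a \<Longrightarrow> continuous_on {0..} (reg_log a)"
  unfolding reg_log_def by (intro continuous_intros) auto

lemma log_weight_nonneg: "c \<le> d \<Longrightarrow> 0 \<le> log_weight c d t"
  by (auto simp: log_weight_def intro!: divide_nonneg_pos mult_right_mono)

lemma borel_measurable_log_weight [measurable]: "log_weight c d \<in> borel_measurable borel"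
  unfolding log_weight_def by measurable

text \<open>Frullani's integral: the weight times exp (- t s) is half the integral of exp (- t (s +
  b)) over b from c to d. In the other order the integral over t gives 1 / (s + b), and integrating
  this over b gives ln (s + d) - ln (s + c).\<close>

lemma frullani:
  assumes c: "0 < c" and cd: "c \<le> d" and s: "0 \<le> s"
  shows "(\<integral>\<^sup>+t. ennreal (log_weight c d t * exp (- t * s)) \<partial>lborel) = ennreal (reg_log c s - reg_log d s)"
proof -
  define f where "f t b = ennreal (exp (- t * (s + b))) * indicator {0..} t * indicator {c..d} b" for t b :: real
  have [measurable]: "case_prod f \<in> borel_measurable (lborel \<Otimes>\<^sub>M lborel)"
    unfolding f_def by measurable
  have *: "(\<integral>\<^sup>+b. f t b \<partial>lborel) = ennreal 2 * ennreal (log_weight c d t * exp (- t * s))" if t: "t \<noteq> 0" for t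
  proof (cases "t < 0")
    case True then show ?thesis by (simp add: f_def log_weight_def)
  next
    case False
    with t have t: "0 < t" by simp
    have "(\<integral>\<^sup>+b. f t b \<partial>lborel) = (\<integral>\<^sup>+b. ennreal (exp (- t * (s + b))) * indicator {c..d} b \<partial>lborel)"
      using t by (simp add: f_def)
    also have "\<dots> = ennreal ((- exp (- t * (s + d)) / t) - (- exp (- t * (s + c)) / t))"
      using t cd by (intro nn_integral_FTC_Icc) (auto intro!: derivative_eq_intros simp: field_simps)
    also have "(- exp (- t * (s + d)) / t) - (- exp (- t * (s + c)) / t) = 2 * (log_weight c d t * exp (- t * s))"
      using t by (simp add: log_weight_def field_simps exp_add exp_minus flip: exp_add)
    also have "ennreal \<dots> = ennreal 2 * ennreal (log_weight c d t * exp (- t * s))"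
      using log_weight_nonneg[OF cd, of t] by (subst ennreal_mult) auto
    finally show ?thesis .
  qed
  have "ennreal 2 * (\<integral>\<^sup>+t. ennreal (log_weight c d t * exp (- t * s)) \<partial>lborel) =
    (\<integral>\<^sup>+t. ennreal 2 * ennreal (log_weight c d t * exp (- t * s)) \<partial>lborel)"
    by (subst nn_integral_cmult) auto
  also have "\<dots> = (\<integral>\<^sup>+t. (\<integral>\<^sup>+b. f t b \<partial>lborel) \<partial>lborel)"
    using * AE_lborel_singleton[of 0] by (intro nn_integral_cong_AE) (auto elim!: eventually_mono)
  also have "\<dots> = (\<integral>\<^sup>+b. (\<integral>\<^sup>+t. f t b \<partial>lborel) \<partial>lborel)"
    by (rule lborel_pair.Fubini'[symmetric]) measurable
  also have "\<dots> = (\<integral>\<^sup>+b. ennreal (1 / (s + b)) * indicator {c..d} b \<partial>lborel)"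
  proof (rule nn_integral_cong)
    fix b
    show "(\<integral>\<^sup>+t. f t b \<partial>lborel) = ennreal (1 / (s + b)) * indicator {c..d} b"
    proof (cases "b \<in> {c..d}")
      case True
      then have sb: "0 < s + b" using c s by auto
      have "(\<integral>\<^sup>+t. f t b \<partial>lborel) = (\<integral>\<^sup>+t. ennreal (exp (- t * (s + b))) * indicator {0..} t \<partial>lborel)"
        using True by (simp add: f_def)
      also have "\<dots> = ennreal (0 - (- exp (- 0 * (s + b)) / (s + b)))"
      proof (rule nn_integral_FTC_atLeast)
        have "((\<lambda>t. exp (- (t * (s + b)))) \<longlongrightarrow> 0) at_top"
          using sb by (intro filterlim_compose[OF exp_at_bot] filterlim_compose[OF filterlim_uminus_at_bot_at_top]
             filterlim_at_top_mult_tendsto_pos[OF tendsto_const] filterlim_ident)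
        then have "((\<lambda>t. - exp (- (t * (s + b))) / (s + b)) \<longlongrightarrow> - 0 / (s + b)) at_top"
          using sb by (intro tendsto_intros) auto
        then show "((\<lambda>t. - exp (- t * (s + b)) / (s + b)) \<longlongrightarrow> 0) at_top" by simp
        have "((\<lambda>t. - exp (- t * q) / q) has_real_derivative exp (- t * q)) (at t)" if "0 < q" for q t :: real
          using that by (auto intro!: derivative_eq_intros simp: field_simps)
        from this[OF sb] show "((\<lambda>t. - exp (- t * (s + b)) / (s + b)) has_real_derivative exp (- t * (s + b))) (at t)" for t .
      qed auto
      finally show ?thesis using True by simp
    qed (simp add: f_def)
  qed
  also have "\<dots> = ennreal (ln (s + d) - ln (s + c))"
    using c cd s by (intro nn_integral_FTC_Icc) (auto intro!: derivative_eq_intros)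
  also have "\<dots> = ennreal 2 * ennreal (reg_log c s - reg_log d s)"
    using c cd s by (subst ennreal_mult[symmetric]) (auto simp: reg_log_def field_simps)
  finally show ?thesis by (simp add: ennreal_mult_cancel_left)
qed

lemma laplace_kernel_log:
  assumes c: "0 < c" and cd: "c \<le> d"
  shows "laplace_kernel (log_weight c d) (\<lambda>s. reg_log c s - reg_log d s)"
proof -
  have *: "has_bochner_integral lborel (\<lambda>t. log_weight c d t * exp (- t * s)) (reg_log c s - reg_log d s)"
    if s: "0 \<le> s" for s
    using frullani[OF c cd s] log_weight_nonneg[OF cd] c cd s
    by (intro has_bochner_integral_nn_integral) (auto simp: reg_log_def)
  have w0: "log_weight c d t = 0" if "t \<le> 0" for t using that by (simp add: log_weight_def)
  have "continuous_on {0..} (\<lambda>s. reg_log c s - reg_log d s)"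
    using c cd by (intro continuous_on_diff continuous_on_reg_log) auto
  then show ?thesis
    using *[of 0] * w0 by (auto simp: laplace_kernel_def has_bochner_integral_iff)
qed

lemma ker_int_add:
  assumes "compactly_supported_prob \<alpha>" "compactly_supported_prob \<beta>"
    "continuous_on {0..} K" "continuous_on {0..} K'"
  shows "ker_int (\<lambda>s. K s + K' s) \<alpha> \<beta> = ker_int K \<alpha> \<beta> + ker_int K' \<alpha> \<beta>"
  unfolding ker_int_def using assms by (intro Bochner_Integration.integral_add integrable_radial_kernel)

lemma quad_form_add:
  assumes "\<And>i. i \<in> J \<Longrightarrow> compactly_supported_prob (\<alpha> i)" "continuous_on {0..} K" "continuous_on {0..} K'"
  shows "quad_form (\<lambda>s. K s + K' s) J c \<alpha> = quad_form K J c \<alpha> + quad_form K' J c \<alpha>"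
proof -
  have "quad_form (\<lambda>s. K s + K' s) J c \<alpha> =
    (\<Sum>i\<in>J. \<Sum>j\<in>J. c i * c j * ker_int K (\<alpha> i) (\<alpha> j) + c i * c j * ker_int K' (\<alpha> i) (\<alpha> j))"
    unfolding quad_form_def using assms by (intro sum.cong refl) (simp add: ker_int_add algebra_simps)
  then show ?thesis by (simp add: quad_form_def sum.distrib)
qed

text \<open>The form of a constant kernel is that constant times the square of the total weight.
  This is how total mass 0 allows constants to be added to a kernel freely.\<close>

lemma quad_form_const:
  assumes "\<And>i. i \<in> J \<Longrightarrow> compactly_supported_prob (\<alpha> i)" "(\<Sum>i\<in>J. c i) = 0"
  shows "quad_form (\<lambda>s. k) J c \<alpha> = 0"
proof -
  have "ker_int (\<lambda>s. k) (\<alpha> i) (\<alpha> j) = k" if "i \<in> J" "j \<in> J" for i j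
  proof -
    interpret a: prob_space "\<alpha> i" using assms that compactly_supported_probD by blast
    interpret b: prob_space "\<alpha> j" using assms that compactly_supported_probD by blast
    interpret pair_prob_space "\<alpha> i" "\<alpha> j" ..
    show ?thesis by (simp add: ker_int_def P.prob_space)
  qed
  then have "quad_form (\<lambda>s. k) J c \<alpha> = (\<Sum>i\<in>J. \<Sum>j\<in>J. c i * c j * k)"
    unfolding quad_form_def by (intro sum.cong refl) auto
  also have "\<dots> = (\<Sum>i\<in>J. c i) * (\<Sum>j\<in>J. c j) * k"
    by (subst sum_product) (simp add: sum_distrib_right)
  finally show ?thesis using assms by simp
qed

lemma abs_ker_int_le:
  fixes K :: "real \<Rightarrow> real"
  assumes "compactly_supported_prob \<alpha>" "compactly_supported_prob \<beta>" "continuous_on {0..} K"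
    "AE p in \<alpha> \<Otimes>\<^sub>M \<beta>. \<bar>K ((cmod (fst p - snd p))\<^sup>2)\<bar> \<le> M"
  shows "\<bar>ker_int K \<alpha> \<beta>\<bar> \<le> M"
proof -
  interpret a: prob_space \<alpha> using assms compactly_supported_probD by blast
  interpret b: prob_space \<beta> using assms compactly_supported_probD by blast
  interpret pair_prob_space \<alpha> \<beta> ..
  have int: "integrable (\<alpha> \<Otimes>\<^sub>M \<beta>) (\<lambda>p. K ((cmod (fst p - snd p))\<^sup>2))"
    by (rule integrable_radial_kernel) fact+
  have "\<bar>ker_int K \<alpha> \<beta>\<bar> \<le> (\<integral>p. \<bar>K ((cmod (fst p - snd p))\<^sup>2)\<bar> \<partial>(\<alpha> \<Otimes>\<^sub>M \<beta>))"
    unfolding ker_int_def by (rule integral_abs_bound)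
  also have "\<dots> \<le> (\<integral>p. M \<partial>(\<alpha> \<Otimes>\<^sub>M \<beta>))" using int assms by (intro integral_mono_AE) auto
  finally show ?thesis by (simp add: P.prob_space)
qed

lemma quad_form_reg_log_diff_nonneg:
  assumes "finite J" "\<And>i. i \<in> J \<Longrightarrow> compactly_supported_prob (\<alpha> i)" "0 < a" "a \<le> b"
  shows "0 \<le> quad_form (\<lambda>s. reg_log a s - reg_log b s) J c \<alpha>"
  using assms by (intro quad_form_laplace_nonneg[OF _ _ laplace_kernel_log] log_weight_nonneg) auto

text \<open>Compare with \<open>reg_log B\<close>, which up to an irrelevant constant tends to 0 as \<open>B\<close> grows.\<close>

lemma quad_form_reg_log_nonneg:
  assumes J: "finite J" and \<alpha>: "\<And>i. i \<in> J \<Longrightarrow> compactly_supported_prob (\<alpha> i)"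
    and c: "(\<Sum>i\<in>J. c i) = 0" and a: "0 < a"
  shows "0 \<le> quad_form (reg_log a) J c \<alpha>"
proof -
  have "\<exists>R>0. AE p in \<alpha> i \<Otimes>\<^sub>M \<alpha> j. (cmod (fst p - snd p))\<^sup>2 \<le> R" if "i \<in> J" "j \<in> J" for i j
    using AE_cmod_diff_bounded[OF \<alpha>[OF that(1)] \<alpha>[OF that(2)]] by metis
  then obtain R where R: "\<And>i j. i \<in> J \<Longrightarrow> j \<in> J \<Longrightarrow> R i j > 0"
    "\<And>i j. i \<in> J \<Longrightarrow> j \<in> J \<Longrightarrow> AE p in \<alpha> i \<Otimes>\<^sub>M \<alpha> j. (cmod (fst p - snd p))\<^sup>2 \<le> R i j"
    by metis
  define M where "M = (\<Sum>i\<in>J. \<Sum>j\<in>J. \<bar>c i * c j\<bar> * R i j)"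
  have M: "M \<ge> 0" unfolding M_def using R(1) by (intro sum_nonneg mult_nonneg_nonneg) (auto intro: less_imp_le)
  have *: "- M / B \<le> quad_form (reg_log a) J c \<alpha>" if B: "a \<le> B" for B
  proof -
    have B0: "0 < B" using a B by simp
    \<comment> \<open>\<open>?K2\<close> is \<open>reg_log B\<close> shifted so as to vanish at s =
      0; on the bounded supports it is of order 1 / B, and the shift is invisible to a family of
      total weight 0.\<close>
    let ?K1 = "\<lambda>s. reg_log a s - reg_log B s" and ?K2 = "\<lambda>s. reg_log B s + ln B / 2"
    have cont: "continuous_on {0..} ?K1" "continuous_on {0..} ?K2" "continuous_on {0..} (\<lambda>s. - (ln B / 2))"
      "continuous_on {0..} (\<lambda>s. ?K1 s + ?K2 s)"
      using a B0 by (intro continuous_intros continuous_on_reg_log; simp)+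
    have "quad_form (reg_log a) J c \<alpha> = quad_form (\<lambda>s. (?K1 s + ?K2 s) + - (ln B / 2)) J c \<alpha>"
      by (rule arg_cong[where f = "\<lambda>K. quad_form K J c \<alpha>"]) auto
    also have "\<dots> = quad_form ?K1 J c \<alpha> + quad_form ?K2 J c \<alpha> + quad_form (\<lambda>s. - (ln B / 2)) J c \<alpha>"
      by (simp only: quad_form_add[OF \<alpha> cont(4,3)] quad_form_add[OF \<alpha> cont(1,2)])
    also have "quad_form (\<lambda>s. - (ln B / 2)) J c \<alpha> = 0" by (rule quad_form_const[OF \<alpha> c])
    finally have eq: "quad_form (reg_log a) J c \<alpha> = quad_form ?K1 J c \<alpha> + quad_form ?K2 J c \<alpha>" by simp
    have nn: "0 \<le> quad_form ?K1 J c \<alpha>" using J \<alpha> a B by (rule quad_form_reg_log_diff_nonneg)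
    have "\<bar>quad_form ?K2 J c \<alpha>\<bar> \<le> (\<Sum>i\<in>J. \<Sum>j\<in>J. \<bar>c i * c j\<bar> * (R i j / B))"
      unfolding quad_form_def
    proof (intro order_trans[OF sum_abs] sum_mono)
      fix i j assume ij: "i \<in> J" "j \<in> J"
      have "\<bar>ker_int ?K2 (\<alpha> i) (\<alpha> j)\<bar> \<le> R i j / B"
      proof (rule abs_ker_int_le[OF \<alpha> \<alpha> cont(2)])
        show "AE p in \<alpha> i \<Otimes>\<^sub>M \<alpha> j. \<bar>reg_log B ((cmod (fst p - snd p))\<^sup>2) + ln B / 2\<bar> \<le> R i j / B"
          using R(2)[OF ij]
        proof eventually_elim
          fix p :: "complex \<times> complex"
          define s where "s = (cmod (fst p - snd p))\<^sup>2"
          assume "(cmod (fst p - snd p))\<^sup>2 \<le> R i j"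
          then have s: "0 \<le> s" "s \<le> R i j" by (auto simp: s_def)
          have "reg_log B s + ln B / 2 = - ln (1 + s / B) / 2"
          proof -
            have "1 + s / B = (s + B) / B" using B0 by (simp add: field_simps)
            then have "ln (1 + s / B) = ln (s + B) - ln B" using s B0 by (simp add: ln_div)
            then show ?thesis by (simp add: reg_log_def)
          qed
          moreover have "0 \<le> ln (1 + s / B)" "ln (1 + s / B) \<le> s / B"
            using s B0 by (auto intro!: ln_add_one_self_le_self)
          moreover have "s / B \<le> R i j / B" using s B0 by (simp add: divide_right_mono)
          moreover have "0 \<le> s / B" using s B0 by simp
          ultimately have "\<bar>reg_log B s + ln B / 2\<bar> \<le> R i j / B" by linarith
          then show "\<bar>reg_log B ((cmod (fst p - snd p))\<^sup>2) + ln B / 2\<bar> \<le> R i j / B" by (simp add: s_def)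
        qed
      qed (use ij in auto)
      then show "\<bar>c i * c j * ker_int ?K2 (\<alpha> i) (\<alpha> j)\<bar> \<le> \<bar>c i * c j\<bar> * (R i j / B)"
        unfolding abs_mult[of "c i * c j"] by (intro mult_left_mono) auto
    qed
    also have "\<dots> = M / B" by (simp add: M_def sum_divide_distrib)
    finally show ?thesis using eq nn by simp
  qed
  show ?thesis
  proof (rule ccontr)
    assume "\<not> ?thesis"
    then have q: "0 < - quad_form (reg_log a) J c \<alpha>" (is "0 < ?q") by simp
    \<comment> \<open>Large enough for the error M / B to fall below the supposed deficit
      \<open>?q\<close>; the maximum ensures a \<le> B.\<close>
    define B where "B = max a (2 * M / ?q + 1)"
    have "a \<le> B" "0 < B" "2 * M / ?q < B" unfolding B_def using a by (auto simp: max_def)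
    then have "2 * M < B * ?q" using q by (metis pos_divide_less_eq)
    then have "M / B < ?q" using \<open>0 < B\<close> M q by (simp add: field_simps)
    with *[OF \<open>a \<le> B\<close>] show False by simp
  qed
qed

text \<open>A second difference in the parameter. For large s a first difference decays like 1 / s,
  which is not integrable over the plane when s = |z|^2; the second difference decays like 1 / s^2
  and is.\<close>

definition test_kernel :: "real \<Rightarrow> real \<Rightarrow> real" where
  "test_kernel b s = (reg_log b s - reg_log (2 * b) s) - (reg_log (2 * b) s - reg_log (3 * b) s)"

lemma continuous_on_test_kernel: "0 < b \<Longrightarrow> continuous_on {0..} (test_kernel b)"
  unfolding test_kernel_def by (intro continuous_on_diff continuous_on_reg_log) auto

lemma laplace_kernel_test:
  assumes b: "0 < b"
  shows "laplace_kernel (\<lambda>t. log_weight b (2 * b) t - log_weight (2 * b) (3 * b) t) (test_kernel b)"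
proof -
  note L = laplace_kernel_log[of b "2 * b"] laplace_kernel_log[of "2 * b" "3 * b"]
  have int: "integrable lborel (\<lambda>t. w t * exp (- t * s))" if "laplace_kernel w K" "0 \<le> s" for w K s
  proof (rule Bochner_Integration.integrable_bound)
    show "integrable lborel w" using that by (simp add: laplace_kernel_def)
    then have [measurable]: "w \<in> borel_measurable borel" by auto
    show "(\<lambda>t. w t * exp (- t * s)) \<in> borel_measurable lborel" by measurable
    have "norm (w t * exp (- t * s)) \<le> norm (w t)" for t
      using that by (cases "t \<le> 0") (auto simp: laplace_kernel_def abs_mult mult_left_le)
    then show "AE t in lborel. norm (w t * exp (- t * s)) \<le> norm (w t)" by (intro AE_I2)
  qed
  have "test_kernel b s = (\<integral>t. (log_weight b (2 * b) t - log_weight (2 * b) (3 * b) t) * exp (- t * s) \<partial>lborel)"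
    if s: "0 \<le> s" for s
  proof -
    have "(\<integral>t. (log_weight b (2 * b) t - log_weight (2 * b) (3 * b) t) * exp (- t * s) \<partial>lborel) =
      (\<integral>t. log_weight b (2 * b) t * exp (- t * s) - log_weight (2 * b) (3 * b) t * exp (- t * s) \<partial>lborel)"
      by (simp add: left_diff_distrib)
    also have "\<dots> = (\<integral>t. log_weight b (2 * b) t * exp (- t * s) \<partial>lborel) -
        (\<integral>t. log_weight (2 * b) (3 * b) t * exp (- t * s) \<partial>lborel)"
      using b s L by (intro Bochner_Integration.integral_diff int) auto
    also have "\<dots> = test_kernel b s"
      using b s L by (simp add: laplace_kernel_def test_kernel_def)
    finally show ?thesis by simp
  qed
  then show ?thesis
    using L b continuous_on_test_kernel[OF b] by (auto simp: laplace_kernel_def)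
qed

text \<open>With e = exp (- b t) the numerators e - e^2 and e^2 - e^3 come from a geometric
  progression, and their difference is e (1 - e)^2.\<close>

lemma test_weight_nonneg: "0 < b \<Longrightarrow> 0 \<le> log_weight b (2 * b) t - log_weight (2 * b) (3 * b) t"
proof (cases "t \<le> 0")
  case False
  define e where "e = exp (- b * t)"
  have "exp (- (2 * b) * t) = e * e" "exp (- (3 * b) * t) = e * e * e"
    by (simp_all add: e_def flip: exp_add)
  moreover assume "0 < b"
  moreover have "0 < e" by (simp add: e_def)
  moreover have "(e - e * e) / (2 * t) - (e * e - e * e * e) / (2 * t) = e * (1 - e)\<^sup>2 / (2 * t)"
    by (simp add: power2_eq_square algebra_simps diff_divide_distrib add_divide_distrib)
  ultimately show ?thesis using False by (simp add: log_weight_def e_def)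
qed (simp add: log_weight_def)

lemma quad_form_test_nonneg:
  assumes "finite J" "\<And>i. i \<in> J \<Longrightarrow> compactly_supported_prob (\<alpha> i)" "0 < b"
  shows "0 \<le> quad_form (test_kernel b) J c \<alpha>"
  using assms by (intro quad_form_laplace_nonneg[OF _ _ laplace_kernel_test] test_weight_nonneg) auto

text \<open>\<open>reg_log a\<close> telescopes into the test kernel plus three kernels that are
  nonnegative on families of total weight 0. Small regularised logarithmic energy thus forces small
  energy for an integrable kernel, where b stays fixed while a may shrink.\<close>

lemma quad_form_test_le:
  assumes J: "finite J" and \<alpha>: "\<And>i. i \<in> J \<Longrightarrow> compactly_supported_prob (\<alpha> i)"
    and c: "(\<Sum>i\<in>J. c i) = 0" and a: "0 < a" "a \<le> b"
  shows "quad_form (test_kernel b) J c \<alpha> \<le> quad_form (reg_log a) J c \<alpha>"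
proof -
  have b: "0 < b" using a by simp
  let ?K1 = "\<lambda>s. reg_log a s - reg_log b s" and ?K2 = "\<lambda>s. reg_log (2 * b) s - reg_log (3 * b) s"
  let ?K3 = "reg_log (2 * b)"
  have cont: "continuous_on {0..} ?K1" "continuous_on {0..} ?K2" "continuous_on {0..} ?K3"
    using a b by (auto intro!: continuous_on_diff continuous_on_reg_log)
  have "reg_log a = (\<lambda>s. test_kernel b s + (?K1 s + (?K2 s + ?K3 s)))"
    by (auto simp: test_kernel_def)
  then have "quad_form (reg_log a) J c \<alpha> = quad_form (\<lambda>s. test_kernel b s + (?K1 s + (?K2 s + ?K3 s))) J c \<alpha>"
    by simp
  also have "\<dots> = quad_form (test_kernel b) J c \<alpha> + (quad_form ?K1 J c \<alpha> + (quad_form ?K2 J c \<alpha> + quad_form ?K3 J c \<alpha>))"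
    by (simp only: quad_form_add[OF \<alpha>] cont continuous_on_test_kernel[OF b] continuous_on_add)
  moreover have "0 \<le> quad_form ?K1 J c \<alpha>" "0 \<le> quad_form ?K2 J c \<alpha>"
    using J \<alpha> a b by (auto intro!: quad_form_reg_log_diff_nonneg)
  moreover have "0 \<le> quad_form ?K3 J c \<alpha>" using J \<alpha> c b by (intro quad_form_reg_log_nonneg) auto
  ultimately show ?thesis by linarith
qed

section \<open>Testing continuous functions against a kernel\<close>

text \<open>From (s + 2b)^2 = (s + b)(s + 3b) + b^2. The closed form shows positivity, the decay,
  and the dependence on s / b alone.\<close>

lemma test_kernel_eq:
  assumes "0 < b" "0 \<le> s"
  shows "test_kernel b s = ln (1 + b\<^sup>2 / ((s + b) * (s + 3 * b))) / 2"
proof -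
  have "1 + b\<^sup>2 / ((s + b) * (s + 3 * b)) = (s + 2 * b)\<^sup>2 / ((s + b) * (s + 3 * b))"
  proof -
    have pos: "0 < (s + b) * (s + 3 * b)" using assms by (intro mult_pos_pos) auto
    have "(s + 2 * b)\<^sup>2 = (s + b) * (s + 3 * b) + b\<^sup>2" by (simp add: power2_eq_square algebra_simps)
    moreover have "s + b \<noteq> 0" "s + 3 * b \<noteq> 0" using assms by auto
    ultimately show ?thesis using pos by (simp add: add_divide_distrib)
  qed
  also have "ln \<dots> = 2 * ln (s + 2 * b) - (ln (s + b) + ln (s + 3 * b))"
    using assms by (simp add: ln_div ln_mult ln_realpow)
  finally show ?thesis by (simp add: test_kernel_def reg_log_def)
qed

lemma test_kernel_pos: "0 < b \<Longrightarrow> 0 \<le> s \<Longrightarrow> 0 < test_kernel b s"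
  by (simp add: test_kernel_eq add_nonneg_pos)

lemma test_kernel_nonneg: "0 < b \<Longrightarrow> 0 \<le> s \<Longrightarrow> 0 \<le> test_kernel b s"
  using test_kernel_pos less_imp_le by blast

lemma test_kernel_le:
  assumes "0 < b" "0 \<le> s"
  shows "test_kernel b s \<le> b\<^sup>2 / (2 * (s + b)\<^sup>2)"
proof -
  have "ln (1 + b\<^sup>2 / ((s + b) * (s + 3 * b))) \<le> b\<^sup>2 / ((s + b) * (s + 3 * b))"
    using assms by (intro ln_add_one_self_le_self) auto
  also have "\<dots> \<le> b\<^sup>2 / (s + b)\<^sup>2"
    using assms by (intro divide_left_mono) (auto simp: power2_eq_square)
  finally show ?thesis using assms by (simp add: test_kernel_eq)
qed

lemma test_kernel_le_1: "0 < b \<Longrightarrow> 0 \<le> s \<Longrightarrow> test_kernel b s \<le> 1"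
proof (rule order_trans[OF test_kernel_le])
  assume "0 < b" "0 \<le> s"
  then have "b\<^sup>2 \<le> (s + b)\<^sup>2" by (intro power_mono) auto
  moreover have "0 \<le> (s + b)\<^sup>2" by simp
  ultimately have "b\<^sup>2 \<le> 2 * (s + b)\<^sup>2" by linarith
  then show "b\<^sup>2 / (2 * (s + b)\<^sup>2) \<le> 1" using \<open>0 < b\<close> \<open>0 \<le> s\<close> by (simp add: divide_le_eq_1)
qed

text \<open>The kernel depends on s / b only, so the kernels with parameter d^2 are the dilates by d
  of a single profile and form an approximate identity after normalisation.\<close>

lemma test_kernel_scale: "0 < d \<Longrightarrow> 0 \<le> s \<Longrightarrow> test_kernel (d\<^sup>2) (d\<^sup>2 * s) = test_kernel 1 s"
proof -
  assume d: "0 < d" and s: "0 \<le> s"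
  have "(d\<^sup>2 * s + d\<^sup>2) * (d\<^sup>2 * s + 3 * d\<^sup>2) = (d\<^sup>2)\<^sup>2 * ((s + 1) * (s + 3))"
    by (simp add: algebra_simps power2_eq_square)
  then show ?thesis using d s by (simp add: test_kernel_eq)
qed

lemma measurable_test_kernel [measurable]:
  assumes "0 < b"
  shows "(\<lambda>z::complex. test_kernel b ((cmod z)\<^sup>2)) \<in> borel_measurable borel"
  by (intro borel_measurable_continuous_onI continuous_on_compose2[OF continuous_on_test_kernel[OF assms]] continuous_intros) auto

lemma integrable_test_kernel: "integrable lborel (\<lambda>z::complex. test_kernel 1 ((cmod z)\<^sup>2))"
proof (rule Bochner_Integration.integrable_bound)
  show "integrable lborel (\<lambda>z::complex. 2 * (1 / (1 + cmod z) ^ 4))"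
    by (rule integrable_mult_right) (rule integrable_inverse_power4)
  have "test_kernel 1 (r\<^sup>2) \<le> 2 * (1 / (1 + r) ^ 4)" if r: "0 \<le> r" for r :: real
  proof -
    have "(1 + r)\<^sup>2 \<le> 2 * (r\<^sup>2 + 1)"
      using zero_le_power2[of "r - 1"] by (simp add: power2_eq_square algebra_simps)
    then have "((1 + r)\<^sup>2)\<^sup>2 \<le> (2 * (r\<^sup>2 + 1))\<^sup>2" by (intro power_mono) auto
    then have *: "(1 + r) ^ 4 \<le> 4 * (r\<^sup>2 + 1)\<^sup>2"
      by (simp add: power2_eq_square power4_eq_xxxx algebra_simps)
    have "test_kernel 1 (r\<^sup>2) \<le> 1 / (2 * (r\<^sup>2 + 1)\<^sup>2)" using test_kernel_le[of 1 "r\<^sup>2"] by simp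
    also have "\<dots> = 2 / (4 * (r\<^sup>2 + 1)\<^sup>2)" by (simp add: field_simps)
    also have "\<dots> \<le> 2 / (1 + r) ^ 4"
    proof (intro divide_left_mono mult_pos_pos *)
      have "0 < r\<^sup>2 + 1" by (simp add: add_nonneg_pos)
      then show "0 < (r\<^sup>2 + 1)\<^sup>2" by (rule zero_less_power)
      show "0 < (1 + r) ^ 4" using r by (intro zero_less_power) linarith
    qed auto
    finally show ?thesis by simp
  qed
  moreover have "0 \<le> test_kernel 1 (r\<^sup>2)" for r :: real by (intro test_kernel_nonneg) auto
  ultimately show "AE z in lborel. norm (test_kernel 1 ((cmod z)\<^sup>2)) \<le> norm (2 * (1 / (1 + cmod z) ^ 4))"
    by (intro AE_I2) (simp add: abs_mult)
qed auto

lemma test_kernel_mass_pos: "0 < (\<integral>z. test_kernel 1 ((cmod z)\<^sup>2) \<partial>lborel)"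
proof (rule ccontr)
  have pos: "0 < test_kernel 1 ((cmod z)\<^sup>2)" for z by (intro test_kernel_pos) auto
  assume "\<not> ?thesis"
  moreover have "0 \<le> (\<integral>z. test_kernel 1 ((cmod z)\<^sup>2) \<partial>lborel)"
    using pos by (intro Bochner_Integration.integral_nonneg) (simp add: less_imp_le)
  ultimately have "(\<integral>z. test_kernel 1 ((cmod z)\<^sup>2) \<partial>lborel) = 0" by linarith
  then have "AE v in lborel. test_kernel 1 ((cmod v)\<^sup>2) = 0"
    using integral_nonneg_eq_0_iff_AE[OF integrable_test_kernel] pos by (simp add: less_imp_le)
  then have "AE v::complex in lborel. False" by eventually_elim (metis pos less_irrefl)
  then show False by (simp add: eventually_False ae_filter_eq_bot_iff)
qed

lemma compactly_supported_prob_return: "compactly_supported_prob (return borel x)"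
  by (rule compactly_supported_probI[where R = "cmod x"]) (auto simp: prob_space_return AE_return)

lemma ker_int_return:
  assumes "compactly_supported_prob \<beta>" "continuous_on {0..} K"
  shows "ker_int K (return borel x) \<beta> = (\<integral>y. K ((cmod (x - y))\<^sup>2) \<partial>\<beta>)"
proof -
  note b = compactly_supported_probD[OF assms(1)]
  interpret b: prob_space \<beta> by (rule b(1))
  interpret a: prob_space "return borel x" by (rule prob_space_return) simp
  interpret pair_prob_space "return borel x" \<beta> ..
  note [measurable_cong] = b(2)
  note [measurable] = measurable_radial_kernel[OF assms(2)]
  have m: "(\<lambda>p. K ((cmod (fst p - snd p))\<^sup>2)) \<in> borel_measurable (borel \<Otimes>\<^sub>M \<beta>)"
    by measurable
  have "ker_int K (return borel x) \<beta> = (\<integral>x. (\<integral>y. K ((cmod (x - y))\<^sup>2) \<partial>\<beta>) \<partial>return borel x)"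
    unfolding ker_int_def
    using integral_fst'[OF integrable_radial_kernel[OF compactly_supported_prob_return assms]] by simp
  also have "\<dots> = (\<integral>y. K ((cmod (x - y))\<^sup>2) \<partial>\<beta>)"
    using m by (intro integral_return b.borel_measurable_lebesgue_integral) (auto simp: case_prod_beta')
  finally show ?thesis .
qed

lemma ker_int_return_return:
  assumes "continuous_on {0..} K"
  shows "ker_int K (return borel x) (return borel y) = K ((cmod (x - y))\<^sup>2)"
proof -
  have "continuous_on UNIV (\<lambda>y. K ((cmod (x - y))\<^sup>2))"
    by (intro continuous_on_compose2[OF assms] continuous_intros) auto
  then show ?thesis
    using assms by (subst ker_int_return)
      (auto intro!: integral_return borel_measurable_continuous_onI compactly_supported_prob_return)
qed

lemma ker_int_sym:
  assumes "compactly_supported_prob \<alpha>" "compactly_supported_prob \<beta>" "continuous_on {0..} K"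
  shows "ker_int K \<alpha> \<beta> = ker_int K \<beta> \<alpha>"
proof -
  interpret a: prob_space \<alpha> using assms compactly_supported_probD by blast
  interpret b: prob_space \<beta> using assms compactly_supported_probD by blast
  interpret pair_prob_space \<alpha> \<beta> ..
  have "(\<lambda>p. K ((cmod (fst p - snd p))\<^sup>2)) \<in> borel_measurable (\<alpha> \<Otimes>\<^sub>M \<beta>)"
    using integrable_radial_kernel[OF assms] by auto
  from integral_product_swap[OF this] show ?thesis
    by (simp add: ker_int_def case_prod_beta' norm_minus_commute)
qed

text \<open>Cauchy--Schwarz against a point mass: the quadratic form of \<open>c + \<lambda> \<delta>\<^sub>u\<close> is nonnegative
  for all \<open>\<lambda>\<close>.\<close>

lemma test_kernel_cauchy_schwarz:
  assumes J: "finite J" and \<alpha>: "\<And>i. i \<in> J \<Longrightarrow> compactly_supported_prob (\<alpha> i)" and b: "0 < b"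
  shows "(\<Sum>i\<in>J. c i * (\<integral>x. test_kernel b ((cmod (u - x))\<^sup>2) \<partial>\<alpha> i))\<^sup>2 \<le> quad_form (test_kernel b) J c \<alpha>"
proof -
  let ?K = "test_kernel b"
  note cont = continuous_on_test_kernel[OF b]
  define m where "m = (\<Sum>i\<in>J. c i * (\<integral>x. ?K ((cmod (u - x))\<^sup>2) \<partial>\<alpha> i))"
  \<comment> \<open>The index \<open>None\<close> carries the additional point mass at u, with free
    weight l.\<close>
  define \<alpha>' where "\<alpha>' = case_option (return borel u) \<alpha>"
  define c' where "c' l = case_option l c" for l
  let ?J = "insert None (Some ` J)"
  have K0: "0 < ?K 0" "?K 0 \<le> 1" using b test_kernel_pos test_kernel_le_1 by auto
  have *: "0 \<le> quad_form ?K J c \<alpha> + 2 * l * m + l\<^sup>2 * ?K 0" for l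
  proof -
    have "0 \<le> quad_form ?K ?J (c' l) \<alpha>'"
      using J \<alpha> by (intro quad_form_test_nonneg b) (auto simp: \<alpha>'_def compactly_supported_prob_return)
    also have "\<dots> = l\<^sup>2 * ker_int ?K (return borel u) (return borel u)
      + (\<Sum>i\<in>J. l * c i * ker_int ?K (return borel u) (\<alpha> i))
      + ((\<Sum>i\<in>J. c i * l * ker_int ?K (\<alpha> i) (return borel u)) + quad_form ?K J c \<alpha>)"
      using J unfolding quad_form_def
      by (simp add: sum.insert sum.reindex c'_def \<alpha>'_def sum.distrib power2_eq_square)
    also have "(\<Sum>i\<in>J. c i * l * ker_int ?K (\<alpha> i) (return borel u)) = l * m"
      unfolding m_def sum_distrib_left
      by (intro sum.cong refl)
         (simp add: ker_int_sym[OF \<alpha> compactly_supported_prob_return cont] ker_int_return[OF \<alpha> cont])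
    also have "(\<Sum>i\<in>J. l * c i * ker_int ?K (return borel u) (\<alpha> i)) = l * m"
      unfolding m_def sum_distrib_left by (intro sum.cong refl) (simp add: ker_int_return[OF \<alpha> cont])
    also have "ker_int ?K (return borel u) (return borel u) = ?K 0"
      by (simp add: ker_int_return_return[OF cont])
    finally show ?thesis by (simp add: algebra_simps)
  qed
  \<comment> \<open>The minimum over l of the quadratic polynomial in \<open>*\<close>.\<close>
  from *[of "- m / ?K 0"] have "m\<^sup>2 \<le> ?K 0 * quad_form ?K J c \<alpha>"
    using K0 by (simp add: field_simps power2_eq_square)
  also have "\<dots> \<le> 1 * quad_form ?K J c \<alpha>"
    using K0 quad_form_test_nonneg[OF J \<alpha> b] by (intro mult_right_mono) auto
  finally show ?thesis by (simp add: m_def)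
qed

lemma lborel_integral_complex_affine:
  fixes f :: "complex \<Rightarrow> real"
  assumes d: "0 < d" and [measurable]: "f \<in> borel_measurable borel"
  shows "(\<integral>u. f u \<partial>lborel) = d\<^sup>2 * (\<integral>y. f (x - d *\<^sub>R y) \<partial>lborel)"
proof -
  have "lborel = density (distr lborel borel (\<lambda>y::complex. x - d *\<^sub>R y)) (\<lambda>_. ennreal (d\<^sup>2))"
    using lborel_affine[of "- d" x] d by simp
  then have "(\<integral>u. f u \<partial>lborel) = (\<integral>u. f u \<partial>density (distr lborel borel (\<lambda>y::complex. x - d *\<^sub>R y)) (\<lambda>_. ennreal (d\<^sup>2)))"
    by simp
  also have "\<dots> = (\<integral>u. d\<^sup>2 * f u \<partial>distr lborel borel (\<lambda>y::complex. x - d *\<^sub>R y))"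
    by (subst integral_density) auto
  also have "\<dots> = (\<integral>y. d\<^sup>2 * f (x - d *\<^sub>R y) \<partial>lborel)"
    by (rule integral_distr) auto
  finally show ?thesis by simp
qed

text \<open>Far out, for |y| at least n, the kernel has little mass and the oscillation of g is at
  most 2 G; for smaller |y| the displacement d |y| lies below the modulus of continuity. Neither
  estimate depends on x.\<close>

lemma mollifier_uniform:
  fixes g :: "complex \<Rightarrow> real"
  assumes g: "uniformly_continuous_on UNIV g" and G: "\<And>x. \<bar>g x\<bar> \<le> G" and e: "0 < e"
  obtains d where "0 < d"
    "\<And>x. \<bar>(\<integral>y. test_kernel 1 ((cmod y)\<^sup>2) * (g (x - d *\<^sub>R y) - g x) \<partial>lborel)\<bar> \<le> e"
proof -
  let ?k = "\<lambda>y::complex. test_kernel 1 ((cmod y)\<^sup>2)"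
  have k0: "0 \<le> ?k y" for y by (intro test_kernel_nonneg) auto
  have gc: "continuous_on UNIV g" using g by (rule uniformly_continuous_imp_continuous)
  have [measurable]: "g \<in> borel_measurable borel" using gc by (rule borel_measurable_continuous_onI)
  have [measurable]: "?k \<in> borel_measurable borel" by (rule measurable_test_kernel) simp
  have G0: "0 \<le> G" using G[of 0] by simp
  define T where "T = (\<integral>y. ?k y \<partial>lborel)"
  have T: "0 < T" unfolding T_def by (rule test_kernel_mass_pos)
  have "(\<lambda>n. \<integral>y. ?k y * indicator {y. real n \<le> cmod y} y \<partial>lborel) \<longlonglongrightarrow> (\<integral>y. 0 \<partial>(lborel :: complex measure))"
  proof (rule integral_dominated_convergence[where w = ?k])
    show "integrable lborel ?k" by (rule integrable_test_kernel)
    show "AE x in lborel. (\<lambda>n. ?k x * indicator {y. real n \<le> cmod y} x) \<longlonglongrightarrow> 0"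
    proof (intro AE_I2 tendsto_eventually)
      fix x :: complex
      obtain n0 :: nat where "cmod x < n0" using reals_Archimedean2 by blast
      then show "\<forall>\<^sub>F n in sequentially. ?k x * indicator {y. real n \<le> cmod y} x = 0"
        by (intro eventually_sequentiallyI[of n0]) auto
    qed
    show "AE x in lborel. norm (?k x * indicator {y. real n \<le> cmod y} x) \<le> ?k x" for n
      using k0 by (intro AE_I2) (auto simp: indicator_def)
  qed auto
  \<comment> \<open>With this threshold the tail contributes at most 2 G e / (4 G + 1), which is at
    most e / 2; the summand 1 covers G = 0.\<close>
  then have "\<forall>\<^sub>F n in sequentially. (\<integral>y. ?k y * indicator {y. real n \<le> cmod y} y \<partial>lborel) < e / (4 * G + 1)"
    using e G0 by (intro order_tendstoD) auto
  then obtain n where n: "(\<integral>y. ?k y * indicator {y. real n \<le> cmod y} y \<partial>lborel) < e / (4 * G + 1)"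
    by (auto simp: eventually_sequentially)
  obtain r where r: "0 < r" "\<And>x y. dist y x < r \<Longrightarrow> dist (g y) (g x) < e / (2 * T)"
    using g e T unfolding uniformly_continuous_on_def by (metis UNIV_I divide_pos_pos mult_pos_pos zero_less_numeral)
  \<comment> \<open>So that d |y| < r whenever |y| < n.\<close>
  define d where "d = r / (real n + 1)"
  have d: "0 < d" using r by (simp add: d_def)
  show ?thesis
  proof (rule that[OF d])
    fix x
    have pw: "\<bar>?k y * (g (x - d *\<^sub>R y) - g x)\<bar> \<le> ?k y * (e / (2 * T)) + 2 * G * (?k y * indicator {y. real n \<le> cmod y} y)" for y
    proof (cases "real n \<le> cmod y")
      case True
      have "\<bar>g (x - d *\<^sub>R y) - g x\<bar> \<le> 2 * G" using G[of x] G[of "x - d *\<^sub>R y"] by linarith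
      then have "?k y * \<bar>g (x - d *\<^sub>R y) - g x\<bar> \<le> ?k y * (2 * G)" using k0 by (intro mult_left_mono) auto
      moreover have "0 \<le> ?k y * (e / (2 * T))" using k0 e T by auto
      ultimately show ?thesis using True k0[of y] by (simp add: abs_mult mult_ac)
    next
      case False
      have "dist (x - d *\<^sub>R y) x = d * cmod y" using d by (simp add: dist_norm)
      also have "\<dots> < d * (real n + 1)" using False d by (intro mult_strict_left_mono) auto
      also have "\<dots> = r" by (simp add: d_def)
      finally have "\<bar>g (x - d *\<^sub>R y) - g x\<bar> \<le> e / (2 * T)" using r(2) by (fastforce simp: dist_real_def)
      then have "?k y * \<bar>g (x - d *\<^sub>R y) - g x\<bar> \<le> ?k y * (e / (2 * T))" using k0 by (intro mult_left_mono) auto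
      then show ?thesis using False k0[of y] by (simp add: abs_mult)
    qed
    have int1: "integrable lborel (\<lambda>y. ?k y * indicator {y. real n \<le> cmod y} y)"
      using integrable_test_kernel by (rule integrable_real_mult_indicator[rotated]) auto
    have int2: "integrable lborel (\<lambda>y. ?k y * (e / (2 * T)) + 2 * G * (?k y * indicator {y. real n \<le> cmod y} y))"
      using int1 integrable_test_kernel by (intro Bochner_Integration.integrable_add integrable_mult_right integrable_mult_left)
    have int3: "integrable lborel (\<lambda>y. ?k y * (g (x - d *\<^sub>R y) - g x))"
      by (rule Bochner_Integration.integrable_bound[OF int2]) (use pw in \<open>auto intro!: AE_I2 order_trans[OF _ abs_ge_self]\<close>)
    have "\<bar>(\<integral>y. ?k y * (g (x - d *\<^sub>R y) - g x) \<partial>lborel)\<bar> \<le> (\<integral>y. \<bar>?k y * (g (x - d *\<^sub>R y) - g x)\<bar> \<partial>lborel)"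
      by (rule integral_abs_bound)
    also have "\<dots> \<le> (\<integral>y. ?k y * (e / (2 * T)) + 2 * G * (?k y * indicator {y. real n \<le> cmod y} y) \<partial>lborel)"
      by (intro integral_mono int2 integrable_abs int3 pw)
    also have "\<dots> = T * (e / (2 * T)) + 2 * G * (\<integral>y. ?k y * indicator {y. real n \<le> cmod y} y \<partial>lborel)"
      using int1 integrable_test_kernel by (subst Bochner_Integration.integral_add) (auto simp: T_def)
    also have "\<dots> \<le> e / 2 + 2 * G * (e / (4 * G + 1))"
      using n T G0 by (intro add_mono mult_left_mono) auto
    also have "\<dots> \<le> e" using G0 e by (simp add: field_simps)
    finally show "\<bar>(\<integral>y. ?k y * (g (x - d *\<^sub>R y) - g x) \<partial>lborel)\<bar> \<le> e" .
  qed
qed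

text \<open>The convolution h of g with the test kernel, divided by b T, is uniformly within e of g.
  By Fubini, integrating h against \<alpha> i is integrating g against the potential of \<alpha> i,
  and the weighted sum of these potentials is bounded at every point by the square root of the form.
  The constants b and C depend on g and e only, not on the family, so they serve for every number of
  particles at once.\<close>

lemma test_function_bound:
  fixes g :: "complex \<Rightarrow> real"
  assumes g: "continuous_on UNIV g" and supp: "\<And>z. R < cmod z \<Longrightarrow> g z = 0" and e: "0 < e"
  obtains b C where "0 < b" "0 \<le> C"
    "\<And>(J::'i set) (c::'i \<Rightarrow> real) (\<alpha>::'i \<Rightarrow> complex measure). finite J \<Longrightarrow> (\<And>i. i \<in> J \<Longrightarrow> compactly_supported_prob (\<alpha> i)) \<Longrightarrow>
      \<bar>\<Sum>i\<in>J. c i * (\<integral>x. g x \<partial>\<alpha> i)\<bar> \<le> e * (\<Sum>i\<in>J. \<bar>c i\<bar>) + C * sqrt (quad_form (test_kernel b) J c \<alpha>)"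
proof -
  let ?k = "\<lambda>y::complex. test_kernel 1 ((cmod y)\<^sup>2)"
  have uc: "uniformly_continuous_on UNIV g"
  proof -
    have "uniformly_continuous_on (cball 0 (R + 1)) g"
      by (intro compact_uniformly_continuous continuous_on_subset[OF g]) auto
    show ?thesis unfolding uniformly_continuous_on_def
    proof (intro allI impI)
      fix \<epsilon> :: real assume \<epsilon>: "0 < \<epsilon>"
      obtain d where d: "0 < d" "\<And>x y. x \<in> cball 0 (R + 1) \<Longrightarrow> y \<in> cball 0 (R + 1) \<Longrightarrow> dist y x < d \<Longrightarrow> dist (g y) (g x) < \<epsilon>"
        using \<open>uniformly_continuous_on (cball 0 (R + 1)) g\<close> \<epsilon> unfolding uniformly_continuous_on_def by metis
      show "\<exists>d>0. \<forall>x\<in>UNIV. \<forall>x'\<in>UNIV. dist x' x < d \<longrightarrow> dist (g x') (g x) < \<epsilon>"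
      \<comment> \<open>Points at distance below 1 either both lie in the disc of radius R + 1, or
        both lie outside the disc of radius R, where g vanishes.\<close>
      proof (intro exI[of _ "min d 1"] conjI ballI impI)
        fix x x' :: complex assume x: "dist x' x < min d 1"
        show "dist (g x') (g x) < \<epsilon>"
        proof (cases "cmod x \<le> R + 1 \<and> cmod x' \<le> R + 1")
          case True then show ?thesis using d x by auto
        next
          case False
          have "\<bar>cmod x - cmod x'\<bar> < 1" using x norm_triangle_ineq3[of x x'] by (simp add: dist_norm norm_minus_commute)
          with False have "R < cmod x" "R < cmod x'" by auto
          then show ?thesis using supp \<epsilon> by simp
        qed
      qed (use d in auto)
    qed
  qed
  have "bounded (g ` cball 0 R)" by (intro compact_imp_bounded compact_continuous_image continuous_on_subset[OF g]) auto
  then obtain G where G': "\<And>x. x \<in> cball 0 R \<Longrightarrow> \<bar>g x\<bar> \<le> G" "0 < G" by (metis (no_types, lifting) bounded_pos imageI real_norm_def)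
  have G: "\<bar>g x\<bar> \<le> G" for x using G' supp[of x] by (cases "cmod x \<le> R") auto
  have [measurable]: "g \<in> borel_measurable borel" using g by (rule borel_measurable_continuous_onI)
  have gint: "integrable lborel g"
  proof (rule Bochner_Integration.integrable_bound)
    show "integrable lborel (\<lambda>x::complex. G * indicator (cball 0 R) x)"
      by (intro integrable_mult_right integrable_real_indicator emeasure_lborel_cball_finite) auto
    show "AE x in lborel. norm (g x) \<le> norm (G * indicator (cball 0 R) x)"
      using G' supp by (intro AE_I2) (auto simp: indicator_def)
  qed auto
  define T where "T = (\<integral>y. ?k y \<partial>lborel)"
  have T: "0 < T" unfolding T_def by (rule test_kernel_mass_pos)
  obtain d where d: "0 < d"
    "\<And>x. \<bar>(\<integral>y. ?k y * (g (x - d *\<^sub>R y) - g x) \<partial>lborel)\<bar> \<le> e * T"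
    using mollifier_uniform[OF uc G, of "e * T"] e T by auto
  \<comment> \<open>Squared, because the kernel takes squared distances; the dilated kernel then has
    total mass b T.\<close>
  define b where "b = d\<^sup>2"
  have b: "0 < b" using d by (simp add: b_def)
  have [measurable]: "(\<lambda>z::complex. test_kernel b ((cmod z)\<^sup>2)) \<in> borel_measurable borel" by (rule measurable_test_kernel[OF b])
  have tk: "0 \<le> test_kernel b ((cmod z)\<^sup>2)" "test_kernel b ((cmod z)\<^sup>2) \<le> 1" for z
    using b by (auto intro: test_kernel_nonneg test_kernel_le_1)
  define h where "h x = (\<integral>u. test_kernel b ((cmod (u - x))\<^sup>2) * g u \<partial>lborel)" for x
  have hint: "integrable lborel (\<lambda>u. test_kernel b ((cmod (u - x))\<^sup>2) * g u)" for x
    by (rule Bochner_Integration.integrable_bound[OF gint]) (use tk in \<open>auto simp: abs_mult intro!: mult_left_le_one_le\<close>)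
  have approx: "\<bar>h x / b - T * g x\<bar> \<le> e * T" for x
  proof -
    have [measurable]: "?k \<in> borel_measurable borel" by (rule measurable_test_kernel) simp
    have "h x = b * (\<integral>y. test_kernel b ((cmod ((x - d *\<^sub>R y) - x))\<^sup>2) * g (x - d *\<^sub>R y) \<partial>lborel)"
    proof -
      have "(\<lambda>u. test_kernel b ((cmod (u - x))\<^sup>2) * g u) \<in> borel_measurable borel" by measurable
      from lborel_integral_complex_affine[OF d(1) this, of x] show ?thesis
        unfolding h_def b_def[symmetric] .
    qed
    also have "(\<lambda>y. test_kernel b ((cmod ((x - d *\<^sub>R y) - x))\<^sup>2) * g (x - d *\<^sub>R y)) = (\<lambda>y. ?k y * g (x - d *\<^sub>R y))"
      using d(1) by (auto simp: b_def power_mult_distrib test_kernel_scale)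
    finally have 1: "h x / b = (\<integral>y. ?k y * g (x - d *\<^sub>R y) \<partial>lborel)" using b by simp
    have int1: "integrable lborel (\<lambda>y. ?k y * g (x - d *\<^sub>R y))"
      by (rule Bochner_Integration.integrable_bound[OF integrable_mult_left[OF integrable_test_kernel, of G]])
         (use G G' in \<open>auto simp: abs_mult intro!: mult_left_mono\<close>)
    have "(\<integral>y. ?k y * (g (x - d *\<^sub>R y) - g x) \<partial>lborel) = (\<integral>y. ?k y * g (x - d *\<^sub>R y) - ?k y * g x \<partial>lborel)"
      by (simp add: right_diff_distrib)
    also have "\<dots> = h x / b - T * g x"
      using int1 integrable_test_kernel by (subst Bochner_Integration.integral_diff) (auto simp: 1 T_def)
    finally show ?thesis using d(2)[of x] by simp
  qed
  \<comment> \<open>The L1 norm of g divided by the mass of the mollifier.\<close>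
  define C where "C = (\<integral>u. \<bar>g u\<bar> \<partial>lborel) / (b * T)"
  show ?thesis
  proof (rule that[OF b])
    show "0 \<le> C" using b T by (simp add: C_def)
    fix J :: "'i set" and c :: "'i \<Rightarrow> real" and \<alpha>
    assume J: "finite J" and \<alpha>: "\<And>i. i \<in> J \<Longrightarrow> compactly_supported_prob (\<alpha> i)"
    define D where "D = quad_form (test_kernel b) J c \<alpha>"
    have D: "0 \<le> D" unfolding D_def using J \<alpha> b by (rule quad_form_test_nonneg)
    define A where "A i u = (\<integral>x. test_kernel b ((cmod (u - x))\<^sup>2) \<partial>\<alpha> i)" for i u
    have m: "\<bar>\<Sum>i\<in>J. c i * A i u\<bar> \<le> sqrt D" for u
    proof -
      have "(\<Sum>i\<in>J. c i * A i u)\<^sup>2 \<le> D"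
        unfolding A_def D_def by (rule test_kernel_cauchy_schwarz[OF J _ b]) (rule \<alpha>)
      then show ?thesis by (intro real_le_rsqrt) simp
    qed
    have sw: "integrable lborel (\<lambda>u. A i u * g u)" "(\<integral>x. h x \<partial>\<alpha> i) = (\<integral>u. A i u * g u \<partial>lborel)"
      "integrable (\<alpha> i) h" if i: "i \<in> J" for i
    proof -
      note a = compactly_supported_probD[OF \<alpha>[OF i]]
      interpret a: prob_space "\<alpha> i" by (rule a(1))
      note [measurable_cong] = a(2)
      interpret Q: pair_sigma_finite "\<alpha> i" "lborel :: complex measure" ..
      define F where "F x u = test_kernel b ((cmod (u - x))\<^sup>2) * g u" for x u
      have Fb: "norm (F x u) \<le> \<bar>g u\<bar>" for x u unfolding F_def using tk by (auto simp: abs_mult intro!: mult_left_le_one_le)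
      have [measurable]: "case_prod F \<in> borel_measurable (\<alpha> i \<Otimes>\<^sub>M lborel)" unfolding F_def by measurable
      have F1: "integrable lborel (F x)" for x unfolding F_def using hint .
      have int: "integrable (\<alpha> i \<Otimes>\<^sub>M lborel) (case_prod F)"
      proof (rule Q.Fubini_integrable)
        show "AE p in \<alpha> i. integrable lborel (\<lambda>y. case_prod F (p, y))" using F1 by simp
        show "integrable (\<alpha> i) (\<lambda>p. \<integral>y. norm (case_prod F (p, y)) \<partial>lborel)"
        proof (rule a.integrable_const_bound)
          show "AE p in \<alpha> i. norm (\<integral>y. norm (case_prod F (p, y)) \<partial>lborel) \<le> (\<integral>u. \<bar>g u\<bar> \<partial>lborel)"
          proof (intro AE_I2)
            fix p
            have "(\<integral>y. norm (case_prod F (p, y)) \<partial>lborel) \<le> (\<integral>u. \<bar>g u\<bar> \<partial>lborel)"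
              unfolding prod.case by (intro integral_mono integrable_norm F1 integrable_abs gint Fb)
            then show "norm (\<integral>y. norm (case_prod F (p, y)) \<partial>lborel) \<le> (\<integral>u. \<bar>g u\<bar> \<partial>lborel)" by simp
          qed
        qed measurable
      qed measurable
      have eq: "(\<integral>x. F x u \<partial>\<alpha> i) = A i u * g u" for u by (simp add: F_def A_def)
      show "integrable lborel (\<lambda>u. A i u * g u)" using Q.integrable_snd[OF int] by (simp add: eq)
      show "integrable (\<alpha> i) h" using Q.integrable_fst[OF int] by (simp add: F_def h_def[abs_def])
      show "(\<integral>x. h x \<partial>\<alpha> i) = (\<integral>u. A i u * g u \<partial>lborel)"
        using Q.Fubini_integral[OF int] by (simp add: eq) (simp add: F_def h_def)
    qed
    have "(\<Sum>i\<in>J. c i * (\<integral>x. h x \<partial>\<alpha> i)) = (\<Sum>i\<in>J. (\<integral>u. c i * (A i u * g u) \<partial>lborel))"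
      by (intro sum.cong refl) (simp add: sw(2))
    also have "\<dots> = (\<integral>u. (\<Sum>i\<in>J. c i * (A i u * g u)) \<partial>lborel)"
      using sw(1) by (intro Bochner_Integration.integral_sum[symmetric] integrable_mult_right)
    finally have eq: "(\<Sum>i\<in>J. c i * (\<integral>x. h x \<partial>\<alpha> i)) = (\<integral>u. (\<Sum>i\<in>J. c i * (A i u * g u)) \<partial>lborel)" .
    have "\<bar>\<Sum>i\<in>J. c i * (\<integral>x. h x \<partial>\<alpha> i)\<bar> \<le> (\<integral>u. \<bar>\<Sum>i\<in>J. c i * (A i u * g u)\<bar> \<partial>lborel)"
      unfolding eq by (rule integral_abs_bound)
    also have "\<dots> \<le> (\<integral>u. sqrt D * \<bar>g u\<bar> \<partial>lborel)"
    proof (intro integral_mono integrable_abs Bochner_Integration.integrable_sum integrable_mult_right sw(1) gint)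
      fix u
      have "(\<Sum>i\<in>J. c i * (A i u * g u)) = (\<Sum>i\<in>J. c i * A i u) * g u" by (simp add: sum_distrib_right mult.assoc)
      then show "\<bar>\<Sum>i\<in>J. c i * (A i u * g u)\<bar> \<le> sqrt D * \<bar>g u\<bar>" using m[of u] by (simp add: abs_mult mult_right_mono)
    qed
    finally have 1: "\<bar>\<Sum>i\<in>J. c i * (\<integral>x. h x \<partial>\<alpha> i)\<bar> \<le> sqrt D * (\<integral>u. \<bar>g u\<bar> \<partial>lborel)" by simp
    have 2: "\<bar>(\<integral>x. g x \<partial>\<alpha> i) - (\<integral>x. h x \<partial>\<alpha> i) / (b * T)\<bar> \<le> e" if i: "i \<in> J" for i
    proof -
      note a = compactly_supported_probD[OF \<alpha>[OF i]]
      interpret a: prob_space "\<alpha> i" by (rule a(1))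
      note [measurable_cong] = a(2)
      have gi: "integrable (\<alpha> i) g" using G by (intro a.integrable_const_bound[where B = G]) auto
      have hi: "integrable (\<alpha> i) (\<lambda>x. h x / (b * T))" using sw(3)[OF i] by simp
      have "(\<integral>x. g x \<partial>\<alpha> i) - (\<integral>x. h x \<partial>\<alpha> i) / (b * T) = (\<integral>x. g x - h x / (b * T) \<partial>\<alpha> i)"
        using gi hi by (subst Bochner_Integration.integral_diff) auto
      also have "\<bar>\<dots>\<bar> \<le> (\<integral>x. \<bar>g x - h x / (b * T)\<bar> \<partial>\<alpha> i)" by (rule integral_abs_bound)
      also have "\<dots> \<le> (\<integral>x. e \<partial>\<alpha> i)"
      proof (intro integral_mono integrable_abs Bochner_Integration.integrable_diff gi hi)
        fix x
        have "\<bar>g x - h x / (b * T)\<bar> = \<bar>h x / b - T * g x\<bar> / T"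
        proof -
          have "g x - h x / (b * T) = - ((h x / b - T * g x) / T)" using T b by (simp add: field_simps)
          then show ?thesis using T by (simp add: abs_divide)
        qed
        also have "\<dots> \<le> e" using approx[of x] T by (simp add: field_simps)
        finally show "\<bar>g x - h x / (b * T)\<bar> \<le> e" .
      qed simp
      finally show ?thesis by (simp add: a.prob_space)
    qed
    have "(\<Sum>i\<in>J. c i * (\<integral>x. g x \<partial>\<alpha> i)) =
      (\<Sum>i\<in>J. c i * ((\<integral>x. g x \<partial>\<alpha> i) - (\<integral>x. h x \<partial>\<alpha> i) / (b * T))) + (\<Sum>i\<in>J. c i * (\<integral>x. h x \<partial>\<alpha> i)) / (b * T)"
      by (simp add: right_diff_distrib sum_subtractf sum_divide_distrib)
    also have "\<bar>\<dots>\<bar> \<le> \<bar>\<Sum>i\<in>J. c i * ((\<integral>x. g x \<partial>\<alpha> i) - (\<integral>x. h x \<partial>\<alpha> i) / (b * T))\<bar> + \<bar>(\<Sum>i\<in>J. c i * (\<integral>x. h x \<partial>\<alpha> i)) / (b * T)\<bar>"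
      by (rule abs_triangle_ineq)
    also have "\<dots> \<le> e * (\<Sum>i\<in>J. \<bar>c i\<bar>) + C * sqrt D"
    proof (rule add_mono)
      show "\<bar>\<Sum>i\<in>J. c i * ((\<integral>x. g x \<partial>\<alpha> i) - (\<integral>x. h x \<partial>\<alpha> i) / (b * T))\<bar> \<le> e * (\<Sum>i\<in>J. \<bar>c i\<bar>)"
        unfolding sum_distrib_left
      proof (intro order_trans[OF sum_abs] sum_mono)
        fix i assume "i \<in> J"
        from mult_left_mono[OF 2[OF this] abs_ge_zero[of "c i"]]
        show "\<bar>c i * ((\<integral>x. g x \<partial>\<alpha> i) - (\<integral>x. h x \<partial>\<alpha> i) / (b * T))\<bar> \<le> e * \<bar>c i\<bar>"
          by (simp add: abs_mult mult.commute)
      qed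
      show "\<bar>(\<Sum>i\<in>J. c i * (\<integral>x. h x \<partial>\<alpha> i)) / (b * T)\<bar> \<le> C * sqrt D"
        using 1 b T by (simp add: C_def abs_divide divide_right_mono mult.commute)
    qed
    finally show "\<bar>\<Sum>i\<in>J. c i * (\<integral>x. g x \<partial>\<alpha> i)\<bar> \<le> e * (\<Sum>i\<in>J. \<bar>c i\<bar>) + C * sqrt (quad_form (test_kernel b) J c \<alpha>)"
      by (simp add: D_def)
  qed
qed

section \<open>Logarithmic energy\<close>

definition log_energy :: "complex measure \<Rightarrow> complex measure \<Rightarrow> real" where
  "log_energy \<alpha> \<beta> = (\<integral>p. - ln (cmod (fst p - snd p)) \<partial>(\<alpha> \<Otimes>\<^sub>M \<beta>))"

text \<open>Since \<open>ln 0 = 0\<close> in the library, finiteness of the energy also requires the diagonal to be null.\<close>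

definition finite_log_energy :: "complex measure \<Rightarrow> complex measure \<Rightarrow> bool" where
  "finite_log_energy \<alpha> \<beta> \<longleftrightarrow> integrable (\<alpha> \<Otimes>\<^sub>M \<beta>) (\<lambda>p. ln (cmod (fst p - snd p))) \<and>
    (AE p in \<alpha> \<Otimes>\<^sub>M \<beta>. fst p \<noteq> snd p)"

text \<open>A density bounded by M, expressed as domination by M times Lebesgue measure, so that no
  density function has to be chosen.\<close>

definition bounded_density :: "real \<Rightarrow> complex measure \<Rightarrow> bool" where
  "bounded_density M \<alpha> \<longleftrightarrow> 0 \<le> M \<and> sets \<alpha> = sets borel \<and>
    (\<forall>A\<in>sets borel. emeasure \<alpha> A \<le> ennreal M * emeasure lborel A)"

lemma nn_integral_bounded_density:
  assumes "bounded_density M \<alpha>" and [measurable]: "f \<in> borel_measurable borel"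
  shows "(\<integral>\<^sup>+x. f x \<partial>\<alpha>) \<le> ennreal M * (\<integral>\<^sup>+x. f x \<partial>lborel)"
proof -
  have s: "sets \<alpha> = sets borel" using assms by (simp add: bounded_density_def)
  have sp: "space \<alpha> = UNIV" using sets_eq_imp_space_eq[OF s] by simp
  let ?D = "density lborel (\<lambda>_::complex. ennreal M)"
  have "emeasure \<alpha> A \<le> emeasure ?D A" for A
  proof (cases "A \<in> sets borel")
    case True then show ?thesis using assms(1) by (simp add: bounded_density_def emeasure_density nn_integral_cmult_indicator)
  next
    case False then show ?thesis using s by (simp add: emeasure_notin_sets)
  qed
  then have "\<alpha> \<le> ?D" using s sp by (simp add: le_measure_iff le_fun_def)
  then have "(\<integral>\<^sup>+x. f x \<partial>\<alpha>) \<le> (\<integral>\<^sup>+x. f x \<partial>?D)" using s by (intro nn_integral_mono_measure) auto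
  also have "\<dots> = (\<integral>\<^sup>+x. ennreal M * f x \<partial>lborel)" by (subst nn_integral_density) auto
  also have "\<dots> = ennreal M * (\<integral>\<^sup>+x. f x \<partial>lborel)" by (rule nn_integral_cmult) simp
  finally show ?thesis .
qed

text \<open>The logarithm is applied to r and to 1 / r. At r = 0 both sides are 0 by the conventions
  for \<open>ln 0\<close> and \<open>1 / 0\<close>, so the bound also holds on the diagonal.\<close>

lemma abs_ln_le: "0 \<le> r \<Longrightarrow> \<bar>ln r\<bar> \<le> r + 1 / (r::real)"
proof (cases "r = 0")
  case False
  assume "0 \<le> r"
  with False have r: "0 < r" by simp
  have "ln r \<le> r - 1" "ln (1 / r) \<le> 1 / r - 1" using r by (auto intro!: ln_le_minus_one)
  moreover have "ln (1 / r) = - ln r" using r by (simp add: ln_div)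
  moreover have "0 < 1 / r" using r by simp
  ultimately show ?thesis using r by linarith
qed simp

text \<open>Near z the density bound reduces to the local integral of 1 / |u| over the unit disc,
  which does not depend on z; farther away the integrand is at most 1 and the total mass is
  1.\<close>

lemma bounded_density_inverse_norm:
  assumes "bounded_density M \<alpha>" "prob_space \<alpha>"
  obtains C where "0 \<le> C" "\<And>z. (\<integral>\<^sup>+y. ennreal (1 / cmod (z - y)) \<partial>\<alpha>) \<le> ennreal C"
proof -
  interpret prob_space \<alpha> by fact
  have s: "sets \<alpha> = sets borel" using assms by (simp add: bounded_density_def)
  note [measurable_cong] = s
  have M: "0 \<le> M" using assms by (simp add: bounded_density_def)
  let ?f = "\<lambda>u::complex. ennreal (1 / cmod u) * indicator (cball 0 1) u"
  have "(\<lambda>u::complex. ennreal (1 / cmod u)) \<in> borel_measurable borel" by measurable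
  moreover have "(indicator (cball 0 1) :: complex \<Rightarrow> ennreal) \<in> borel_measurable borel"
    by (rule borel_measurable_indicator) auto
  ultimately have [measurable]: "?f \<in> borel_measurable borel" by (rule borel_measurable_times_ennreal)
  define C0 where "C0 = enn2real (\<integral>\<^sup>+u. ?f u \<partial>lborel)"
  have C0: "(\<integral>\<^sup>+u. ?f u \<partial>lborel) = ennreal C0" "0 \<le> C0"
    using nn_integral_inverse_norm_finite by (auto simp: C0_def)
  show ?thesis
  proof (rule that)
    show "0 \<le> M * C0 + 1" using M C0 by simp
    fix z :: complex
    have "(\<integral>\<^sup>+y. ennreal (1 / cmod (z - y)) \<partial>\<alpha>) \<le> (\<integral>\<^sup>+y. ?f (z - y) + 1 \<partial>\<alpha>)"
      by (intro nn_integral_mono) (auto simp: indicator_def divide_le_eq_1 intro!: ennreal_le_1 split: if_splits)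
    also have "\<dots> = (\<integral>\<^sup>+y. ?f (z - y) \<partial>\<alpha>) + 1"
      by (subst nn_integral_add) (auto simp: emeasure_space_1)
    also have "(\<integral>\<^sup>+y. ?f (z - y) \<partial>\<alpha>) \<le> ennreal M * (\<integral>\<^sup>+y. ?f (z - y) \<partial>lborel)"
      by (rule nn_integral_bounded_density[OF assms(1)]) measurable
    also have "(\<integral>\<^sup>+y. ?f (z - y) \<partial>lborel) = ennreal C0"
      using nn_integral_lborel_reflect[of ?f z] C0 by simp
    also have "ennreal M * ennreal C0 + 1 = ennreal (M * C0 + 1)"
      using M C0 by (simp add: ennreal_plus ennreal_mult)
    finally show "(\<integral>\<^sup>+y. ennreal (1 / cmod (z - y)) \<partial>\<alpha>) \<le> ennreal (M * C0 + 1)"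
      by (simp add: add_right_mono)
  qed
qed

lemma bounded_density_AE_neq:
  assumes "bounded_density M \<alpha>" shows "AE y in \<alpha>. y \<noteq> z"
proof -
  have "emeasure \<alpha> {z} \<le> ennreal M * emeasure lborel {z}"
  proof -
    have "{z} \<in> sets borel" by simp
    then show ?thesis using assms unfolding bounded_density_def by blast
  qed
  then have "emeasure \<alpha> {z} = 0" by simp
  moreover have "{z} \<in> sets \<alpha>" using assms by (simp add: bounded_density_def)
  ultimately have "{z} \<in> null_sets \<alpha>" by (rule null_setsI)
  then show ?thesis by (rule AE_I') auto
qed

lemma integrable_log_bounded_density:
  assumes "compactly_supported_prob \<alpha>" "bounded_density M \<alpha>"
  shows "integrable \<alpha> (\<lambda>y. ln (cmod (z - y)))" "integrable \<alpha> (\<lambda>y. 1 / cmod (z - y))"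
proof -
  note a = compactly_supported_probD[OF assms(1)]
  note [measurable_cong] = a(2)
  interpret prob_space \<alpha> by (rule a(1))
  obtain C where C: "0 \<le> C" "\<And>z. (\<integral>\<^sup>+y. ennreal (1 / cmod (z - y)) \<partial>\<alpha>) \<le> ennreal C"
    using bounded_density_inverse_norm[OF assms(2) a(1)] by blast
  show 1: "integrable \<alpha> (\<lambda>y. 1 / cmod (z - y))"
    using le_less_trans[OF C(2)[of z] ennreal_less_top] by (intro integrableI_bounded) auto
  obtain R where R: "R > 0" "AE x in \<alpha>. cmod x \<le> R" using a by auto
  show "integrable \<alpha> (\<lambda>y. ln (cmod (z - y)))"
  proof (rule Bochner_Integration.integrable_bound)
    show "integrable \<alpha> (\<lambda>y. (cmod z + R) + 1 / cmod (z - y))" using 1 by simp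
    show "AE y in \<alpha>. norm (ln (cmod (z - y))) \<le> norm (cmod z + R + 1 / cmod (z - y))"
      using R(2)
    proof eventually_elim
      fix y assume "cmod y \<le> R"
      then have "cmod (z - y) \<le> cmod z + R" using norm_triangle_ineq4[of z y] by linarith
      moreover have "\<bar>ln (cmod (z - y))\<bar> \<le> cmod (z - y) + 1 / cmod (z - y)" by (rule abs_ln_le) simp
      ultimately show "norm (ln (cmod (z - y))) \<le> norm (cmod z + R + 1 / cmod (z - y))" by simp
    qed
  qed measurable
qed

text \<open>One factor of bounded density is enough: |ln| is dominated by a constant plus 1 / |x -
  y|, whose integral over y is bounded uniformly in x, and points are null for \<beta>, hence so is
  the diagonal. This allows pairing with \<open>\<sigma>\<close>, about whose regularity nothing is
  known.\<close>

lemma finite_log_energy_bounded_density: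
  assumes "compactly_supported_prob \<alpha>" "compactly_supported_prob \<beta>" "bounded_density M \<beta>"
  shows "finite_log_energy \<alpha> \<beta>"
proof -
  note a = compactly_supported_probD[OF assms(1)] and b = compactly_supported_probD[OF assms(2)]
  note [measurable_cong] = a(2) b(2)
  interpret a: prob_space \<alpha> by (rule a(1))
  interpret b: prob_space \<beta> by (rule b(1))
  interpret pair_prob_space \<alpha> \<beta> ..
  obtain C where C: "0 \<le> C" "\<And>z. (\<integral>\<^sup>+y. ennreal (1 / cmod (z - y)) \<partial>\<beta>) \<le> ennreal C"
    using bounded_density_inverse_norm[OF assms(3) b(1)] by blast
  obtain R where R: "0 < R" "AE p in \<alpha> \<Otimes>\<^sub>M \<beta>. (cmod (fst p - snd p))\<^sup>2 \<le> R"
    using AE_cmod_diff_bounded[OF assms(1,2)] .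
  have ln_le: "AE p in \<alpha> \<Otimes>\<^sub>M \<beta>. ennreal \<bar>ln (cmod (fst p - snd p))\<bar> \<le> ennreal (sqrt R) + ennreal (1 / cmod (fst p - snd p))"
    using R(2)
  proof eventually_elim
    fix p :: "complex \<times> complex" assume "(cmod (fst p - snd p))\<^sup>2 \<le> R"
    then have "cmod (fst p - snd p) \<le> sqrt R" by (rule real_le_rsqrt)
    moreover have "\<bar>ln (cmod (fst p - snd p))\<bar> \<le> cmod (fst p - snd p) + 1 / cmod (fst p - snd p)" by (rule abs_ln_le) simp
    ultimately have "ennreal \<bar>ln (cmod (fst p - snd p))\<bar> \<le> ennreal (sqrt R + 1 / cmod (fst p - snd p))"
      by (intro ennreal_leI) linarith
    also have "\<dots> = ennreal (sqrt R) + ennreal (1 / cmod (fst p - snd p))"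
      using R(1) by (intro ennreal_plus) auto
    finally show "ennreal \<bar>ln (cmod (fst p - snd p))\<bar> \<le> ennreal (sqrt R) + ennreal (1 / cmod (fst p - snd p))" .
  qed
  have "(\<integral>\<^sup>+p. ennreal \<bar>ln (cmod (fst p - snd p))\<bar> \<partial>(\<alpha> \<Otimes>\<^sub>M \<beta>)) \<le>
    (\<integral>\<^sup>+p. ennreal (sqrt R) + ennreal (1 / cmod (fst p - snd p)) \<partial>(\<alpha> \<Otimes>\<^sub>M \<beta>))"
    by (rule nn_integral_mono_AE[OF ln_le])
  also have "\<dots> = ennreal (sqrt R) + (\<integral>\<^sup>+p. ennreal (1 / cmod (fst p - snd p)) \<partial>(\<alpha> \<Otimes>\<^sub>M \<beta>))"
    by (subst nn_integral_add) (auto simp: P.emeasure_space_1)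
  also have "(\<integral>\<^sup>+p. ennreal (1 / cmod (fst p - snd p)) \<partial>(\<alpha> \<Otimes>\<^sub>M \<beta>)) = (\<integral>\<^sup>+x. (\<integral>\<^sup>+y. ennreal (1 / cmod (x - y)) \<partial>\<beta>) \<partial>\<alpha>)"
    by (subst b.nn_integral_fst[symmetric]) auto
  also have "\<dots> \<le> (\<integral>\<^sup>+x. ennreal C \<partial>\<alpha>)" by (intro nn_integral_mono C(2))
  also have "\<dots> = ennreal C" by (simp add: a.emeasure_space_1)
  finally have "(\<integral>\<^sup>+p. ennreal \<bar>ln (cmod (fst p - snd p))\<bar> \<partial>(\<alpha> \<Otimes>\<^sub>M \<beta>)) \<le> ennreal (sqrt R) + ennreal C"
    by (simp add: add_left_mono)
  also have "\<dots> < \<infinity>" by simp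
  finally have "integrable (\<alpha> \<Otimes>\<^sub>M \<beta>) (\<lambda>p. ln (cmod (fst p - snd p)))"
    by (intro integrableI_bounded) auto
  moreover have "AE p in \<alpha> \<Otimes>\<^sub>M \<beta>. fst p \<noteq> snd p"
  proof (rule AE_pair_measure)
    show "AE x in \<alpha>. AE y in \<beta>. fst (x, y) \<noteq> snd (x, y)"
    proof (rule AE_I2)
      fix x
      show "AE y in \<beta>. fst (x, y) \<noteq> snd (x, y)"
        using bounded_density_AE_neq[OF assms(3), of x] by eventually_elim simp
    qed
    show "{p \<in> space (\<alpha> \<Otimes>\<^sub>M \<beta>). fst p \<noteq> snd p} \<in> sets (\<alpha> \<Otimes>\<^sub>M \<beta>)" by measurable
  qed
  ultimately show ?thesis by (simp add: finite_log_energy_def)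
qed

lemma finite_log_energy_sym:
  assumes "compactly_supported_prob \<alpha>" "compactly_supported_prob \<beta>" "finite_log_energy \<alpha> \<beta>"
  shows "finite_log_energy \<beta> \<alpha>" "log_energy \<beta> \<alpha> = log_energy \<alpha> \<beta>"
proof -
  note a = compactly_supported_probD[OF assms(1)] and b = compactly_supported_probD[OF assms(2)]
  note [measurable_cong] = a(2) b(2)
  interpret a: prob_space \<alpha> by (rule a(1))
  interpret b: prob_space \<beta> by (rule b(1))
  interpret pair_prob_space \<alpha> \<beta> ..
  interpret Q: pair_prob_space \<beta> \<alpha> ..
  have i: "integrable (\<alpha> \<Otimes>\<^sub>M \<beta>) (\<lambda>p. ln (cmod (fst p - snd p)))" and ae: "AE p in \<alpha> \<Otimes>\<^sub>M \<beta>. fst p \<noteq> snd p"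
    using assms(3) by (auto simp: finite_log_energy_def)
  have 1: "integrable (\<beta> \<Otimes>\<^sub>M \<alpha>) (\<lambda>p. ln (cmod (fst p - snd p)))"
    using integrable_product_swap[OF i] by (simp add: case_prod_beta' norm_minus_commute)
  have 2: "AE p in \<beta> \<Otimes>\<^sub>M \<alpha>. fst p \<noteq> snd p"
  proof -
    have "AE x in \<alpha>. AE y in \<beta>. x \<noteq> y" using AE_pair[OF ae] by simp
    then have "AE y in \<beta>. AE x in \<alpha>. x \<noteq> y"
      by (subst (asm) AE_commute) measurable
    then have "AE y in \<beta>. AE x in \<alpha>. y \<noteq> x" by (elim eventually_mono) (auto elim!: eventually_mono)
    then show ?thesis by (intro Q.AE_pair_measure) auto
  qed
  from 1 2 show "finite_log_energy \<beta> \<alpha>" by (simp add: finite_log_energy_def)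
  show "log_energy \<beta> \<alpha> = log_energy \<alpha> \<beta>"
    using integral_product_swap[of "\<lambda>p. - ln (cmod (fst p - snd p))"]
    by (simp add: log_energy_def case_prod_beta' norm_minus_commute)
qed

section \<open>From the extended-real weighted energy to real integrals\<close>

lemma integrable_compactly_supported:
  fixes h :: "complex \<Rightarrow> real"
  assumes "compactly_supported_prob \<alpha>" "continuous_on UNIV h"
  shows "integrable \<alpha> h"
proof -
  note a = compactly_supported_probD[OF assms(1)]
  note [measurable_cong] = a(2)
  interpret prob_space \<alpha> by (rule a(1))
  have [measurable]: "h \<in> borel_measurable borel" using assms(2) by (rule borel_measurable_continuous_onI)
  obtain R where R: "R > 0" "AE x in \<alpha>. cmod x \<le> R" using a by auto
  have "bounded (h ` cball 0 R)" by (intro compact_imp_bounded compact_continuous_image continuous_on_subset[OF assms(2)]) auto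
  then obtain G where "\<And>x. x \<in> cball 0 R \<Longrightarrow> \<bar>h x\<bar> \<le> G" by (metis bounded_pos imageI real_norm_def)
  then show ?thesis using R by (intro integrable_const_bound[where B = G]) (auto elim!: eventually_mono)
qed

lemma integral_pair_proj:
  fixes h :: "complex \<Rightarrow> real"
  assumes "prob_space \<alpha>" "prob_space \<beta>"
  shows "integrable \<alpha> h \<Longrightarrow> has_bochner_integral (\<alpha> \<Otimes>\<^sub>M \<beta>) (\<lambda>p. h (fst p)) (\<integral>x. h x \<partial>\<alpha>)"
    and "integrable \<beta> h \<Longrightarrow> has_bochner_integral (\<alpha> \<Otimes>\<^sub>M \<beta>) (\<lambda>p. h (snd p)) (\<integral>x. h x \<partial>\<beta>)"
proof -
  interpret a: prob_space \<alpha> by fact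
  interpret b: prob_space \<beta> by fact
  interpret pair_prob_space \<alpha> \<beta> ..
  have d1: "distr (\<alpha> \<Otimes>\<^sub>M \<beta>) \<alpha> fst = \<alpha>"
    by (rule b.distr_pair_fst)
  interpret Q: pair_prob_space \<beta> \<alpha> ..
  have d2: "distr (\<beta> \<Otimes>\<^sub>M \<alpha>) \<beta> fst = \<beta>"
    by (rule a.distr_pair_fst)
  show "has_bochner_integral (\<alpha> \<Otimes>\<^sub>M \<beta>) (\<lambda>p. h (fst p)) (\<integral>x. h x \<partial>\<alpha>)" if "integrable \<alpha> h"
    using that integrable_distr[of fst "\<alpha> \<Otimes>\<^sub>M \<beta>" \<alpha> h] integral_distr[of fst "\<alpha> \<Otimes>\<^sub>M \<beta>" \<alpha> h] d1
    by (auto simp: has_bochner_integral_iff)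
  show "has_bochner_integral (\<alpha> \<Otimes>\<^sub>M \<beta>) (\<lambda>p. h (snd p)) (\<integral>x. h x \<partial>\<beta>)" if "integrable \<beta> h"
  proof -
    have [measurable]: "h \<in> borel_measurable \<beta>" using that by auto
    have "integrable (\<beta> \<Otimes>\<^sub>M \<alpha>) (\<lambda>p. h (fst p))" "(\<integral>p. h (fst p) \<partial>(\<beta> \<Otimes>\<^sub>M \<alpha>)) = (\<integral>x. h x \<partial>\<beta>)"
      using that integrable_distr[of fst "\<beta> \<Otimes>\<^sub>M \<alpha>" \<beta> h] integral_distr[of fst "\<beta> \<Otimes>\<^sub>M \<alpha>" \<beta> h] d2 by auto
    then show ?thesis
      using Q.integrable_product_swap[of "\<lambda>p. h (fst p)"] Q.integral_product_swap[of "\<lambda>p. h (fst p)"]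
      by (simp add: has_bochner_integral_iff case_prod_beta')
  qed
qed

text \<open>Off the null diagonal the extended kernel is real and integrable, so positive part minus
  negative part is the ordinary integral. The prefactor 1 / (2 \<tau>) normalises the logarithm to
  coefficient 1 and turns the two integrals of \<Phi> into one over \<tau>.\<close>

lemma weighted_energy_eq:
  assumes "compactly_supported_prob \<nu>" "continuous_on UNIV \<Phi>" "0 < \<tau>" "finite_log_energy \<nu> \<nu>"
  shows "weighted_energy \<Phi> \<tau> \<nu> = ereal (log_energy \<nu> \<nu> + (\<integral>x. \<Phi> x \<partial>\<nu>) / \<tau>)"
proof -
  note a = compactly_supported_probD[OF assms(1)]
  note [measurable_cong] = a(2)
  interpret prob_space \<nu> by (rule a(1))
  define g where "g p = 2 * \<tau> * (- ln (cmod (fst p - snd p))) + \<Phi> (fst p) + \<Phi> (snd p)" for p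
  have \<Phi>i: "integrable \<nu> \<Phi>" by (rule integrable_compactly_supported) fact+
  note P = integral_pair_proj[OF a(1) a(1)]
  have ae: "AE p in \<nu> \<Otimes>\<^sub>M \<nu>. fst p \<noteq> snd p" using assms(4) by (simp add: finite_log_energy_def)
  have li: "integrable (\<nu> \<Otimes>\<^sub>M \<nu>) (\<lambda>p. - ln (cmod (fst p - snd p)))" using assms(4) by (simp add: finite_log_energy_def)
  have g: "has_bochner_integral (\<nu> \<Otimes>\<^sub>M \<nu>) g (2 * \<tau> * log_energy \<nu> \<nu> + (\<integral>x. \<Phi> x \<partial>\<nu>) + (\<integral>x. \<Phi> x \<partial>\<nu>))"
    unfolding g_def log_energy_def
    by (intro has_bochner_integral_add has_bochner_integral_mult_right P \<Phi>i has_bochner_integral_integrable li)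
  then have gi: "integrable (\<nu> \<Otimes>\<^sub>M \<nu>) g" by (simp add: has_bochner_integral_iff)
  have eq: "AE p in \<nu> \<Otimes>\<^sub>M \<nu>. (\<lambda>(z, w). energy_kernel \<Phi> \<tau> z w) p = ereal (g p)"
    using ae by eventually_elim (auto simp: energy_kernel_def g_def ln_div split: prod.split)
  have "ereal_integral (\<nu> \<Otimes>\<^sub>M \<nu>) (\<lambda>(z, w). energy_kernel \<Phi> \<tau> z w) =
    enn2ereal (\<integral>\<^sup>+p. ennreal (g p) \<partial>(\<nu> \<Otimes>\<^sub>M \<nu>)) - enn2ereal (\<integral>\<^sup>+p. ennreal (- g p) \<partial>(\<nu> \<Otimes>\<^sub>M \<nu>))"
    unfolding ereal_integral_def using eq
    by (intro arg_cong2[where f = "(-)"] arg_cong[where f = enn2ereal] nn_integral_cong_AE)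
       (auto elim!: eventually_mono simp: e2ennreal_ereal)
  also have "\<dots> = ereal (integral\<^sup>L (\<nu> \<Otimes>\<^sub>M \<nu>) g)"
  proof -
    have fin: "(\<integral>\<^sup>+p. ennreal (g p) \<partial>(\<nu> \<Otimes>\<^sub>M \<nu>)) \<noteq> \<infinity>" "(\<integral>\<^sup>+p. ennreal (- g p) \<partial>(\<nu> \<Otimes>\<^sub>M \<nu>)) \<noteq> \<infinity>"
      using gi by (auto simp: real_integrable_def)
    then obtain x y where xy: "0 \<le> x" "0 \<le> y" "(\<integral>\<^sup>+p. ennreal (g p) \<partial>(\<nu> \<Otimes>\<^sub>M \<nu>)) = ennreal x" "(\<integral>\<^sup>+p. ennreal (- g p) \<partial>(\<nu> \<Otimes>\<^sub>M \<nu>)) = ennreal y"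
      by (metis ennreal_cases infinity_ennreal_def)
    then show ?thesis using real_lebesgue_integral_def[OF gi] by (simp add: enn2ereal_ennreal)
  qed
  also have "integral\<^sup>L (\<nu> \<Otimes>\<^sub>M \<nu>) g = 2 * \<tau> * log_energy \<nu> \<nu> + (\<integral>x. \<Phi> x \<partial>\<nu>) + (\<integral>x. \<Phi> x \<partial>\<nu>)"
    using g by (simp add: has_bochner_integral_iff)
  finally show ?thesis unfolding weighted_energy_def using assms(3) by (simp add: field_simps)
qed

text \<open>On a compact support the kernel is bounded below, so its negative part is finite and
  finite energy means a finite positive part. The kernel is then finite almost everywhere, which
  makes the diagonal null because the kernel is infinite there.\<close>

lemma finite_log_energyI:
  assumes "compactly_supported_prob \<nu>" "continuous_on UNIV \<Phi>" "0 < \<tau>" "weighted_energy \<Phi> \<tau> \<nu> < \<infinity>"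
  shows "finite_log_energy \<nu> \<nu>"
proof -
  note a = compactly_supported_probD[OF assms(1)]
  note [measurable_cong] = a(2)
  interpret prob_space \<nu> by (rule a(1))
  interpret pair_prob_space \<nu> \<nu> ..
  have [measurable]: "\<Phi> \<in> borel_measurable borel" using assms(2) by (rule borel_measurable_continuous_onI)
  define k where "k p = energy_kernel \<Phi> \<tau> (fst p) (snd p)" for p
  have k_eq: "(\<lambda>(z, w). energy_kernel \<Phi> \<tau> z w) = k" by (auto simp: k_def)
  have [measurable]: "k \<in> borel_measurable (\<nu> \<Otimes>\<^sub>M \<nu>)" unfolding k_def energy_kernel_def by measurable
  obtain R where R: "R > 0" "AE x in \<nu>. cmod x \<le> R" using a by auto
  have "bounded (\<Phi> ` cball 0 R)" by (intro compact_imp_bounded compact_continuous_image continuous_on_subset[OF assms(2)]) auto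
  then obtain G where G: "\<And>x. x \<in> cball 0 R \<Longrightarrow> \<bar>\<Phi> x\<bar> \<le> G" by (metis bounded_pos imageI real_norm_def)
  have aeR: "AE p in \<nu> \<Otimes>\<^sub>M \<nu>. cmod (fst p) \<le> R \<and> cmod (snd p) \<le> R"
    using a R by (intro AE_pair_measure_fst_snd) auto
  define r where "r = 4 * \<tau> * R"
  \<comment> \<open>On the support |z - w| \<le> 2 R and ln x \<le> x, so r bounds 2 \<tau> ln |z -
    w| from above; 2 G accounts for the two values of \<Phi>.\<close>
  define B where "B = r + 2 * G"
  have G0: "0 \<le> G" using G[of 0] R by auto
  have B: "0 \<le> B" using assms(3) R G0 by (simp add: B_def r_def)
  have low: "ereal (- B) \<le> k p" "k p < \<infinity> \<Longrightarrow> ennreal (2 * \<tau> * \<bar>ln (cmod (fst p - snd p))\<bar>) \<le> e2ennreal (k p) + ennreal (2 * B)"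
    if "cmod (fst p) \<le> R \<and> cmod (snd p) \<le> R" for p
  proof -
    have 1: "\<bar>\<Phi> (fst p)\<bar> \<le> G" "\<bar>\<Phi> (snd p)\<bar> \<le> G" using that by (auto intro: G)
    have "cmod (fst p - snd p) \<le> 2 * R" using that norm_triangle_ineq4[of "fst p" "snd p"] by linarith
    moreover have "ln (cmod (fst p - snd p)) \<le> cmod (fst p - snd p)"
      using ln_le_minus_one[of "cmod (fst p - snd p)"] by (cases "fst p = snd p") auto
    ultimately have 2: "ln (cmod (fst p - snd p)) \<le> 2 * R" by linarith
    then have 3: "2 * \<tau> * ln (cmod (fst p - snd p)) \<le> r" using assms(3) by (simp add: r_def)
    have "- B \<le> - (2 * \<tau> * ln (cmod (fst p - snd p))) + \<Phi> (fst p) + \<Phi> (snd p)"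
      using 1 3 unfolding B_def by linarith
    then show "ereal (- B) \<le> k p" by (simp add: k_def energy_kernel_def ln_div)
    assume "k p < \<infinity>"
    then have ne: "fst p \<noteq> snd p" by (auto simp: k_def energy_kernel_def)
    define l where "l = 2 * \<tau> * ln (cmod (fst p - snd p))"
    have k: "k p = ereal (- l + \<Phi> (fst p) + \<Phi> (snd p))" using ne by (simp add: k_def energy_kernel_def ln_div l_def)
    have "2 * \<tau> * \<bar>ln (cmod (fst p - snd p))\<bar> = \<bar>l\<bar>" using assms(3) by (simp add: l_def abs_mult)
    also have "ennreal \<bar>l\<bar> \<le> ennreal (max 0 (- l + \<Phi> (fst p) + \<Phi> (snd p)) + 2 * B)"
    proof (rule ennreal_leI)
      have "0 \<le> r" using assms(3) R by (simp add: r_def)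
      moreover have "0 \<le> m \<Longrightarrow> - l + \<Phi> (fst p) + \<Phi> (snd p) \<le> m \<Longrightarrow> 0 \<le> r \<Longrightarrow> \<bar>l\<bar> \<le> m + 2 * B" for m
        using abs_le_D1[OF 1(1)] abs_le_D2[OF 1(1)] abs_le_D1[OF 1(2)] abs_le_D2[OF 1(2)] 3 G0
        unfolding B_def l_def[symmetric] by argo
      ultimately show "\<bar>l\<bar> \<le> max 0 (- l + \<Phi> (fst p) + \<Phi> (snd p)) + 2 * B"
        by simp
    qed
    also have "\<dots> = e2ennreal (k p) + ennreal (2 * B)"
      unfolding k e2ennreal_ereal using B by (subst ennreal_plus) (auto simp: max_def ennreal_neg)
    finally show "ennreal (2 * \<tau> * \<bar>ln (cmod (fst p - snd p))\<bar>) \<le> e2ennreal (k p) + ennreal (2 * B)" .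
  qed
  have "(\<integral>\<^sup>+p. e2ennreal (- k p) \<partial>(\<nu> \<Otimes>\<^sub>M \<nu>)) \<le> (\<integral>\<^sup>+p. ennreal B \<partial>(\<nu> \<Otimes>\<^sub>M \<nu>))"
  proof (rule nn_integral_mono_AE, use aeR in eventually_elim)
    fix p assume "cmod (fst p) \<le> R \<and> cmod (snd p) \<le> R"
    from low(1)[OF this] have "- k p \<le> ereal B" using ereal_uminus_le_reorder by fastforce
    then have "e2ennreal (- k p) \<le> e2ennreal (ereal B)" by (rule e2ennreal_mono)
    then show "e2ennreal (- k p) \<le> ennreal B" by (simp add: e2ennreal_ereal)
  qed
  then have neg: "(\<integral>\<^sup>+p. e2ennreal (- k p) \<partial>(\<nu> \<Otimes>\<^sub>M \<nu>)) \<le> ennreal B" by (simp add: P.emeasure_space_1)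
  have pos: "(\<integral>\<^sup>+p. e2ennreal (k p) \<partial>(\<nu> \<Otimes>\<^sub>M \<nu>)) \<noteq> \<infinity>"
  proof
    assume inf: "(\<integral>\<^sup>+p. e2ennreal (k p) \<partial>(\<nu> \<Otimes>\<^sub>M \<nu>)) = \<infinity>"
    obtain y where y: "0 \<le> y" "(\<integral>\<^sup>+p. e2ennreal (- k p) \<partial>(\<nu> \<Otimes>\<^sub>M \<nu>)) = ennreal y"
    proof -
      have "(\<integral>\<^sup>+p. e2ennreal (- k p) \<partial>(\<nu> \<Otimes>\<^sub>M \<nu>)) < top" using neg ennreal_less_top by (rule le_less_trans)
      then show ?thesis using that by (cases "(\<integral>\<^sup>+p. e2ennreal (- k p) \<partial>(\<nu> \<Otimes>\<^sub>M \<nu>))" rule: ennreal_cases) auto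
    qed
    have "weighted_energy \<Phi> \<tau> \<nu> = \<infinity>"
      unfolding weighted_energy_def ereal_integral_def k_eq inf y(2)
      using assms(3) y(1) by (simp add: enn2ereal_ennreal infinity_ennreal_def)
    with assms(4) show False by simp
  qed
  have "AE p in \<nu> \<Otimes>\<^sub>M \<nu>. e2ennreal (k p) \<noteq> \<infinity>"
    by (rule nn_integral_PInf_AE) (use pos in auto)
  then have fin: "AE p in \<nu> \<Otimes>\<^sub>M \<nu>. k p < \<infinity>"
  proof eventually_elim
    fix p assume "e2ennreal (k p) \<noteq> \<infinity>"
    then show "k p < \<infinity>" by (cases "k p") (auto simp: infinity_ennreal_def)
  qed
  then have ae: "AE p in \<nu> \<Otimes>\<^sub>M \<nu>. fst p \<noteq> snd p"
    by eventually_elim (auto simp: k_def energy_kernel_def)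
  have "(\<integral>\<^sup>+p. ennreal (2 * \<tau> * \<bar>ln (cmod (fst p - snd p))\<bar>) \<partial>(\<nu> \<Otimes>\<^sub>M \<nu>)) \<le>
      (\<integral>\<^sup>+p. e2ennreal (k p) + ennreal (2 * B) \<partial>(\<nu> \<Otimes>\<^sub>M \<nu>))"
  proof (rule nn_integral_mono_AE)
    show "AE p in \<nu> \<Otimes>\<^sub>M \<nu>. ennreal (2 * \<tau> * \<bar>ln (cmod (fst p - snd p))\<bar>) \<le> e2ennreal (k p) + ennreal (2 * B)"
      using aeR fin by eventually_elim (rule low(2))
  qed
  also have "\<dots> = (\<integral>\<^sup>+p. e2ennreal (k p) \<partial>(\<nu> \<Otimes>\<^sub>M \<nu>)) + ennreal (2 * B)"
    by (subst nn_integral_add) (auto simp: P.emeasure_space_1)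
  also have "\<dots> < \<infinity>" using pos by (simp add: less_top)
  finally have "integrable (\<nu> \<Otimes>\<^sub>M \<nu>) (\<lambda>p. 2 * \<tau> * ln (cmod (fst p - snd p)))"
    using assms(3) by (intro integrableI_bounded) (auto simp: abs_mult)
  then have "integrable (\<nu> \<Otimes>\<^sub>M \<nu>) (\<lambda>p. ln (cmod (fst p - snd p)))"
  proof -
    assume "integrable (\<nu> \<Otimes>\<^sub>M \<nu>) (\<lambda>p. 2 * \<tau> * ln (cmod (fst p - snd p)))"
    then have "integrable (\<nu> \<Otimes>\<^sub>M \<nu>) (\<lambda>p. 1 / (2 * \<tau>) * (2 * \<tau> * ln (cmod (fst p - snd p))))"
      by (rule integrable_mult_right)
    then show ?thesis using assms(3) by simp
  qed
  with ae show ?thesis by (simp add: finite_log_energy_def)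
qed

section \<open>Mixtures and translates of measures\<close>

text \<open>Positive and negative parts are treated separately. The statement is abstract so as to
  serve both for a mixture and for the product of a mixture with itself.\<close>

lemma integral_of_nn_integral_sum:
  fixes g :: "'a \<Rightarrow> real"
  assumes I: "finite I" and s: "sets P = sets N" "\<And>i. i \<in> I \<Longrightarrow> sets (M i) = sets N"
    and nn: "\<And>f. f \<in> borel_measurable N \<Longrightarrow> (\<integral>\<^sup>+x. f x \<partial>P) = (\<Sum>i\<in>I. ennreal (w i) * (\<integral>\<^sup>+x. f x \<partial>M i))"
    and w: "\<And>i. i \<in> I \<Longrightarrow> 0 \<le> w i"
    and g: "\<And>i. i \<in> I \<Longrightarrow> integrable (M i) g" and gm: "g \<in> borel_measurable N"
  shows "integrable P g" "(\<integral>x. g x \<partial>P) = (\<Sum>i\<in>I. w i * (\<integral>x. g x \<partial>M i))"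
proof -
  note [measurable] = gm
  note [measurable_cong] = s(1)
  have *: "(\<integral>\<^sup>+x. ennreal (h x) \<partial>P) = ennreal (\<Sum>i\<in>I. w i * enn2real (\<integral>\<^sup>+x. ennreal (h x) \<partial>M i))"
    if [measurable]: "h \<in> borel_measurable N" and h: "\<And>i. i \<in> I \<Longrightarrow> (\<integral>\<^sup>+x. ennreal (h x) \<partial>M i) \<noteq> \<infinity>" for h
  proof -
    have "(\<integral>\<^sup>+x. ennreal (h x) \<partial>P) = (\<Sum>i\<in>I. ennreal (w i) * (\<integral>\<^sup>+x. ennreal (h x) \<partial>M i))"
      by (rule nn) measurable
    also have "\<dots> = (\<Sum>i\<in>I. ennreal (w i * enn2real (\<integral>\<^sup>+x. ennreal (h x) \<partial>M i)))"
      using h w by (intro sum.cong refl) (simp add: ennreal_mult less_top)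
    also have "\<dots> = ennreal (\<Sum>i\<in>I. w i * enn2real (\<integral>\<^sup>+x. ennreal (h x) \<partial>M i))"
      using w by (intro sum_ennreal) auto
    finally show ?thesis .
  qed
  have fin: "(\<integral>\<^sup>+x. ennreal (g x) \<partial>M i) \<noteq> \<infinity>" "(\<integral>\<^sup>+x. ennreal (- g x) \<partial>M i) \<noteq> \<infinity>" if "i \<in> I" for i
    using g[OF that] by (auto simp: real_integrable_def)
  have pos: "(\<integral>\<^sup>+x. ennreal (g x) \<partial>P) = ennreal (\<Sum>i\<in>I. w i * enn2real (\<integral>\<^sup>+x. ennreal (g x) \<partial>M i))"
    by (rule *) (use fin in auto)
  have neg: "(\<integral>\<^sup>+x. ennreal (- g x) \<partial>P) = ennreal (\<Sum>i\<in>I. w i * enn2real (\<integral>\<^sup>+x. ennreal (- g x) \<partial>M i))"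
    by (rule *) (use fin in auto)
  show int: "integrable P g"
    using pos neg by (auto simp: real_integrable_def)
  have nonneg: "0 \<le> (\<Sum>i\<in>I. w i * enn2real (\<integral>\<^sup>+x. ennreal (h x) \<partial>M i))" for h
    using w by (intro sum_nonneg) auto
  show "(\<integral>x. g x \<partial>P) = (\<Sum>i\<in>I. w i * (\<integral>x. g x \<partial>M i))"
    unfolding real_lebesgue_integral_def[OF int] pos neg
    using nonneg g by (simp add: real_lebesgue_integral_def right_diff_distrib sum_subtractf)
qed

text \<open>The convex combination (1 - t) \<alpha> + t \<beta>, as the law of a sample drawn after
  tossing a coin that shows \<beta> with probability t.\<close>

definition mixture :: "real \<Rightarrow> complex measure \<Rightarrow> complex measure \<Rightarrow> complex measure" where
  "mixture t \<alpha> \<beta> = measure_pmf (bernoulli_pmf t) \<bind> (\<lambda>b. if b then \<beta> else \<alpha>)"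

context
  fixes \<alpha> \<beta> :: "complex measure" and t :: real
  assumes \<alpha>: "compactly_supported_prob \<alpha>" and \<beta>: "compactly_supported_prob \<beta>" and t: "0 \<le> t" "t \<le> 1"
begin

private definition m where "m b = (if b then \<beta> else \<alpha>)"
private definition w where "w b = (if b then t else 1 - t)"

private lemma m: "compactly_supported_prob (m b)" "prob_space (m b)" "sets (m b) = sets borel"
  using \<alpha> \<beta> compactly_supported_probD by (auto simp: m_def)

private lemma w: "0 \<le> w b" using t by (auto simp: w_def)

lemma sets_mixture: "sets (mixture t \<alpha> \<beta>) = sets borel"
  unfolding mixture_def m_def[symmetric] by (rule sets_bind) (auto simp: m)

lemma nn_integral_mixture:
  assumes [measurable]: "f \<in> borel_measurable borel"
  shows "(\<integral>\<^sup>+x. f x \<partial>mixture t \<alpha> \<beta>) = (\<Sum>b\<in>UNIV. ennreal (w b) * (\<integral>\<^sup>+x. f x \<partial>m b))"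
proof -
  have "(\<integral>\<^sup>+x. f x \<partial>mixture t \<alpha> \<beta>) = (\<integral>\<^sup>+b. (\<integral>\<^sup>+x. f x \<partial>m b) \<partial>measure_pmf (bernoulli_pmf t))"
    unfolding mixture_def m_def[symmetric] using m
    by (intro nn_integral_bind[of f borel]) (auto simp: space_subprob_algebra prob_space_imp_subprob_space)
  also have "\<dots> = (\<Sum>b\<in>UNIV. ennreal (w b) * (\<integral>\<^sup>+x. f x \<partial>m b))"
    using t by (subst nn_integral_bernoulli_pmf) (auto simp: UNIV_bool w_def mult.commute add.commute)
  finally show ?thesis .
qed

lemma compactly_supported_mixture: "compactly_supported_prob (mixture t \<alpha> \<beta>)"
proof -
  note [measurable_cong] = sets_mixture
  have sp: "space (mixture t \<alpha> \<beta>) = UNIV" using sets_eq_imp_space_eq[OF sets_mixture] by simp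
  have "prob_space (mixture t \<alpha> \<beta>)"
  proof
    have "emeasure (mixture t \<alpha> \<beta>) UNIV = (\<integral>\<^sup>+x. 1 \<partial>mixture t \<alpha> \<beta>)" using sp by simp
    also have "\<dots> = (\<Sum>b\<in>UNIV. ennreal (w b) * (\<integral>\<^sup>+x. 1 \<partial>m b))" by (rule nn_integral_mixture) simp
    also have "\<dots> = (\<Sum>b\<in>UNIV. ennreal (w b))" using m(2) by (simp add: prob_space.emeasure_space_1)
    also have "\<dots> = 1" using t by (simp add: UNIV_bool w_def flip: ennreal_plus)
    finally show "emeasure (mixture t \<alpha> \<beta>) (space (mixture t \<alpha> \<beta>)) = 1" using sp by simp
  qed
  moreover have "\<exists>R. AE x in mixture t \<alpha> \<beta>. cmod x \<le> R"
  proof -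
    obtain R1 where R1: "R1 > 0" "AE x in \<alpha>. cmod x \<le> R1" using compactly_supported_probD[OF \<alpha>] by auto
    obtain R2 where R2: "R2 > 0" "AE x in \<beta>. cmod x \<le> R2" using compactly_supported_probD[OF \<beta>] by auto
    define S where "S = {x::complex. max R1 R2 < cmod x}"
    have S[measurable]: "S \<in> sets borel" unfolding S_def by (intro borel_open open_Collect_less continuous_intros)
    have "emeasure (mixture t \<alpha> \<beta>) S = (\<integral>\<^sup>+x. indicator S x \<partial>mixture t \<alpha> \<beta>)" by simp
    also have "\<dots> = (\<Sum>b\<in>UNIV. ennreal (w b) * (\<integral>\<^sup>+x. indicator S x \<partial>m b))" by (rule nn_integral_mixture) simp
    also have "\<dots> = (\<Sum>b\<in>UNIV. ennreal (w b) * emeasure (m b) S)" using m(3) by (intro sum.cong refl) simp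
    also have "\<dots> = 0"
    proof -
      have "AE x in m b. x \<notin> S" for b
      proof (cases b)
        case True
        then show ?thesis using R2(2) unfolding m_def by (auto simp: S_def elim!: eventually_mono)
      next
        case False
        then show ?thesis using R1(2) unfolding m_def by (auto simp: S_def elim!: eventually_mono)
      qed
      then have "emeasure (m b) S = 0" for b using AE_iff_null_sets[of S "m b"] m(3) by (auto simp: null_sets_def)
      then show ?thesis by simp
    qed
    finally have "S \<in> null_sets (mixture t \<alpha> \<beta>)" using sets_mixture S by (intro null_setsI) auto
    then have "AE x in mixture t \<alpha> \<beta>. cmod x \<le> max R1 R2" by (rule AE_I') (auto simp: S_def)
    then show ?thesis by blast
  qed
  ultimately show ?thesis using sets_mixture compactly_supported_probI by blast
qed

lemma integral_mixture:
  fixes g :: "complex \<Rightarrow> real"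
  assumes "integrable \<alpha> g" "integrable \<beta> g" "g \<in> borel_measurable borel"
  shows "(\<integral>x. g x \<partial>mixture t \<alpha> \<beta>) = (1 - t) * (\<integral>x. g x \<partial>\<alpha>) + t * (\<integral>x. g x \<partial>\<beta>)"
proof -
  have "(\<integral>x. g x \<partial>mixture t \<alpha> \<beta>) = (\<Sum>b\<in>UNIV. w b * (\<integral>x. g x \<partial>m b))"
    using assms w m nn_integral_mixture sets_mixture
    by (intro integral_of_nn_integral_sum(2)[where N = borel]) (auto simp: m_def)
  then show ?thesis by (simp add: UNIV_bool m_def w_def)
qed

private lemma nn_integral_mixture_pair:
  assumes [measurable]: "f \<in> borel_measurable (borel \<Otimes>\<^sub>M borel)"
  shows "(\<integral>\<^sup>+p. f p \<partial>(mixture t \<alpha> \<beta> \<Otimes>\<^sub>M mixture t \<alpha> \<beta>)) =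
    (\<Sum>b\<in>UNIV. ennreal (w (fst b) * w (snd b)) * (\<integral>\<^sup>+p. f p \<partial>(m (fst b) \<Otimes>\<^sub>M m (snd b))))"
proof -
  let ?P = "mixture t \<alpha> \<beta>"
  interpret P: prob_space ?P using compactly_supported_mixture compactly_supported_probD by blast
  interpret m: prob_space "m b" for b by (rule m)
  note [measurable_cong] = sets_mixture m(3)
  have "(\<integral>\<^sup>+p. f p \<partial>(?P \<Otimes>\<^sub>M ?P)) = (\<integral>\<^sup>+x. (\<integral>\<^sup>+y. f (x, y) \<partial>?P) \<partial>?P)"
    by (rule P.nn_integral_fst[symmetric]) measurable
  also have "\<dots> = (\<integral>\<^sup>+x. (\<Sum>b'\<in>UNIV. ennreal (w b') * (\<integral>\<^sup>+y. f (x, y) \<partial>m b')) \<partial>?P)"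
    by (intro nn_integral_cong nn_integral_mixture) measurable
  also have "\<dots> = (\<Sum>b\<in>UNIV. ennreal (w b) * (\<integral>\<^sup>+x. (\<Sum>b'\<in>UNIV. ennreal (w b') * (\<integral>\<^sup>+y. f (x, y) \<partial>m b')) \<partial>m b))"
    by (intro nn_integral_mixture) measurable
  also have "\<dots> = (\<Sum>b\<in>UNIV. ennreal (w b) * (\<Sum>b'\<in>UNIV. ennreal (w b') * (\<integral>\<^sup>+p. f p \<partial>(m b \<Otimes>\<^sub>M m b'))))"
  proof (intro sum.cong refl arg_cong2[where f = times])
    fix b
    have "(\<integral>\<^sup>+x. (\<Sum>b'\<in>UNIV. ennreal (w b') * (\<integral>\<^sup>+y. f (x, y) \<partial>m b')) \<partial>m b) =
      (\<Sum>b'\<in>UNIV. (\<integral>\<^sup>+x. ennreal (w b') * (\<integral>\<^sup>+y. f (x, y) \<partial>m b') \<partial>m b))"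
      by (intro nn_integral_sum) measurable
    also have "\<dots> = (\<Sum>b'\<in>UNIV. ennreal (w b') * (\<integral>\<^sup>+p. f p \<partial>(m b \<Otimes>\<^sub>M m b')))"
      by (intro sum.cong refl) (simp add: nn_integral_cmult m.nn_integral_fst)
    finally show "(\<integral>\<^sup>+x. (\<Sum>b'\<in>UNIV. ennreal (w b') * (\<integral>\<^sup>+y. f (x, y) \<partial>m b')) \<partial>m b) =
      (\<Sum>b'\<in>UNIV. ennreal (w b') * (\<integral>\<^sup>+p. f p \<partial>(m b \<Otimes>\<^sub>M m b')))" .
  qed
  also have "\<dots> = (\<Sum>b\<in>UNIV \<times> UNIV. ennreal (w (fst b) * w (snd b)) * (\<integral>\<^sup>+p. f p \<partial>(m (fst b) \<Otimes>\<^sub>M m (snd b))))"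
    unfolding sum_distrib_left using w
    by (subst sum.cartesian_product) (auto intro!: sum.cong simp: ennreal_mult mult_ac)
  finally show ?thesis by simp
qed

text \<open>Bilinearity over the four pairs of coin outcomes, the two mixed ones agreeing by
  symmetry. The same expansion applied to the indicator of the diagonal shows that the diagonal
  stays null.\<close>

lemma log_energy_mixture:
  assumes "finite_log_energy \<alpha> \<alpha>" "finite_log_energy \<alpha> \<beta>" "finite_log_energy \<beta> \<beta>"
  shows "finite_log_energy (mixture t \<alpha> \<beta>) (mixture t \<alpha> \<beta>)"
    "log_energy (mixture t \<alpha> \<beta>) (mixture t \<alpha> \<beta>) =
      (1 - t)\<^sup>2 * log_energy \<alpha> \<alpha> + 2 * t * (1 - t) * log_energy \<alpha> \<beta> + t\<^sup>2 * log_energy \<beta> \<beta>"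
proof -
  let ?P = "mixture t \<alpha> \<beta> \<Otimes>\<^sub>M mixture t \<alpha> \<beta>"
  let ?I = "\<lambda>b. m (fst b) \<Otimes>\<^sub>M m (snd b)"
  note sy = finite_log_energy_sym[OF \<alpha> \<beta> assms(2)]
  have fin: "finite_log_energy (m b) (m b')" for b b'
    using assms sy by (cases b; cases b') (auto simp: m_def)
  have s: "sets ?P = sets (borel \<Otimes>\<^sub>M borel)" "sets (?I b) = sets (borel \<Otimes>\<^sub>M borel)" for b
    by (auto intro!: sets_pair_measure_cong sets_mixture m(3))
  have ln_m: "(\<lambda>p::complex \<times> complex. - ln (cmod (fst p - snd p))) \<in> borel_measurable (borel \<Otimes>\<^sub>M borel)" by measurable
  have ln_i: "integrable (?I b) (\<lambda>p. - ln (cmod (fst p - snd p)))" for b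
    using fin[of "fst b" "snd b"] by (simp add: finite_log_energy_def)
  note I = integral_of_nn_integral_sum[where I = UNIV and P = ?P and N = "borel \<Otimes>\<^sub>M borel" and M = ?I and
      w = "\<lambda>b. w (fst b) * w (snd b)", OF finite s nn_integral_mixture_pair mult_nonneg_nonneg[OF w w] ln_i ln_m]
  have "integrable ?P (\<lambda>p. ln (cmod (fst p - snd p)))" using I(1) by simp
  moreover have "AE p in ?P. fst p \<noteq> snd p"
  proof -
    define D where "D = {p::complex \<times> complex. fst p = snd p}"
    have D[measurable]: "D \<in> sets (borel \<Otimes>\<^sub>M borel)"
      unfolding D_def borel_prod by (intro borel_closed closed_Collect_eq continuous_intros)
    have "emeasure ?P D = (\<integral>\<^sup>+p. indicator D p \<partial>?P)" using s D by (subst nn_integral_indicator) auto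
    also have "\<dots> = (\<Sum>b\<in>UNIV. ennreal (w (fst b) * w (snd b)) * (\<integral>\<^sup>+p. indicator D p \<partial>?I b))"
      by (rule nn_integral_mixture_pair) measurable
    also have "\<dots> = 0"
    proof -
      have "(\<integral>\<^sup>+p. indicator D p \<partial>?I b) = 0" for b
      proof -
        have "AE p in ?I b. fst p \<noteq> snd p" using fin by (simp add: finite_log_energy_def)
        then have "(\<integral>\<^sup>+p. indicator D p \<partial>?I b) = (\<integral>\<^sup>+p. 0 \<partial>?I b)"
          by (intro nn_integral_cong_AE) (auto elim!: eventually_mono simp: D_def)
        then show ?thesis by simp
      qed
      then show ?thesis by simp
    qed
    finally have "D \<in> null_sets ?P" using s D by (intro null_setsI) auto
    then show ?thesis by (rule AE_I') (auto simp: D_def)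
  qed
  ultimately show "finite_log_energy (mixture t \<alpha> \<beta>) (mixture t \<alpha> \<beta>)" by (simp add: finite_log_energy_def)
  have "log_energy (mixture t \<alpha> \<beta>) (mixture t \<alpha> \<beta>) = (\<Sum>b\<in>UNIV \<times> UNIV. w (fst b) * w (snd b) * log_energy (m (fst b)) (m (snd b)))"
    using I(2) by (simp add: log_energy_def)
  also have "\<dots> = (\<Sum>b\<in>UNIV. \<Sum>b'\<in>UNIV. w b * w b' * log_energy (m b) (m b'))"
    by (subst sum.cartesian_product) (simp add: case_prod_beta')
  also have "\<dots> = (1 - t)\<^sup>2 * log_energy \<alpha> \<alpha> + 2 * t * (1 - t) * log_energy \<alpha> \<beta> + t\<^sup>2 * log_energy \<beta> \<beta>"
    using sy(2) by (simp add: UNIV_bool m_def w_def power2_eq_square algebra_simps)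
  finally show "log_energy (mixture t \<alpha> \<beta>) (mixture t \<alpha> \<beta>) =
      (1 - t)\<^sup>2 * log_energy \<alpha> \<alpha> + 2 * t * (1 - t) * log_energy \<alpha> \<beta> + t\<^sup>2 * log_energy \<beta> \<beta>" .
qed

end

section \<open>Uniform measures on discs and continuous images\<close>

definition disc :: "real \<Rightarrow> complex measure" where
  "disc r = uniform_measure lborel (ball 0 r)"

context
  fixes r :: real assumes r: "0 < r"
begin

private lemma ball_measure: "emeasure lborel (ball (0::complex) r) = ennreal (unit_ball_vol 2 * r\<^sup>2)" "0 < unit_ball_vol (2::real) * r\<^sup>2"
  using r by (auto simp: emeasure_lborel_ball_complex)

lemma sets_disc: "sets (disc r) = sets borel"
  by (simp add: disc_def)

lemma AE_disc: "AE s in disc r. cmod s \<le> r"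
  unfolding disc_def by (rule AE_uniform_measureI) auto

lemma compactly_supported_disc: "compactly_supported_prob (disc r)"
proof (rule compactly_supported_probI[OF _ sets_disc AE_disc])
  show "prob_space (disc r)" unfolding disc_def using ball_measure
    by (intro prob_space_uniform_measure) auto
qed

lemma bounded_density_disc: "bounded_density (1 / (unit_ball_vol 2 * r\<^sup>2)) (disc r)"
  unfolding bounded_density_def
proof (intro conjI ballI sets_disc)
  show "0 \<le> 1 / (unit_ball_vol 2 * r\<^sup>2)" using ball_measure by (simp add: less_imp_le)
  fix A :: "complex set" assume A: "A \<in> sets borel"
  have "emeasure (disc r) A = emeasure lborel (ball 0 r \<inter> A) / ennreal (unit_ball_vol 2 * r\<^sup>2)"
    unfolding disc_def using A by (simp add: ball_measure)
  also have "\<dots> \<le> emeasure lborel A / ennreal (unit_ball_vol 2 * r\<^sup>2)"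
    using A by (intro divide_right_mono_ennreal emeasure_mono) auto
  also have "\<dots> = ennreal (1 / (unit_ball_vol 2 * r\<^sup>2)) * emeasure lborel A"
    using ball_measure(2) by (simp add: divide_ennreal_def inverse_ennreal mult.commute inverse_eq_divide)
  finally show "emeasure (disc r) A \<le> ennreal (1 / (unit_ball_vol 2 * r\<^sup>2)) * emeasure lborel A" .
qed

end

lemma bounded_density_affine:
  assumes "bounded_density M \<alpha>"
  shows "bounded_density M (distr \<alpha> borel (\<lambda>s. z - s))"
  unfolding bounded_density_def
proof (intro conjI ballI)
  note b = assms[unfolded bounded_density_def]
  note [measurable_cong] = b[THEN conjunct2, THEN conjunct1]
  show "0 \<le> M" using b by simp
  fix A :: "complex set" assume A[measurable]: "A \<in> sets borel"
  have pre: "(\<lambda>s. z - s) -` A \<in> sets borel" using measurable_sets[of "\<lambda>s. z - s" borel borel A] by simp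
  have sp: "space \<alpha> = UNIV" using b sets_eq_imp_space_eq[of \<alpha> borel] by simp
  have "emeasure (distr \<alpha> borel (\<lambda>s. z - s)) A = emeasure \<alpha> ((\<lambda>s. z - s) -` A)"
    using sp by (subst emeasure_distr) auto
  also have "\<dots> \<le> ennreal M * emeasure lborel ((\<lambda>s. z - s) -` A)" using b pre by blast
  also have "emeasure lborel ((\<lambda>s. z - s) -` A) = (\<integral>\<^sup>+s. indicator A (z - s) \<partial>lborel)"
  proof -
    have "(\<integral>\<^sup>+s. indicator A (z - s) \<partial>lborel) = (\<integral>\<^sup>+s. indicator ((\<lambda>s. z - s) -` A) s \<partial>lborel)"
      by (intro nn_integral_cong) (simp add: indicator_def)
    then show ?thesis using pre by (simp add: nn_integral_indicator)
  qed
  also have "\<dots> = (\<integral>\<^sup>+s. indicator A s \<partial>lborel)" by (rule nn_integral_lborel_reflect) measurable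
  also have "\<dots> = emeasure lborel A" by simp
  finally show "emeasure (distr \<alpha> borel (\<lambda>s. z - s)) A \<le> ennreal M * emeasure lborel A" .
qed simp

lemma compactly_supported_distr:
  assumes "compactly_supported_prob \<alpha>" and T: "continuous_on UNIV T"
  shows "compactly_supported_prob (distr \<alpha> borel T)"
proof -
  note a = compactly_supported_probD[OF assms(1)]
  note [measurable_cong] = a(2)
  interpret prob_space \<alpha> by (rule a(1))
  have [measurable]: "T \<in> borel_measurable borel" using T by (rule borel_measurable_continuous_onI)
  obtain R where R: "R > 0" "AE x in \<alpha>. cmod x \<le> R" using a by auto
  have "bounded (T ` cball 0 R)" by (intro compact_imp_bounded compact_continuous_image continuous_on_subset[OF T]) auto
  then obtain G where G: "\<And>x. x \<in> cball 0 R \<Longrightarrow> cmod (T x) \<le> G" by (metis bounded_pos imageI)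
  show ?thesis
  proof (rule compactly_supported_probI[where R = G])
    show "prob_space (distr \<alpha> borel T)" by (rule prob_space_distr) measurable
    show "AE x in distr \<alpha> borel T. cmod x \<le> G"
      by (subst AE_distr_iff) (use R(2) G in \<open>auto elim!: eventually_mono\<close>)
  qed simp
qed

section \<open>The extremal measure\<close>

locale extremal =
  fixes \<Phi> :: "complex \<Rightarrow> real" and \<tau> :: real and \<sigma> :: "complex measure"
  assumes cont_\<Phi>: "continuous_on UNIV \<Phi>" and growth_\<Phi>: "superlog_growth \<Phi>"
    and \<tau>: "0 < \<tau>" and extremal: "is_extremal_measure \<Phi> \<tau> \<sigma>"
begin

definition Q :: "complex \<Rightarrow> real" where "Q z = \<Phi> z / (2 * \<tau>)"

definition energy :: "complex measure \<Rightarrow> real" where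
  "energy \<nu> = log_energy \<nu> \<nu> + 2 * (\<integral>x. Q x \<partial>\<nu>)"

definition I :: real where "I = energy \<sigma>"

lemma cont_Q: "continuous_on UNIV Q"
  unfolding Q_def using \<tau> by (intro continuous_intros cont_\<Phi>) auto

lemma Q_measurable [measurable]: "Q \<in> borel_measurable borel"
  using cont_Q by (rule borel_measurable_continuous_onI)

lemma integrable_Q: "compactly_supported_prob \<nu> \<Longrightarrow> integrable \<nu> Q"
  using cont_Q by (rule integrable_compactly_supported[rotated])

lemma weighted_energy_eq_energy:
  assumes "compactly_supported_prob \<nu>" "finite_log_energy \<nu> \<nu>"
  shows "weighted_energy \<Phi> \<tau> \<nu> = ereal (energy \<nu>)"
  using weighted_energy_eq[OF assms(1) cont_\<Phi> \<tau> assms(2)] \<tau> by (simp add: energy_def Q_def)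

lemma \<sigma>: "compactly_supported_prob \<sigma>"
  using extremal by (simp add: is_extremal_measure_def)

text \<open>The uniform measure on the unit disc is a competitor of finite energy.\<close>

lemma finite_\<sigma>: "finite_log_energy \<sigma> \<sigma>"
proof (rule finite_log_energyI[OF \<sigma> cont_\<Phi> \<tau>])
  have d: "compactly_supported_prob (disc 1)" by (rule compactly_supported_disc) simp
  have "finite_log_energy (disc 1) (disc 1)"
    by (rule finite_log_energy_bounded_density[OF d d bounded_density_disc]) simp
  then have "weighted_energy \<Phi> \<tau> (disc 1) < \<infinity>" using weighted_energy_eq_energy[OF d] by simp
  moreover have "weighted_energy \<Phi> \<tau> \<sigma> \<le> weighted_energy \<Phi> \<tau> (disc 1)"
    using extremal d by (simp add: is_extremal_measure_def)
  ultimately show "weighted_energy \<Phi> \<tau> \<sigma> < \<infinity>" by (rule le_less_trans[rotated])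
qed

lemma energy_ge:
  assumes "compactly_supported_prob \<nu>" "finite_log_energy \<nu> \<nu>"
  shows "I \<le> energy \<nu>"
proof -
  have "weighted_energy \<Phi> \<tau> \<sigma> \<le> weighted_energy \<Phi> \<tau> \<nu>"
    using extremal assms by (simp add: is_extremal_measure_def)
  then show ?thesis
    using weighted_energy_eq_energy[OF assms] weighted_energy_eq_energy[OF \<sigma> finite_\<sigma>] by (simp add: I_def)
qed

text \<open>First variation: differentiate the energy of \<open>(1 - t) \<sigma> + t \<beta>\<close> at \<open>t = 0\<close>.\<close>

lemma euler_lagrange:
  assumes \<beta>: "compactly_supported_prob \<beta>" and fin: "finite_log_energy \<sigma> \<beta>" "finite_log_energy \<beta> \<beta>"
  shows "I \<le> log_energy \<sigma> \<beta> + (\<integral>x. Q x \<partial>\<sigma>) + (\<integral>x. Q x \<partial>\<beta>)"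
proof (rule ccontr)
  define B where "B = log_energy \<sigma> \<beta> + (\<integral>x. Q x \<partial>\<sigma>) + (\<integral>x. Q x \<partial>\<beta>)"
  assume "\<not> ?thesis"
  then have BI: "B < I" by (simp add: B_def)
  \<comment> \<open>Minimality along the segment from \<sigma> to \<beta>, with the terms of order 0
    cancelled and one factor t divided out.\<close>
  have *: "2 * (I - B) \<le> t * (I - 2 * B + energy \<beta>)" if t: "0 < t" "t \<le> 1" for t
  proof -
    have t': "0 \<le> t" using t by simp
    have "I \<le> energy (mixture t \<sigma> \<beta>)"
      by (intro energy_ge compactly_supported_mixture log_energy_mixture \<sigma> \<beta> finite_\<sigma> fin t t')
    also have "\<dots> = (1 - t)\<^sup>2 * I + 2 * t * (1 - t) * B + t\<^sup>2 * energy \<beta>"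
      unfolding energy_def log_energy_mixture(2)[OF \<sigma> \<beta> t' t(2) finite_\<sigma> fin]
        integral_mixture[OF \<sigma> \<beta> t' t(2) integrable_Q[OF \<sigma>] integrable_Q[OF \<beta>] Q_measurable]
      by (simp add: I_def energy_def B_def power2_eq_square algebra_simps)
    finally have "t * (2 * (I - B)) \<le> t * (t * (I - 2 * B + energy \<beta>))"
      by (simp add: power2_eq_square algebra_simps)
    then show ?thesis using t by simp
  qed
  \<comment> \<open>At t = 1 / S the right side of \<open>*\<close> is at most I - B, half of the
    left side; the maximum keeps t \<le> 1.\<close>
  define S where "S = max 1 ((I - 2 * B + energy \<beta>) / (I - B))"
  have "(I - 2 * B + energy \<beta>) \<le> S * (I - B)" "1 \<le> S"
    using BI by (auto simp: S_def simp flip: pos_divide_le_eq)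
  then have "1 / S * (I - 2 * B + energy \<beta>) \<le> I - B" by (simp add: field_simps)
  moreover have "2 * (I - B) \<le> 1 / S * (I - 2 * B + energy \<beta>)"
    using \<open>1 \<le> S\<close> by (intro *) auto
  ultimately have "2 * (I - B) \<le> I - B" by (rule order_trans[rotated])
  then show False using BI by argo
qed

text \<open>The convolution of \<sigma> with the uniform measure on a disc, as the law of a sum of
  independent samples.\<close>

definition smoothed :: "real \<Rightarrow> complex measure" where
  "smoothed r = distr (\<sigma> \<Otimes>\<^sub>M disc r) borel (\<lambda>p. fst p + snd p)"

lemma sets_\<sigma> [measurable_cong]: "sets \<sigma> = sets borel"
  and prob_\<sigma>: "prob_space \<sigma>"
  using compactly_supported_probD[OF \<sigma>] by auto

context
  fixes r :: real assumes r: "0 < r"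
begin

interpretation s: prob_space \<sigma> by (rule prob_\<sigma>)
interpretation d: prob_space "disc r" using compactly_supported_probD[OF compactly_supported_disc[OF r]] by simp
interpretation sd: pair_prob_space \<sigma> "disc r" ..

lemmas [measurable_cong] = sets_disc[OF r]

lemma sets_smoothed [measurable_cong]: "sets (smoothed r) = sets borel"
  by (simp add: smoothed_def)

lemma compactly_supported_smoothed: "compactly_supported_prob (smoothed r)"
proof -
  obtain R where R: "R > 0" "AE x in \<sigma>. cmod x \<le> R" using compactly_supported_probD[OF \<sigma>] by auto
  show ?thesis
  proof (rule compactly_supported_probI[OF _ sets_smoothed, of "R + r"])
    show "prob_space (smoothed r)" unfolding smoothed_def by (rule sd.P.prob_space_distr) measurable
    have "AE p in \<sigma> \<Otimes>\<^sub>M disc r. cmod (fst p) \<le> R \<and> cmod (snd p) \<le> r"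
      by (intro AE_pair_measure_fst_snd R(2) AE_disc[OF r]) unfold_locales
    then have "AE p in \<sigma> \<Otimes>\<^sub>M disc r. cmod (fst p + snd p) \<le> R + r"
      by eventually_elim (intro order_trans[OF norm_triangle_ineq] add_mono, auto)
    then show "AE x in smoothed r. cmod x \<le> R + r"
      unfolding smoothed_def by (subst AE_distr_iff) auto
  qed
qed

lemma bounded_density_smoothed: "bounded_density (1 / (unit_ball_vol 2 * r\<^sup>2)) (smoothed r)"
proof -
  define M where "M = 1 / (unit_ball_vol 2 * r\<^sup>2)"
  have bd: "bounded_density M (disc r)" unfolding M_def by (rule bounded_density_disc[OF r])
  have "emeasure (smoothed r) A \<le> ennreal M * emeasure lborel A" if A[measurable]: "A \<in> sets borel" for A
  proof -
    have "emeasure (smoothed r) A = (\<integral>\<^sup>+y. indicator A y \<partial>smoothed r)" by simp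
    also have "\<dots> = (\<integral>\<^sup>+p. indicator A (fst p + snd p) \<partial>(\<sigma> \<Otimes>\<^sub>M disc r))"
      unfolding smoothed_def by (rule nn_integral_distr) auto
    also have "\<dots> = (\<integral>\<^sup>+x. (\<integral>\<^sup>+s. indicator A (x + s) \<partial>disc r) \<partial>\<sigma>)"
      by (subst d.nn_integral_fst[symmetric]) auto
    also have "\<dots> \<le> (\<integral>\<^sup>+x. ennreal M * emeasure lborel A \<partial>\<sigma>)"
    proof (rule nn_integral_mono)
      fix x
      have "(\<integral>\<^sup>+s. indicator A (x + s) \<partial>disc r) \<le> ennreal M * (\<integral>\<^sup>+s. indicator A (x + s) \<partial>lborel)"
        by (rule nn_integral_bounded_density[OF bd]) measurable
      also have "(\<integral>\<^sup>+s. indicator A (x + s) \<partial>lborel) = (\<integral>\<^sup>+s. indicator A s \<partial>distr lborel borel ((+) x))"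
        by (rule nn_integral_distr[symmetric]) auto
      also have "\<dots> = emeasure lborel A" by (simp add: lborel_distr_plus)
      finally show "(\<integral>\<^sup>+s. indicator A (x + s) \<partial>disc r) \<le> ennreal M * emeasure lborel A" .
    qed
    also have "\<dots> = ennreal M * emeasure lborel A" by (simp add: s.emeasure_space_1)
    finally show ?thesis .
  qed
  moreover have "0 \<le> M" using bd by (simp add: bounded_density_def)
  ultimately show ?thesis using sets_smoothed by (simp add: bounded_density_def M_def)
qed

lemma integral_smoothed:
  fixes h :: "complex \<Rightarrow> real"
  assumes "integrable (smoothed r) h"
  shows "integrable (\<sigma> \<Otimes>\<^sub>M disc r) (\<lambda>p. h (fst p + snd p))"
    "(\<integral>y. h y \<partial>smoothed r) = (\<integral>x. (\<integral>s. h (x + s) \<partial>disc r) \<partial>\<sigma>)"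
    "(\<integral>y. h y \<partial>smoothed r) = (\<integral>s. (\<integral>x. h (x + s) \<partial>\<sigma>) \<partial>disc r)"
    "integrable (disc r) (\<lambda>s. \<integral>x. h (x + s) \<partial>\<sigma>)"
proof -
  have [measurable]: "h \<in> borel_measurable borel"
    using assms borel_measurable_integrable measurable_cong_sets[OF sets_smoothed refl] by blast
  show 1: "integrable (\<sigma> \<Otimes>\<^sub>M disc r) (\<lambda>p. h (fst p + snd p))"
    using assms unfolding smoothed_def by (subst (asm) integrable_distr_eq) auto
  have 2: "(\<integral>y. h y \<partial>smoothed r) = (\<integral>p. h (fst p + snd p) \<partial>(\<sigma> \<Otimes>\<^sub>M disc r))"
    unfolding smoothed_def by (rule integral_distr) auto
  have 3: "integrable (\<sigma> \<Otimes>\<^sub>M disc r) (case_prod (\<lambda>x s. h (x + s)))"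
    using 1 by (simp add: case_prod_beta')
  show "(\<integral>y. h y \<partial>smoothed r) = (\<integral>x. (\<integral>s. h (x + s) \<partial>disc r) \<partial>\<sigma>)"
    using sd.integral_fst[OF 3] 2 by (simp add: case_prod_beta')
  then show "(\<integral>y. h y \<partial>smoothed r) = (\<integral>s. (\<integral>x. h (x + s) \<partial>\<sigma>) \<partial>disc r)"
    using sd.Fubini_integral[OF 3] by simp
  show "integrable (disc r) (\<lambda>s. \<integral>x. h (x + s) \<partial>\<sigma>)" using sd.integrable_snd[OF 3] .
qed

text \<open>The Euler--Lagrange inequality is tested with the law of z - s, uniform on a disc around
  z. Since |x - (z - s)| = |z - (x + s)|, its mutual energy with \<sigma> is the potential of the
  smoothed measure at z, so the inequality holds at every z and not only outside an exceptional
  set.\<close>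

lemma smoothed_potential_ge:
  "I \<le> (\<integral>y. - ln (cmod (z - y)) \<partial>smoothed r) + (\<integral>x. Q x \<partial>\<sigma>) + (\<integral>s. Q (z - s) \<partial>disc r)"
proof -
  let ?\<beta> = "distr (disc r) borel (\<lambda>s. z - s)"
  have \<beta>: "compactly_supported_prob ?\<beta>"
    by (intro compactly_supported_distr compactly_supported_disc r continuous_intros)
  have bd: "bounded_density (1 / (unit_ball_vol 2 * r\<^sup>2)) ?\<beta>"
    by (intro bounded_density_affine bounded_density_disc r)
  note fin = finite_log_energy_bounded_density[OF \<sigma> \<beta> bd] finite_log_energy_bounded_density[OF \<beta> \<beta> bd]
  interpret b: prob_space ?\<beta> using \<beta> compactly_supported_probD by blast
  interpret sb: pair_prob_space \<sigma> ?\<beta> ..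
  have i: "integrable (\<sigma> \<Otimes>\<^sub>M ?\<beta>) (case_prod (\<lambda>x y. - ln (cmod (x - y))))"
    using fin(1) by (simp add: finite_log_energy_def case_prod_beta')
  have "log_energy \<sigma> ?\<beta> = (\<integral>x. (\<integral>y. - ln (cmod (x - y)) \<partial>?\<beta>) \<partial>\<sigma>)"
    unfolding log_energy_def using sb.integral_fst[OF i] by (simp add: case_prod_beta')
  also have "\<dots> = (\<integral>x. (\<integral>s. - ln (cmod (z - (x + s))) \<partial>disc r) \<partial>\<sigma>)"
  proof (rule Bochner_Integration.integral_cong[OF refl])
    fix x
    have "(\<integral>y. - ln (cmod (x - y)) \<partial>?\<beta>) = (\<integral>s. - ln (cmod (x - (z - s))) \<partial>disc r)"
      by (rule integral_distr) auto
    also have "\<dots> = (\<integral>s. - ln (cmod (z - (x + s))) \<partial>disc r)"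
    proof (rule Bochner_Integration.integral_cong[OF refl])
      fix s
      have "cmod (x - (z - s)) = cmod (z - (x + s))" using norm_minus_commute[of "x + s" z] by (simp add: algebra_simps)
      then show "- ln (cmod (x - (z - s))) = - ln (cmod (z - (x + s)))" by simp
    qed
    finally show "(\<integral>y. - ln (cmod (x - y)) \<partial>?\<beta>) = (\<integral>s. - ln (cmod (z - (x + s))) \<partial>disc r)" .
  qed
  also have "\<dots> = (\<integral>y. - ln (cmod (z - y)) \<partial>smoothed r)"
    using integrable_log_bounded_density(1)[OF compactly_supported_smoothed bounded_density_smoothed, of z]
    by (intro integral_smoothed(2)[symmetric]) auto
  finally have "log_energy \<sigma> ?\<beta> = (\<integral>y. - ln (cmod (z - y)) \<partial>smoothed r)" .
  moreover have "(\<integral>x. Q x \<partial>?\<beta>) = (\<integral>s. Q (z - s) \<partial>disc r)"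
    by (rule integral_distr) auto
  ultimately show ?thesis using euler_lagrange[OF \<beta> fin] by simp
qed

lemma ker_int_translate:
  assumes "continuous_on {0..} K"
  shows "ker_int K (distr \<sigma> borel (\<lambda>x. x + s)) (distr \<sigma> borel (\<lambda>x. x + s)) = ker_int K \<sigma> \<sigma>"
proof -
  let ?T = "\<lambda>x::complex. x + s"
  interpret t: prob_space "distr \<sigma> borel ?T" by (rule s.prob_space_distr) measurable
  have eq: "distr \<sigma> borel ?T \<Otimes>\<^sub>M distr \<sigma> borel ?T = distr (\<sigma> \<Otimes>\<^sub>M \<sigma>) (borel \<Otimes>\<^sub>M borel) (\<lambda>(x, y). (?T x, ?T y))"
    by (rule pair_measure_distr) (measurable, unfold_locales)
  show ?thesis unfolding ker_int_def eq
    by (subst integral_distr) (auto simp: measurable_radial_kernel[OF assms] case_prod_beta' intro!: Bochner_Integration.integral_cong)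
qed

lemma ker_int_eq_iterated:
  fixes K :: "real \<Rightarrow> real"
  assumes "compactly_supported_prob \<alpha>" "compactly_supported_prob \<beta>" "continuous_on {0..} K"
  shows "ker_int K \<alpha> \<beta> = (\<integral>x. (\<integral>y. K ((cmod (x - y))\<^sup>2) \<partial>\<beta>) \<partial>\<alpha>)"
    "integrable \<alpha> (\<lambda>x. \<integral>y. K ((cmod (x - y))\<^sup>2) \<partial>\<beta>)"
proof -
  interpret a: prob_space \<alpha> using assms compactly_supported_probD by blast
  interpret b: prob_space \<beta> using assms compactly_supported_probD by blast
  interpret pair_prob_space \<alpha> \<beta> ..
  have "integrable (\<alpha> \<Otimes>\<^sub>M \<beta>) (case_prod (\<lambda>x y. K ((cmod (x - y))\<^sup>2)))"
    using integrable_radial_kernel[OF assms] by (simp add: case_prod_beta')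
  from integral_fst[OF this] integrable_fst[OF this]
  show "ker_int K \<alpha> \<beta> = (\<integral>x. (\<integral>y. K ((cmod (x - y))\<^sup>2) \<partial>\<beta>) \<partial>\<alpha>)"
    "integrable \<alpha> (\<lambda>x. \<integral>y. K ((cmod (x - y))\<^sup>2) \<partial>\<beta>)"
    by (simp_all add: ker_int_def case_prod_beta')
qed

lemma measurable_potential:
  fixes K :: "real \<Rightarrow> real"
  assumes "compactly_supported_prob \<beta>" "continuous_on {0..} K"
  shows "(\<lambda>x. \<integral>y. K ((cmod (x - y))\<^sup>2) \<partial>\<beta>) \<in> borel_measurable borel"
proof -
  note b = compactly_supported_probD[OF assms(1)]
  interpret b: prob_space \<beta> by (rule b(1))
  note [measurable_cong] = b(2)
  note [measurable] = measurable_radial_kernel[OF assms(2)]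
  have m: "(\<lambda>p. K ((cmod (fst p - snd p))\<^sup>2)) \<in> borel_measurable (borel \<Otimes>\<^sub>M \<beta>)"
    by measurable
  then show ?thesis
    by (intro b.borel_measurable_lebesgue_integral) (auto simp: case_prod_beta')
qed

text \<open>The smoothed measure averages the translates of \<open>\<sigma>\<close>; positivity of the quadratic form on
  (translate) \<open>-\<close> (smoothed measure), averaged over all translates, gives the claim.\<close>

lemma ker_int_smoothed_le:
  assumes a: "0 < a"
  shows "ker_int (reg_log a) (smoothed r) (smoothed r) \<le> ker_int (reg_log a) \<sigma> \<sigma>"
proof -
  let ?K = "reg_log a" and ?\<nu> = "smoothed r"
  let ?T = "\<lambda>s. distr \<sigma> borel (\<lambda>x. x + s)"
  note \<nu> = compactly_supported_smoothed
  note cont = continuous_on_reg_log[OF a]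
  have T: "compactly_supported_prob (?T s)" for s
    by (intro compactly_supported_distr \<sigma> continuous_intros)
  have 1: "2 * ker_int ?K (?T s) ?\<nu> \<le> ker_int ?K \<sigma> \<sigma> + ker_int ?K ?\<nu> ?\<nu>" for s
  proof -
    have "0 \<le> quad_form ?K UNIV (\<lambda>b. if b then 1 else - 1) (\<lambda>b. if b then ?T s else ?\<nu>)"
      using T \<nu> a by (intro quad_form_reg_log_nonneg) (auto simp: UNIV_bool)
    also have "\<dots> = ker_int ?K (?T s) (?T s) - ker_int ?K (?T s) ?\<nu> - ker_int ?K ?\<nu> (?T s) + ker_int ?K ?\<nu> ?\<nu>"
      by (simp add: quad_form_def UNIV_bool)
    also have "ker_int ?K ?\<nu> (?T s) = ker_int ?K (?T s) ?\<nu>" by (rule ker_int_sym[OF \<nu> T cont])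
    finally show ?thesis by (simp add: ker_int_translate[OF cont])
  qed
  define p where "p x = (\<integral>y. ?K ((cmod (x - y))\<^sup>2) \<partial>?\<nu>)" for x
  have pm[measurable]: "p \<in> borel_measurable borel" unfolding p_def by (rule measurable_potential[OF \<nu> cont])
  have pi: "integrable ?\<nu> p" and pe: "ker_int ?K ?\<nu> ?\<nu> = (\<integral>x. p x \<partial>?\<nu>)"
    unfolding p_def using ker_int_eq_iterated[OF \<nu> \<nu> cont] by auto
  have pT: "ker_int ?K (?T s) ?\<nu> = (\<integral>x. p (x + s) \<partial>\<sigma>)" for s
    unfolding ker_int_eq_iterated(1)[OF T \<nu> cont] p_def[symmetric] by (rule integral_distr) auto
  \<comment> \<open>Averaged over s, the mixed energy of translate and smoothed measure becomes the
    self-energy of the smoothed measure; one copy of it then cancels.\<close>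
  have "2 * ker_int ?K ?\<nu> ?\<nu> = (\<integral>s. 2 * (\<integral>x. p (x + s) \<partial>\<sigma>) \<partial>disc r)"
    using integral_smoothed(3)[OF pi] by (simp add: pe)
  also have "\<dots> \<le> (\<integral>s. ker_int ?K \<sigma> \<sigma> + ker_int ?K ?\<nu> ?\<nu> \<partial>disc r)"
    using integral_smoothed(4)[OF pi] 1 by (intro integral_mono) (auto simp: pT)
  also have "\<dots> = ker_int ?K \<sigma> \<sigma> + ker_int ?K ?\<nu> ?\<nu>" by (simp add: d.prob_space)
  finally show ?thesis by simp
qed

end

end

section \<open>Comparing the logarithm with its regularisation\<close>

lemma reg_log_le_ln:
  assumes "0 < a" "0 < x" shows "reg_log a (x\<^sup>2) \<le> - ln x"
proof -
  have "ln (x\<^sup>2) \<le> ln (x\<^sup>2 + a)" using assms by (subst ln_le_cancel_iff) (auto intro: add_pos_pos)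
  then show ?thesis using assms by (simp add: reg_log_def ln_realpow)
qed

text \<open>With y = sqrt a / x the gap is ln (1 + y^2) / 2, at most ln (1 + y) and so at most y.
  This error is a multiple of 1 / x, which measures of bounded density integrate.\<close>

lemma ln_le_reg_log:
  assumes "0 < a" "0 < x" shows "- ln x \<le> reg_log a (x\<^sup>2) + sqrt a / x"
proof -
  define y where "y = sqrt a / x"
  have y: "0 < y" using assms by (simp add: y_def)
  have "x\<^sup>2 + a = x\<^sup>2 * (1 + y\<^sup>2)" using assms by (simp add: y_def field_simps)
  moreover have "0 < 1 + y\<^sup>2" by (simp add: add_pos_nonneg)
  ultimately have "ln (x\<^sup>2 + a) = 2 * ln x + ln (1 + y\<^sup>2)" using assms by (simp add: ln_mult ln_realpow)
  moreover have "ln (1 + y\<^sup>2) \<le> ln ((1 + y)\<^sup>2)"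
    using y by (subst ln_le_cancel_iff) (auto simp: power2_eq_square algebra_simps add_pos_pos)
  moreover have "ln ((1 + y)\<^sup>2) \<le> 2 * y" using y ln_add_one_self_le_self[of y] by (simp add: ln_realpow)
  ultimately show ?thesis unfolding reg_log_def y_def[symmetric] by argo
qed

lemma ker_int_reg_log_le_log_energy:
  assumes "compactly_supported_prob \<alpha>" "compactly_supported_prob \<beta>" "finite_log_energy \<alpha> \<beta>" "0 < a"
  shows "ker_int (reg_log a) \<alpha> \<beta> \<le> log_energy \<alpha> \<beta>"
  unfolding ker_int_def log_energy_def
proof (rule integral_mono_AE)
  show "integrable (\<alpha> \<Otimes>\<^sub>M \<beta>) (\<lambda>p. reg_log a ((cmod (fst p - snd p))\<^sup>2))"
    by (intro integrable_radial_kernel continuous_on_reg_log assms)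
  show "integrable (\<alpha> \<Otimes>\<^sub>M \<beta>) (\<lambda>p. - ln (cmod (fst p - snd p)))" using assms by (simp add: finite_log_energy_def)
  have "AE p in \<alpha> \<Otimes>\<^sub>M \<beta>. fst p \<noteq> snd p" using assms by (simp add: finite_log_energy_def)
  then show "AE p in \<alpha> \<Otimes>\<^sub>M \<beta>. reg_log a ((cmod (fst p - snd p))\<^sup>2) \<le> - ln (cmod (fst p - snd p))"
    by eventually_elim (use assms in \<open>auto intro!: reg_log_le_ln\<close>)
qed

text \<open>C bounds the integrals of 1 / |z - y| over y for all z, so the error C sqrt a vanishes
  with a uniformly in z. The energy bound follows by integrating the potential bound.\<close>

lemma bounded_density_potential:
  assumes \<nu>: "compactly_supported_prob \<nu>" "bounded_density M \<nu>"
  obtains C where "0 \<le> C"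
    "\<And>a z. 0 < a \<Longrightarrow> (\<integral>y. - ln (cmod (z - y)) \<partial>\<nu>) \<le> (\<integral>y. reg_log a ((cmod (z - y))\<^sup>2) \<partial>\<nu>) + C * sqrt a"
    "\<And>a. 0 < a \<Longrightarrow> log_energy \<nu> \<nu> \<le> ker_int (reg_log a) \<nu> \<nu> + C * sqrt a"
proof -
  note n = compactly_supported_probD[OF \<nu>(1)]
  interpret n: prob_space \<nu> by (rule n(1))
  interpret nn: pair_prob_space \<nu> \<nu> ..
  note [measurable_cong] = n(2)
  obtain C where C: "0 \<le> C" "\<And>z. (\<integral>\<^sup>+y. ennreal (1 / cmod (z - y)) \<partial>\<nu>) \<le> ennreal C"
    using bounded_density_inverse_norm[OF \<nu>(2) n(1)] by blast
  note int = integrable_log_bounded_density[OF \<nu>]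
  have C': "(\<integral>y. 1 / cmod (z - y) \<partial>\<nu>) \<le> C" for z
    using C by (intro integral_real_bounded) auto
  have pot: "(\<integral>y. - ln (cmod (z - y)) \<partial>\<nu>) \<le> (\<integral>y. reg_log a ((cmod (z - y))\<^sup>2) \<partial>\<nu>) + C * sqrt a" if a: "0 < a" for a z
  proof -
    have rc: "continuous_on UNIV (\<lambda>y. reg_log a ((cmod (z - y))\<^sup>2))"
      by (intro continuous_on_compose2[OF continuous_on_reg_log[OF a]] continuous_intros) auto
    have ri: "integrable \<nu> (\<lambda>y. reg_log a ((cmod (z - y))\<^sup>2))" by (rule integrable_compactly_supported[OF \<nu>(1) rc])
    have "(\<integral>y. - ln (cmod (z - y)) \<partial>\<nu>) \<le> (\<integral>y. reg_log a ((cmod (z - y))\<^sup>2) + sqrt a * (1 / cmod (z - y)) \<partial>\<nu>)"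
    proof (rule integral_mono_AE)
      show "integrable \<nu> (\<lambda>y. - ln (cmod (z - y)))" using int(1)[of z] by simp
      show "integrable \<nu> (\<lambda>y. reg_log a ((cmod (z - y))\<^sup>2) + sqrt a * (1 / cmod (z - y)))"
        by (intro Bochner_Integration.integrable_add integrable_mult_right ri int(2))
      show "AE y in \<nu>. - ln (cmod (z - y)) \<le> reg_log a ((cmod (z - y))\<^sup>2) + sqrt a * (1 / cmod (z - y))"
        using bounded_density_AE_neq[OF \<nu>(2), of z] by eventually_elim (use ln_le_reg_log[OF a] in auto)
    qed
    also have "\<dots> = (\<integral>y. reg_log a ((cmod (z - y))\<^sup>2) \<partial>\<nu>) + sqrt a * (\<integral>y. 1 / cmod (z - y) \<partial>\<nu>)"
      by (subst Bochner_Integration.integral_add[OF ri integrable_mult_right[OF int(2)]])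
         (simp only: integral_mult_right_zero)
    also have "sqrt a * (\<integral>y. 1 / cmod (z - y) \<partial>\<nu>) \<le> sqrt a * C" using C'[of z] a by (intro mult_left_mono) auto
    finally show ?thesis by (simp add: mult.commute)
  qed
  have "log_energy \<nu> \<nu> \<le> ker_int (reg_log a) \<nu> \<nu> + C * sqrt a" if a: "0 < a" for a
  proof -
    have i: "integrable (\<nu> \<Otimes>\<^sub>M \<nu>) (case_prod (\<lambda>x y. - ln (cmod (x - y))))"
      using finite_log_energy_bounded_density[OF \<nu>(1) \<nu>] by (simp add: finite_log_energy_def case_prod_beta')
    have k: "integrable (\<nu> \<Otimes>\<^sub>M \<nu>) (case_prod (\<lambda>x y. reg_log a ((cmod (x - y))\<^sup>2)))"
      using integrable_radial_kernel[OF \<nu>(1) \<nu>(1) continuous_on_reg_log[OF a]] by (simp add: case_prod_beta')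
    have "log_energy \<nu> \<nu> = (\<integral>z. (\<integral>y. - ln (cmod (z - y)) \<partial>\<nu>) \<partial>\<nu>)"
      using nn.integral_fst[OF i] by (simp add: log_energy_def case_prod_beta')
    also have "\<dots> \<le> (\<integral>z. (\<integral>y. reg_log a ((cmod (z - y))\<^sup>2) \<partial>\<nu>) + C * sqrt a \<partial>\<nu>)"
      using nn.integrable_fst[OF i] nn.integrable_fst[OF k] pot[OF a] by (intro integral_mono) auto
    also have "\<dots> = ker_int (reg_log a) \<nu> \<nu> + C * sqrt a"
      using nn.integrable_fst[OF k] nn.integral_fst[OF k]
      by (subst Bochner_Integration.integral_add) (auto simp: n.prob_space ker_int_def case_prod_beta')
    finally show ?thesis .
  qed
  with C(1) pot show ?thesis using that by blast
qed

context extremal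
begin

text \<open>The comparison is made for \<open>reg_log a\<close>, where positivity is available, and
  then a tends to 0: for \<sigma> the regularised energy is below the true one, and for the smoothed
  measure the loss is only C sqrt a.\<close>

lemma log_energy_smoothed_le:
  assumes r: "0 < r"
  shows "log_energy (smoothed r) (smoothed r) \<le> log_energy \<sigma> \<sigma>"
proof -
  note \<nu> = compactly_supported_smoothed[OF r] bounded_density_smoothed[OF r]
  obtain C where C: "0 \<le> C" "\<And>a. 0 < a \<Longrightarrow> log_energy (smoothed r) (smoothed r) \<le> ker_int (reg_log a) (smoothed r) (smoothed r) + C * sqrt a"
    using bounded_density_potential[OF \<nu>] by metis
  show ?thesis
  proof (rule field_le_epsilon)
    fix e :: real assume e: "0 < e"
    define a where "a = (e / (C + 1))\<^sup>2"
    have a: "0 < a" and sa: "sqrt a = e / (C + 1)" using e C(1) by (auto simp: a_def)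
    have "log_energy (smoothed r) (smoothed r) \<le> ker_int (reg_log a) (smoothed r) (smoothed r) + C * sqrt a"
      by (rule C(2)[OF a])
    also have "\<dots> \<le> log_energy \<sigma> \<sigma> + C * sqrt a"
      using ker_int_smoothed_le[OF r a] ker_int_reg_log_le_log_energy[OF \<sigma> \<sigma> finite_\<sigma> a] by simp
    also have "C * sqrt a \<le> e" using e C(1) by (simp add: sa field_simps)
    finally show "log_energy (smoothed r) (smoothed r) \<le> log_energy \<sigma> \<sigma> + e" by simp
  qed
qed

end

section \<open>The Gibbs form of the ensemble\<close>

text \<open>Each index lies in exactly N - 1 pairs. This count is what the inverse temperature (N -
  1) / \<tau> is matched to.\<close>

lemma sum_triangle_add:
  fixes g :: "nat \<Rightarrow> real"
  shows "(\<Sum>k<N. \<Sum>j<k. g j + g k) = (real N - 1) * (\<Sum>k<N. g k)"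
proof (induction N)
  case (Suc N)
  have "(\<Sum>j<N. g j + g N) = (\<Sum>j<N. g j) + real N * g N" by (simp add: sum.distrib)
  with Suc show ?case by (simp add: algebra_simps)
qed simp

lemma sum_square_triangle:
  fixes f :: "nat \<Rightarrow> nat \<Rightarrow> real"
  assumes sym: "\<And>i j. f i j = f j i"
  shows "(\<Sum>i<N. \<Sum>j<N. f i j) = (\<Sum>i<N. f i i) + 2 * (\<Sum>k<N. \<Sum>j<k. f j k)"
proof (induction N)
  case (Suc N)
  have "(\<Sum>i<Suc N. \<Sum>j<Suc N. f i j) = (\<Sum>i<N. \<Sum>j<N. f i j) + (\<Sum>i<N. f i N) + (\<Sum>j<N. f N j) + f N N"
    by (simp add: sum.distrib)
  also have "(\<Sum>j<N. f N j) = (\<Sum>i<N. f i N)" using sym by (intro sum.cong) auto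
  finally show ?case using Suc by simp
qed simp

lemma sum_triangle_const: "(\<Sum>k<N. \<Sum>j<k. c) = real N * (real N - 1) / 2 * (c::real)"
proof (induction N)
  case (Suc N)
  have "(\<Sum>k<Suc N. \<Sum>j<k. c) = real N * (real N - 1) / 2 * c + real N * c" using Suc by simp
  also have "\<dots> = real (Suc N) * (real (Suc N) - 1) / 2 * c" by (simp add: field_simps)
  finally show ?case .
qed simp

text \<open>Both sides agree on boxes, where density and indicator factor over the coordinates. It
  moves the weights exp (- \<beta> \<Phi>) from the reference measures into a density with respect
  to Lebesgue measure.\<close>

lemma PiM_density:
  fixes M :: "'a measure" and f :: "'a \<Rightarrow> real"
  assumes I: "finite I" and "sigma_finite_measure M" and [measurable]: "f \<in> borel_measurable M"
  shows "PiM I (\<lambda>_. density M (\<lambda>x. ennreal (f x))) = density (PiM I (\<lambda>_. M)) (\<lambda>z. \<Prod>i\<in>I. ennreal (f (z i)))"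
proof -
  interpret M: sigma_finite_measure M by fact
  interpret D: sigma_finite_measure "density M (\<lambda>x. ennreal (f x))"
    by (subst M.sigma_finite_iff_density_finite) auto
  interpret PM: product_sigma_finite "\<lambda>_. M" ..
  interpret PD: product_sigma_finite "\<lambda>_. density M (\<lambda>x. ennreal (f x))" ..
  have m: "(\<lambda>z. \<Prod>i\<in>I. ennreal (f (z i))) \<in> borel_measurable (PiM I (\<lambda>_. M))"
    by (intro borel_measurable_prod_ennreal measurable_compose[OF measurable_component_singleton]) auto
  show ?thesis
  proof (rule PD.PiM_eqI[OF I, symmetric])
    show "sets (density (PiM I (\<lambda>_. M)) (\<lambda>z. \<Prod>i\<in>I. ennreal (f (z i)))) = sets (PiM I (\<lambda>_. density M (\<lambda>x. ennreal (f x))))"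
      unfolding sets_density by (rule sets_PiM_cong) simp_all
    fix A assume A: "\<And>i. i \<in> I \<Longrightarrow> A i \<in> sets (density M (\<lambda>x. ennreal (f x)))"
    then have A': "A i \<in> sets M" if "i \<in> I" for i using that by simp
    have "emeasure (density (PiM I (\<lambda>_. M)) (\<lambda>z. \<Prod>i\<in>I. ennreal (f (z i)))) (Pi\<^sub>E I A) =
      (\<integral>\<^sup>+z. (\<Prod>i\<in>I. ennreal (f (z i))) * indicator (Pi\<^sub>E I A) z \<partial>PiM I (\<lambda>_. M))"
      using m A' I by (intro emeasure_density) (auto intro!: sets_PiM_I_finite)
    also have "\<dots> = (\<integral>\<^sup>+z. (\<Prod>i\<in>I. ennreal (f (z i)) * indicator (A i) (z i)) \<partial>PiM I (\<lambda>_. M))"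
    proof (rule nn_integral_cong)
      fix z assume z: "z \<in> space (PiM I (\<lambda>_. M))"
      have "indicator (Pi\<^sub>E I A) z = (\<Prod>i\<in>I. indicator (A i) (z i) :: ennreal)"
      proof (cases "z \<in> Pi\<^sub>E I A")
        case True then show ?thesis by (auto simp: PiE_iff)
      next
        case False
        then obtain i where "i \<in> I" "z i \<notin> A i" using z by (auto simp: space_PiM PiE_iff)
        then show ?thesis using False I by (auto intro!: prod_zero[symmetric] bexI[of _ i])
      qed
      then show "(\<Prod>i\<in>I. ennreal (f (z i))) * indicator (Pi\<^sub>E I A) z = (\<Prod>i\<in>I. ennreal (f (z i)) * indicator (A i) (z i))"
        by (simp add: prod.distrib)
    qed
    also have "\<dots> = (\<Prod>i\<in>I. \<integral>\<^sup>+x. ennreal (f x) * indicator (A i) x \<partial>M)"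
      using A' I by (intro PM.product_nn_integral_prod) auto
    also have "\<dots> = (\<Prod>i\<in>I. emeasure (density M (\<lambda>x. ennreal (f x))) (A i))"
      using A' by (intro prod.cong refl) (simp add: emeasure_density)
    finally show "emeasure (density (PiM I (\<lambda>_. M)) (\<lambda>z. \<Prod>i\<in>I. ennreal (f (z i)))) (Pi\<^sub>E I A) =
      (\<Prod>i\<in>I. emeasure (density M (\<lambda>x. ennreal (f x))) (A i))" .
  qed
qed

lemma distr_PiM_pair:
  assumes \<nu>: "prob_space \<nu>" and I: "finite I" "i \<in> I" "j \<in> I" "i \<noteq> j"
  shows "distr (PiM I (\<lambda>_. \<nu>)) (\<nu> \<Otimes>\<^sub>M \<nu>) (\<lambda>z. (z i, z j)) = \<nu> \<Otimes>\<^sub>M \<nu>"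
proof -
  interpret n: prob_space \<nu> by (rule \<nu>)
  interpret P: product_sigma_finite "\<lambda>_. \<nu>" ..
  have m: "(\<lambda>z. (z i, z j)) \<in> PiM I (\<lambda>_. \<nu>) \<rightarrow>\<^sub>M \<nu> \<Otimes>\<^sub>M \<nu>"
    using I by (intro measurable_Pair measurable_component_singleton)
  show ?thesis
  proof (rule pair_measure_eqI[symmetric])
    fix A B assume AB: "A \<in> sets \<nu>" "B \<in> sets \<nu>"
    define E where "E = (\<lambda>k. if k = i then A else if k = j then B else space \<nu>)"
    have pre: "(\<lambda>z. (z i, z j)) -` (A \<times> B) \<inter> space (PiM I (\<lambda>_. \<nu>)) = Pi\<^sub>E I E"
    proof -
      have sub: "E k \<subseteq> space \<nu>" for k using AB[THEN sets.sets_into_space] by (auto simp: E_def)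
      have "z \<in> Pi\<^sub>E I E \<longleftrightarrow> z i \<in> A \<and> z j \<in> B \<and> z \<in> Pi\<^sub>E I (\<lambda>_. space \<nu>)" for z
      proof
        assume z: "z \<in> Pi\<^sub>E I E"
        have "z i \<in> A" using PiE_mem[OF z I(2)] by (simp add: E_def)
        moreover have "z j \<in> B" using PiE_mem[OF z I(3)] I(4) by (simp add: E_def)
        moreover have "z \<in> Pi\<^sub>E I (\<lambda>_. space \<nu>)" using z sub unfolding PiE_iff by blast
        ultimately show "z i \<in> A \<and> z j \<in> B \<and> z \<in> Pi\<^sub>E I (\<lambda>_. space \<nu>)" by simp
      next
        assume z: "z i \<in> A \<and> z j \<in> B \<and> z \<in> Pi\<^sub>E I (\<lambda>_. space \<nu>)"
        then show "z \<in> Pi\<^sub>E I E" unfolding PiE_iff E_def by auto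
      qed
      then show ?thesis by (auto simp: space_PiM)
    qed
    have "emeasure (distr (PiM I (\<lambda>_. \<nu>)) (\<nu> \<Otimes>\<^sub>M \<nu>) (\<lambda>z. (z i, z j))) (A \<times> B) = emeasure (PiM I (\<lambda>_. \<nu>)) (Pi\<^sub>E I E)"
      using AB by (subst emeasure_distr[OF m]) (auto simp: pre)
    also have "\<dots> = (\<Prod>k\<in>I. emeasure \<nu> (E k))"
      using AB I by (intro P.emeasure_PiM) (auto simp: E_def)
    also have "\<dots> = emeasure \<nu> (E i) * (emeasure \<nu> (E j) * (\<Prod>k\<in>I - {i} - {j}. emeasure \<nu> (E k)))"
      using I by (simp add: prod.remove[of I i] prod.remove[of "I - {i}" j])
    also have "(\<Prod>k\<in>I - {i} - {j}. emeasure \<nu> (E k)) = 1"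
      by (intro prod.neutral) (auto simp: E_def n.emeasure_space_1)
    finally show "emeasure \<nu> A * emeasure \<nu> B = emeasure (distr (PiM I (\<lambda>_. \<nu>)) (\<nu> \<Otimes>\<^sub>M \<nu>) (\<lambda>z. (z i, z j))) (A \<times> B)"
      using I by (simp add: E_def)
  qed (auto intro: n.sigma_finite_measure_axioms)
qed

text \<open>One coordinate is exchanged at a time, each at the cost of a factor M. The total cost is
  exponential in the number of particles, negligible against exponentials of its square.\<close>

lemma nn_integral_PiM_bounded_density:
  assumes bd: "bounded_density M \<nu>" and \<nu>: "prob_space \<nu>" and I: "finite I"
    and f: "f \<in> borel_measurable (PiM I (\<lambda>_. borel))"
  shows "(\<integral>\<^sup>+z. f z \<partial>PiM I (\<lambda>_. \<nu>)) \<le> ennreal M ^ card I * (\<integral>\<^sup>+z. f z \<partial>PiM I (\<lambda>_. lborel :: complex measure))"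
  using I f
proof (induction I arbitrary: f rule: finite_induct)
  case empty
  then show ?case by (simp add: PiM_empty nn_integral_count_space)
next
  case (insert i I)
  interpret n: prob_space \<nu> by (rule \<nu>)
  have s: "sets \<nu> = sets borel" using bd by (simp add: bounded_density_def)
  interpret P: product_sigma_finite "\<lambda>_. \<nu>" ..
  interpret L: product_sigma_finite "\<lambda>_. lborel :: complex measure" ..
  have fm: "f \<in> borel_measurable (PiM (insert i I) (\<lambda>_. \<nu>))" "f \<in> borel_measurable (PiM (insert i I) (\<lambda>_. lborel))"
    using insert.prems s by (auto cong: measurable_cong_sets[OF sets_PiM_cong refl])
  have f1: "(\<lambda>y. f (x(i := y))) \<in> borel_measurable borel" if "x \<in> space (PiM I (\<lambda>_. borel))" for x
    using measurable_comp[OF measurable_component_update[OF that insert.hyps(2)] insert.prems] by (simp add: comp_def)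
  have f2: "(\<lambda>x. \<integral>\<^sup>+y. f (x(i := y)) \<partial>lborel) \<in> borel_measurable (PiM I (\<lambda>_. borel))"
  proof -
    have "case_prod (\<lambda>x y. f (x(i := y))) \<in> borel_measurable (PiM I (\<lambda>_. borel) \<Otimes>\<^sub>M lborel)"
      using measurable_comp[OF measurable_add_dim insert.prems] by (simp add: comp_def case_prod_beta')
    then show ?thesis by (rule lborel.borel_measurable_nn_integral)
  qed
  have sp: "space (PiM I (\<lambda>_. \<nu>)) = space (PiM I (\<lambda>_. borel))"
    using sets_eq_imp_space_eq[OF s] by (simp add: space_PiM)
  have "(\<integral>\<^sup>+z. f z \<partial>PiM (insert i I) (\<lambda>_. \<nu>)) = (\<integral>\<^sup>+x. (\<integral>\<^sup>+y. f (x(i := y)) \<partial>\<nu>) \<partial>PiM I (\<lambda>_. \<nu>))"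
    by (rule P.product_nn_integral_insert[OF insert.hyps fm(1)])
  also have "\<dots> \<le> (\<integral>\<^sup>+x. ennreal M * (\<integral>\<^sup>+y. f (x(i := y)) \<partial>lborel) \<partial>PiM I (\<lambda>_. \<nu>))"
    by (intro nn_integral_mono nn_integral_bounded_density[OF bd] f1) (simp add: sp)
  also have "\<dots> \<le> ennreal M ^ card I * (\<integral>\<^sup>+x. ennreal M * (\<integral>\<^sup>+y. f (x(i := y)) \<partial>lborel) \<partial>PiM I (\<lambda>_. lborel))"
    by (rule insert.IH) (rule borel_measurable_times_ennreal[OF borel_measurable_const f2])
  also have "\<dots> = ennreal M ^ card I * (ennreal M * (\<integral>\<^sup>+x. (\<integral>\<^sup>+y. f (x(i := y)) \<partial>lborel) \<partial>PiM I (\<lambda>_. lborel)))"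
  proof -
    have "(\<lambda>x. \<integral>\<^sup>+y. f (x(i := y)) \<partial>lborel) \<in> borel_measurable (PiM I (\<lambda>_. lborel))"
      using f2 by (subst measurable_cong_sets[OF sets_PiM_cong refl]) auto
    then show ?thesis by (simp only: nn_integral_cmult)
  qed
  also have "(\<integral>\<^sup>+x. (\<integral>\<^sup>+y. f (x(i := y)) \<partial>lborel) \<partial>PiM I (\<lambda>_. lborel)) = (\<integral>\<^sup>+z. f z \<partial>PiM (insert i I) (\<lambda>_. lborel))"
    by (rule L.product_nn_integral_insert[OF insert.hyps fm(2), symmetric])
  finally show ?case using insert.hyps by (simp add: mult_ac)
qed

text \<open>The nonnegative integral truncates negative values to 0, so it can only be larger.
  Needed for the tangent line in Jensen's inequality, which takes negative values.\<close>

lemma integral_le_nn_integral: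
  assumes "integrable M f" shows "ennreal (\<integral>x. f x \<partial>M) \<le> (\<integral>\<^sup>+x. ennreal (f x) \<partial>M)"
proof -
  have fin: "(\<integral>\<^sup>+x. ennreal (f x) \<partial>M) \<noteq> \<infinity>" using assms by (auto simp: real_integrable_def)
  have "(\<integral>x. f x \<partial>M) \<le> enn2real (\<integral>\<^sup>+x. ennreal (f x) \<partial>M)"
    unfolding real_lebesgue_integral_def[OF assms] by simp
  then have "ennreal (\<integral>x. f x \<partial>M) \<le> ennreal (enn2real (\<integral>\<^sup>+x. ennreal (f x) \<partial>M))" by (rule ennreal_leI)
  moreover have "ennreal (enn2real (\<integral>\<^sup>+x. ennreal (f x) \<partial>M)) = (\<integral>\<^sup>+x. ennreal (f x) \<partial>M)"
    using fin by (simp add: less_top)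
  ultimately show ?thesis by simp
qed

context extremal
begin

definition L :: "complex \<Rightarrow> complex \<Rightarrow> real" where
  "L z w = - ln (cmod (z - w)) + Q z + Q w"

text \<open>The factor 2 counts ordered pairs. At coincident points \<open>ln 0 = 0\<close> leaves H
  finite although the weight vanishes, hence the separate treatment of non-injective
  configurations.\<close>

definition H :: "nat \<Rightarrow> (nat \<Rightarrow> complex) \<Rightarrow> real" where
  "H N z = (\<Sum>k<N. \<Sum>j<k. 2 * L (z j) (z k))"

definition weight :: "nat \<Rightarrow> (nat \<Rightarrow> complex) \<Rightarrow> real" where
  "weight N z = (cmod (vandermonde N z))\<^sup>2 * (\<Prod>j<N. exp (- ((real N - 1) / \<tau>) * \<Phi> (z j)))"

lemma H_eq: "H N z = - 2 * (\<Sum>k<N. \<Sum>j<k. ln (cmod (z j - z k))) + 2 * (real N - 1) * (\<Sum>k<N. Q (z k))"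
proof -
  have "H N z = (\<Sum>k<N. \<Sum>j<k. - 2 * ln (cmod (z j - z k)) + 2 * (Q (z j) + Q (z k)))"
    by (simp add: H_def L_def algebra_simps)
  also have "\<dots> = - 2 * (\<Sum>k<N. \<Sum>j<k. ln (cmod (z j - z k))) + 2 * (\<Sum>k<N. \<Sum>j<k. Q (z j) + Q (z k))"
    by (simp only: sum.distrib sum_distrib_left distrib_left)
  finally show ?thesis by (simp add: sum_triangle_add)
qed

lemma weight_eq_exp:
  assumes "inj_on z {..<N}" shows "weight N z = exp (- H N z)"
proof -
  have ne: "z j \<noteq> z k" if "k < N" "j < k" for j k
    using assms that by (auto simp: inj_on_def)
  have "(cmod (vandermonde N z))\<^sup>2 = (\<Prod>k<N. \<Prod>j<k. (cmod (z j - z k))\<^sup>2)"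
    by (simp add: vandermonde_def prod_norm[symmetric] flip: prod_power_distrib)
  also have "\<dots> = (\<Prod>k<N. \<Prod>j<k. exp (2 * ln (cmod (z j - z k))))"
    using ne by (intro prod.cong refl) (simp add: exp_double)
  also have "\<dots> = exp (2 * (\<Sum>k<N. \<Sum>j<k. ln (cmod (z j - z k))))"
    by (simp add: exp_sum sum_distrib_left)
  finally have 1: "(cmod (vandermonde N z))\<^sup>2 = exp (2 * (\<Sum>k<N. \<Sum>j<k. ln (cmod (z j - z k))))" .
  have 2: "(\<Prod>j<N. exp (- ((real N - 1) / \<tau>) * \<Phi> (z j))) = exp (- (2 * (real N - 1) * (\<Sum>k<N. Q (z k))))"
  proof -
    have "- ((real N - 1) / \<tau>) * \<Phi> x = - (2 * (real N - 1) * Q x)" for x using \<tau> by (simp add: Q_def field_simps)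
    then show ?thesis by (simp add: exp_sum sum_distrib_left flip: sum_negf)
  qed
  show ?thesis unfolding weight_def 1 2 H_eq by (simp flip: exp_add)
qed

lemma weight_eq_0:
  assumes "\<not> inj_on z {..<N}" shows "weight N z = 0"
proof -
  from assms obtain j k where "k < N" "j < k" "z j = z k"
    unfolding inj_on_def by (metis lessThan_iff linorder_neqE_nat)
  then have "(\<Prod>j<k. z j - z k) = 0" by (intro prod_zero) auto
  with \<open>k < N\<close> have "vandermonde N z = 0" unfolding vandermonde_def by (intro prod_zero) auto
  then show ?thesis by (simp add: weight_def)
qed

lemma measurable_component_lborel:
  "i \<in> J \<Longrightarrow> (\<lambda>z. z i) \<in> PiM J (\<lambda>_. borel :: complex measure) \<rightarrow>\<^sub>M borel"
  by (rule measurable_component_singleton)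

lemma measurable_of_component:
  "g \<in> borel_measurable borel \<Longrightarrow> i \<in> J \<Longrightarrow> (\<lambda>z. g (z i)) \<in> borel_measurable (PiM J (\<lambda>_. borel :: complex measure))"
  by (rule measurable_compose[OF measurable_component_lborel])

lemma measurable_H [measurable]: "H N \<in> borel_measurable (PiM {..<N} (\<lambda>_. borel))"
proof -
  have [measurable]: "(\<lambda>z. z i) \<in> PiM {..<N} (\<lambda>_. borel :: complex measure) \<rightarrow>\<^sub>M borel" if "i < N" for i
    using that by (intro measurable_component_lborel) auto
  show ?thesis unfolding H_def L_def
    by (intro borel_measurable_sum borel_measurable_times borel_measurable_add borel_measurable_uminus
        borel_measurable_ln borel_measurable_norm borel_measurable_diff borel_measurable_const
        measurable_compose[OF _ Q_measurable] measurable_component_lborel) auto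
qed

lemma measurable_weight [measurable]: "weight N \<in> borel_measurable (PiM {..<N} (\<lambda>_. borel))"
proof -
  have [measurable]: "\<Phi> \<in> borel_measurable borel" using cont_\<Phi> by (rule borel_measurable_continuous_onI)
  show ?thesis unfolding weight_def vandermonde_def
    by (intro borel_measurable_times borel_measurable_power borel_measurable_norm borel_measurable_prod
        borel_measurable_diff measurable_component_lborel
        measurable_of_component[of "\<lambda>x. exp (- ((real N - 1) / \<tau>) * \<Phi> x)"]) auto
qed

lemma PiM_weighted:
  fixes N :: nat
  shows "PiM {..<N} (\<lambda>_. weighted_measure \<beta> \<Phi>) =
    density (PiM {..<N} (\<lambda>_. lborel)) (\<lambda>z. \<Prod>j<N. ennreal (exp (- \<beta> * \<Phi> (z j))))"
proof -
  have [measurable]: "\<Phi> \<in> borel_measurable borel" using cont_\<Phi> by (rule borel_measurable_continuous_onI)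
  show ?thesis unfolding weighted_measure_def
    using PiM_density[OF finite_lessThan lborel.sigma_finite_measure_axioms, of "\<lambda>z. exp (- \<beta> * \<Phi> z)" N] by simp
qed

abbreviation lebN :: "nat \<Rightarrow> (nat \<Rightarrow> complex) measure" where
  "lebN N \<equiv> PiM {..<N} (\<lambda>_. lborel)"

definition Z :: "nat \<Rightarrow> ennreal" where "Z N = (\<integral>\<^sup>+z. ennreal (weight N z) \<partial>lebN N)"

lemma sets_lebN [measurable_cong]: "sets (lebN N) = sets (PiM {..<N} (\<lambda>_. borel))"
  by (intro sets_PiM_cong) auto

lemma measurable_vandermonde [measurable]: "vandermonde N \<in> borel_measurable (PiM {..<N} (\<lambda>_. borel))"
  unfolding vandermonde_def
  by (intro borel_measurable_prod borel_measurable_diff measurable_component_lborel) auto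

lemma measurable_vandermonde_square:
  "(\<lambda>z. ennreal ((cmod (vandermonde N z))\<^sup>2)) \<in> borel_measurable (PiM {..<N} (\<lambda>_. borel))"
  by (rule measurable_compose[OF measurable_vandermonde, of "\<lambda>w. ennreal ((cmod w)\<^sup>2)"]) measurable

lemma measurable_expprod [measurable]:
  fixes N :: nat
  shows "(\<lambda>z. \<Prod>j<N. ennreal (exp (- \<beta> * \<Phi> (z j)))) \<in> borel_measurable (PiM {..<N} (\<lambda>_. borel))"
proof -
  have [measurable]: "\<Phi> \<in> borel_measurable borel" using cont_\<Phi> by (rule borel_measurable_continuous_onI)
  show ?thesis
    by (intro borel_measurable_prod_ennreal measurable_of_component[of "\<lambda>x. ennreal (exp (- \<beta> * \<Phi> x))"]) auto
qed

lemma weight_ennreal: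
  "(\<Prod>j<N. ennreal (exp (- ((real N - 1) / \<tau>) * \<Phi> (z j)))) * ennreal ((cmod (vandermonde N z))\<^sup>2) = ennreal (weight N z)"
  unfolding weight_def by (subst prod_ennreal) (auto simp: ennreal_mult prod_nonneg mult.commute)

lemma partition_function_eq: "partition_function N ((real N - 1) / \<tau>) \<Phi> = Z N"
  unfolding partition_function_def Z_def PiM_weighted weight_ennreal[symmetric]
proof (rule nn_integral_density)
  show "(\<lambda>z. \<Prod>j<N. ennreal (exp (- ((real N - 1) / \<tau>) * \<Phi> (z j)))) \<in> borel_measurable (lebN N)"
    using measurable_expprod by (simp only: measurable_cong_sets[OF sets_lebN refl])
  show "(\<lambda>z. ennreal ((cmod (vandermonde N z))\<^sup>2)) \<in> borel_measurable (lebN N)"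
    using measurable_vandermonde_square by (simp only: measurable_cong_sets[OF sets_lebN refl])
qed

lemma ensemble_eq:
  "ensemble N ((real N - 1) / \<tau>) \<Phi> = density (lebN N) (\<lambda>z. ennreal (weight N z) / Z N)"
  unfolding ensemble_def partition_function_eq PiM_weighted
proof -
  let ?f = "\<lambda>z. \<Prod>j<N. ennreal (exp (- ((real N - 1) / \<tau>) * \<Phi> (z j)))"
  let ?g = "\<lambda>z. ennreal ((cmod (vandermonde N z))\<^sup>2) / Z N"
  have "?f \<in> borel_measurable (PiM {..<N} (\<lambda>_. borel))" by (rule measurable_expprod)
  moreover have "?g \<in> borel_measurable (PiM {..<N} (\<lambda>_. borel))"
    by (intro borel_measurable_divide_ennreal measurable_vandermonde_square borel_measurable_const)
  ultimately have "?f \<in> borel_measurable (lebN N)" "?g \<in> borel_measurable (lebN N)"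
    by (simp_all only: measurable_cong_sets[OF sets_lebN refl])
  note density_density_eq[OF this]
  moreover have "(\<lambda>z. ?f z * ?g z) = (\<lambda>z. ennreal (weight N z) / Z N)"
    unfolding weight_ennreal[symmetric] by (simp add: divide_ennreal_def mult.assoc)
  ultimately show "density (density (lebN N) ?f) ?g = density (lebN N) (\<lambda>z. ennreal (weight N z) / Z N)" by simp
qed

end

section \<open>Concentration on configurations of low energy\<close>

text \<open>The exponent is - e N^2 up to terms linear in N, so it eventually lies below -
  N.\<close>

lemma gaussian_rate_tendsto_0:
  fixes c d e :: real assumes "0 < e"
  shows "(\<lambda>N. exp (real N * c + (real N - 1) * (d - real N * e))) \<longlonglongrightarrow> 0"
proof -
  \<comment> \<open>From here on N e - d is at least 2 |c| + 2 and N - 1 is at least N / 2; the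
    product absorbs N c and leaves - N.\<close>
  define n0 where "n0 = 2 + nat \<lceil>(4 * \<bar>c\<bar> + 4 * \<bar>d\<bar> + 4) / e\<rceil>"
  have bound: "exp (real N * c + (real N - 1) * (d - real N * e)) \<le> exp (- 1) ^ N" if N: "n0 \<le> N" for N
  proof -
    have N2: "2 \<le> real N" using N unfolding n0_def by linarith
    have "(4 * \<bar>c\<bar> + 4 * \<bar>d\<bar> + 4) / e \<le> real N" using N unfolding n0_def by linarith
    then have Ne: "4 * \<bar>c\<bar> + 4 * \<bar>d\<bar> + 4 \<le> real N * e" using assms by (simp add: pos_divide_le_eq)
    have "real N / 2 * (real N * e - d) \<le> (real N - 1) * (real N * e - d)"
      using N2 Ne by (intro mult_right_mono) linarith+
    moreover have "real N / 2 * (2 * \<bar>c\<bar> + 2) \<le> real N / 2 * (real N * e - d)"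
      using N2 Ne by (intro mult_left_mono) linarith+
    moreover have "real N * c \<le> real N * \<bar>c\<bar>" by (intro mult_left_mono) auto
    moreover have "real N / 2 * (2 * \<bar>c\<bar> + 2) = real N * \<bar>c\<bar> + real N" by (simp add: algebra_simps)
    moreover have "(real N - 1) * (d - real N * e) = - ((real N - 1) * (real N * e - d))"
      by (metis minus_diff_eq mult_minus_right)
    ultimately have "real N * c + (real N - 1) * (d - real N * e) \<le> real N * (- 1)" by linarith
    then have "exp (real N * c + (real N - 1) * (d - real N * e)) \<le> exp (real N * (- 1))" by simp
    also have "\<dots> = exp (- 1) ^ N" by (rule exp_of_nat_mult)
    finally show ?thesis .
  qed
  have lim: "(\<lambda>N. exp (- 1 :: real) ^ N) \<longlonglongrightarrow> 0" by (intro LIMSEQ_power_zero) simp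
  have ev: "eventually (\<lambda>N. exp (real N * c + (real N - 1) * (d - real N * e)) \<le> exp (- 1) ^ N) sequentially"
    using bound unfolding eventually_sequentially by blast
  show ?thesis
    by (rule tendsto_sandwich[OF _ ev tendsto_const lim]) (intro always_eventually allI, rule exp_ge_zero)
qed

context extremal
begin

text \<open>The growth condition says little near the origin, where ln |z| is very negative;
  continuity supplies a bound on the unit disc, and outside it 1 + |z| \<le> 2 |z| costs A ln 2. The
  result holds on the whole plane with a nonnegative logarithm.\<close>

lemma growth:
  assumes A: "0 < A"
  obtains C where "0 \<le> C" "\<And>z. A * ln (1 + cmod z) - C \<le> Q z"
proof -
  obtain C0 where C0: "\<And>z. z \<noteq> 0 \<Longrightarrow> 2 * \<tau> * A * ln (cmod z) - C0 \<le> \<Phi> z"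
    using growth_\<Phi> A \<tau> unfolding superlog_growth_def by (metis mult_pos_pos zero_less_numeral)
  have "bounded (Q ` cball 0 1)" by (intro compact_imp_bounded compact_continuous_image continuous_on_subset[OF cont_Q]) auto
  then obtain G where G: "\<And>x. x \<in> cball 0 1 \<Longrightarrow> \<bar>Q x\<bar> \<le> G" "0 < G" by (metis bounded_pos imageI real_norm_def)
  define C where "C = \<bar>C0\<bar> / (2 * \<tau>) + A * ln 2 + G"
  have parts: "0 \<le> \<bar>C0\<bar> / (2 * \<tau>)" "0 \<le> A * ln 2" using A \<tau> by auto
  show ?thesis
  proof (rule that)
    show "0 \<le> C" using parts G(2) by (simp add: C_def)
    fix z
    show "A * ln (1 + cmod z) - C \<le> Q z"
    proof (cases "cmod z \<le> 1")
      case True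
      have "ln (1 + cmod z) \<le> ln 2" using True by (subst ln_le_cancel_iff) (auto intro: add_pos_nonneg)
      then have "A * ln (1 + cmod z) \<le> A * ln 2" using A by simp
      moreover have "- G \<le> Q z" using G(1)[of z] True by auto
      ultimately show ?thesis using parts(1) unfolding C_def by linarith
    next
      case False
      then have z: "1 < cmod z" "z \<noteq> 0" by auto
      have "ln (1 + cmod z) \<le> ln (2 * cmod z)" using z by (subst ln_le_cancel_iff) (auto intro: add_pos_nonneg)
      also have "\<dots> = ln 2 + ln (cmod z)" using z by (subst ln_mult) auto
      finally have "A * ln (1 + cmod z) \<le> A * ln 2 + A * ln (cmod z)" using A by (simp flip: distrib_left)
      moreover have "A * ln (cmod z) - \<bar>C0\<bar> / (2 * \<tau>) \<le> Q z"
      proof -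
        have "2 * \<tau> * A * ln (cmod z) - \<bar>C0\<bar> \<le> \<Phi> z" using C0[OF z(2)] by linarith
        then have "(2 * \<tau> * A * ln (cmod z) - \<bar>C0\<bar>) / (2 * \<tau>) \<le> Q z" unfolding Q_def using \<tau> by (intro divide_right_mono) auto
        then show ?thesis using \<tau> by (simp add: diff_divide_distrib)
      qed
      ultimately show ?thesis using G(2) unfolding C_def by linarith
    qed
  qed
qed

text \<open>What one particle keeps of its potential after ln |z - w| has been bounded by separate
  contributions of z and w. It still grows faster than any multiple of the logarithm.\<close>

definition q :: "complex \<Rightarrow> real" where "q z = Q z - ln (1 + cmod z)"

lemma ln_dist_le: "ln (cmod (z - w)) \<le> ln (1 + cmod z) + ln (1 + cmod w)"
proof (cases "z = w")
  case False
  have "cmod (z - w) \<le> cmod z + cmod w" by (rule norm_triangle_ineq4)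
  also have "\<dots> \<le> (1 + cmod z) * (1 + cmod w)" by (simp add: algebra_simps)
  finally have "ln (cmod (z - w)) \<le> ln ((1 + cmod z) * (1 + cmod w))"
    using False by (subst ln_le_cancel_iff) (auto intro!: mult_pos_pos add_pos_nonneg)
  also have "\<dots> = ln (1 + cmod z) + ln (1 + cmod w)" by (intro ln_mult_pos add_pos_nonneg) auto
  finally show ?thesis .
qed simp

lemma L_ge: "q z + q w \<le> L z w"
  using ln_dist_le[of z w] by (simp add: q_def L_def)

lemma H_ge: "2 * (real N - 1) * (\<Sum>k<N. q (z k)) \<le> H N z"
proof -
  have "2 * (real N - 1) * (\<Sum>k<N. q (z k)) = (\<Sum>k<N. \<Sum>j<k. 2 * (q (z j) + q (z k)))"
  proof -
    have "2 * (real N - 1) * (\<Sum>k<N. q (z k)) = 2 * (\<Sum>k<N. \<Sum>j<k. q (z j) + q (z k))"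
      by (simp only: sum_triangle_add[of "\<lambda>j. q (z j)" N] mult.assoc)
    then show ?thesis by (simp only: sum_distrib_left)
  qed
  also have "\<dots> \<le> H N z" unfolding H_def by (intro sum_mono mult_left_mono L_ge) auto
  finally show ?thesis .
qed

lemma L_pair:
  assumes \<nu>: "compactly_supported_prob \<nu>" "finite_log_energy \<nu> \<nu>"
  shows "has_bochner_integral (\<nu> \<Otimes>\<^sub>M \<nu>) (\<lambda>p. L (fst p) (snd p)) (energy \<nu>)"
proof -
  note n = compactly_supported_probD[OF \<nu>(1)]
  have "has_bochner_integral (\<nu> \<Otimes>\<^sub>M \<nu>) (\<lambda>p. - ln (cmod (fst p - snd p))) (log_energy \<nu> \<nu>)"
    unfolding log_energy_def using \<nu>(2) by (intro has_bochner_integral_integrable) (simp add: finite_log_energy_def)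
  then have "has_bochner_integral (\<nu> \<Otimes>\<^sub>M \<nu>) (\<lambda>p. - ln (cmod (fst p - snd p)) + Q (fst p) + Q (snd p))
    (log_energy \<nu> \<nu> + (\<integral>x. Q x \<partial>\<nu>) + (\<integral>x. Q x \<partial>\<nu>))"
    by (intro has_bochner_integral_add integral_pair_proj n integrable_Q \<nu>)
  moreover have "log_energy \<nu> \<nu> + (\<integral>x. Q x \<partial>\<nu>) + (\<integral>x. Q x \<partial>\<nu>) = energy \<nu>" by (simp add: energy_def)
  ultimately show ?thesis unfolding L_def by (simp only:)
qed

section \<open>The partition function and the probability of high energy\<close>

lemma Z_lower:
  assumes \<nu>: "compactly_supported_prob \<nu>" "bounded_density M \<nu>"
  shows "ennreal (exp (- (real N * (real N - 1) * energy \<nu>))) \<le> ennreal M ^ N * Z N"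
proof -
  note n = compactly_supported_probD[OF \<nu>(1)]
  interpret n: prob_space \<nu> by (rule n(1))
  interpret P: product_prob_space "\<lambda>_. \<nu>" "{..<N}" ..
  let ?P = "PiM {..<N} (\<lambda>_. \<nu>)"
  have fin: "finite_log_energy \<nu> \<nu>" by (rule finite_log_energy_bounded_density[OF \<nu>(1) \<nu>])
  have sP: "sets ?P = sets (PiM {..<N} (\<lambda>_. borel))" using n(2) by (intro sets_PiM_cong) auto
  have wm: "weight N \<in> borel_measurable ?P" using measurable_weight by (simp only: measurable_cong_sets[OF sP refl])
  define c where "c = real N * (real N - 1) * energy \<nu>"
  have pairm: "(\<lambda>z. (z j, z k)) \<in> ?P \<rightarrow>\<^sub>M \<nu> \<Otimes>\<^sub>M \<nu>" if "k < N" "j < k" for j k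
    using that by (intro measurable_Pair measurable_component_singleton) auto
  have d: "distr ?P (\<nu> \<Otimes>\<^sub>M \<nu>) (\<lambda>z. (z j, z k)) = \<nu> \<Otimes>\<^sub>M \<nu>" if "k < N" "j < k" for j k
    using that by (intro distr_PiM_pair n(1)) auto
  have Lint: "has_bochner_integral ?P (\<lambda>z. L (z j) (z k)) (energy \<nu>)" if "k < N" "j < k" for j k
  proof -
    have "has_bochner_integral (distr ?P (\<nu> \<Otimes>\<^sub>M \<nu>) (\<lambda>z. (z j, z k))) (\<lambda>p. L (fst p) (snd p)) (energy \<nu>)"
      unfolding d[OF that] by (rule L_pair[OF \<nu>(1) fin])
    then have "integrable (distr ?P (\<nu> \<Otimes>\<^sub>M \<nu>) (\<lambda>z. (z j, z k))) (\<lambda>p. L (fst p) (snd p))"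
      "integral\<^sup>L (distr ?P (\<nu> \<Otimes>\<^sub>M \<nu>) (\<lambda>z. (z j, z k))) (\<lambda>p. L (fst p) (snd p)) = energy \<nu>"
      by (auto simp: has_bochner_integral_iff)
    moreover have "(\<lambda>p. L (fst p) (snd p)) \<in> borel_measurable (\<nu> \<Otimes>\<^sub>M \<nu>)"
      using L_pair[OF \<nu>(1) fin] by (auto simp: has_bochner_integral_iff)
    ultimately show ?thesis
      using pairm[OF that] by (simp add: has_bochner_integral_iff integrable_distr_eq integral_distr)
  qed
  have Hint: "has_bochner_integral ?P (H N) c"
  proof -
    have "has_bochner_integral ?P (\<lambda>z. \<Sum>k<N. \<Sum>j<k. 2 * L (z j) (z k)) (\<Sum>k<N. \<Sum>j<k. 2 * energy \<nu>)"
      using Lint by (intro has_bochner_integral_sum has_bochner_integral_mult_right) auto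
    then show ?thesis unfolding sum_triangle_const by (simp add: H_def[abs_def] c_def mult_ac)
  qed
  \<comment> \<open>Particles drawn independently from \<nu> are almost surely distinct, since the
    diagonal is null; only for distinct particles is the weight the exponential of - H.\<close>
  have ne: "AE z in ?P. \<forall>k\<in>{..<N}. \<forall>j\<in>{..<k}. z j \<noteq> z k"
  proof (intro AE_ball_countable[THEN iffD2] ballI countable_finite finite_lessThan)
    fix j k assume jk: "k \<in> {..<N}" "j \<in> {..<k}"
    have "AE p in distr ?P (\<nu> \<Otimes>\<^sub>M \<nu>) (\<lambda>z. (z j, z k)). fst p \<noteq> snd p"
      using fin jk by (subst d) (auto simp: finite_log_energy_def)
    then show "AE z in ?P. z j \<noteq> z k"
    proof -
      note [measurable_cong] = n(2)
      have D: "{p \<in> space (\<nu> \<Otimes>\<^sub>M \<nu>). fst p \<noteq> snd p} \<in> sets (\<nu> \<Otimes>\<^sub>M \<nu>)" by measurable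
      assume "AE p in distr ?P (\<nu> \<Otimes>\<^sub>M \<nu>) (\<lambda>z. (z j, z k)). fst p \<noteq> snd p"
      then show ?thesis using AE_distr_iff[OF pairm[of k j] D] jk by simp
    qed
  qed
  \<comment> \<open>Jensen's inequality in the form of its tangent line: exp (c - H) \<ge> 1 + c -
    H, where c is the mean of H and the line therefore integrates to 1.\<close>
  have ae: "AE z in ?P. ennreal (exp (- c) * (1 + c - H N z)) \<le> ennreal (weight N z)"
    using ne
  proof eventually_elim
    fix z :: "nat \<Rightarrow> complex" assume "\<forall>k\<in>{..<N}. \<forall>j\<in>{..<k}. z j \<noteq> z k"
    then have "inj_on z {..<N}" unfolding inj_on_def by (metis lessThan_iff linorder_neqE_nat)
    then have w: "weight N z = exp (- H N z)" by (rule weight_eq_exp)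
    have "1 + c - H N z \<le> exp (c - H N z)" using exp_ge_add_one_self[of "c - H N z"] by linarith
    then have "exp (- c) * (1 + c - H N z) \<le> exp (- c) * exp (c - H N z)" by (rule mult_left_mono) simp
    then show "ennreal (exp (- c) * (1 + c - H N z)) \<le> ennreal (weight N z)"
      unfolding w by (intro ennreal_leI) (simp flip: exp_add)
  qed
  have Hi: "integrable ?P (H N)" "integral\<^sup>L ?P (H N) = c" using Hint by (auto simp: has_bochner_integral_iff)
  have "ennreal (exp (- c)) = ennreal (\<integral>z. exp (- c) * (1 + c - H N z) \<partial>?P)"
    using Hi by (simp add: P.P.prob_space)
  also have "\<dots> \<le> (\<integral>\<^sup>+z. ennreal (exp (- c) * (1 + c - H N z)) \<partial>?P)"
    by (intro integral_le_nn_integral integrable_mult_right Bochner_Integration.integrable_diff Hi(1)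
        Bochner_Integration.integrable_add P.P.integrable_const)
  also have "\<dots> \<le> (\<integral>\<^sup>+z. ennreal (weight N z) \<partial>?P)" by (rule nn_integral_mono_AE[OF ae])
  also have "\<dots> \<le> ennreal M ^ card {..<N} * (\<integral>\<^sup>+z. ennreal (weight N z) \<partial>lebN N)"
    by (intro nn_integral_PiM_bounded_density[OF \<nu>(2) n(1) finite_lessThan]
        measurable_compose[OF measurable_weight measurable_ennreal])
  finally show ?thesis by (simp add: c_def Z_def)
qed

text \<open>The exponent H is split: the share 1 - 1 / N is replaced by its lower bound \<theta>,
  and the remaining H / N is at least x times the sum of the values of q, which makes the integrand
  a product of integrable functions of single particles. Only exp (O(N)) is lost.\<close>

lemma tail_bound:
  obtains K where "0 < K" "\<And>N \<theta>. 2 \<le> N \<Longrightarrow>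
    (\<integral>\<^sup>+z. ennreal (weight N z) * indicator {z. \<theta> < H N z} z \<partial>lebN N) \<le> ennreal (exp (- (1 - 1 / real N) * \<theta>) * K ^ N)"
proof -
  \<comment> \<open>Of the rate 5, one unit is spent on passing from Q to q; the rate 4 that is left
    gives the integrable decay (1 + |z|)^-4.\<close>
  obtain C where C: "0 \<le> C" "\<And>z. 5 * ln (1 + cmod z) - C \<le> Q z" using growth[of 5] by auto
  have q4: "4 * ln (1 + cmod z) - C \<le> q z" for z using C(2)[of z] by (simp add: q_def)
  let ?g = "\<lambda>z::complex. exp (2 * C) * (1 / (1 + cmod z) ^ 4)"
  define K0 where "K0 = (\<integral>z. ?g z \<partial>lborel)"
  have gi: "integrable lborel ?g" by (rule integrable_mult_right) (rule integrable_inverse_power4)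
  have g0: "0 \<le> ?g z" for z by simp
  have K0: "0 \<le> K0" unfolding K0_def by (rule Bochner_Integration.integral_nonneg) simp
  have Kint: "(\<integral>\<^sup>+z. ennreal (?g z) \<partial>lborel) = ennreal K0"
    unfolding K0_def using gi by (intro nn_integral_eq_integral) auto
  define K where "K = K0 + 1"
  interpret LB: product_sigma_finite "\<lambda>_::nat. lborel :: complex measure" ..
  show ?thesis
  proof (rule that)
    show "0 < K" using K0 by (simp add: K_def)
    fix N :: nat and \<theta> :: real assume N: "2 \<le> N"
    \<comment> \<open>For N \<ge> 2 this lies between 1 and 2: the lower bound preserves the decay,
      the upper one limits the constant to exp (2 C), so K does not depend on N.\<close>
    define x where "x = 2 * (real N - 1) / real N"
    have x: "1 \<le> x" "x \<le> 2" using N by (auto simp: x_def field_simps)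
    have eq: "exp (- x * q z) \<le> ?g z" for z
    proof -
      have "4 * ln (1 + cmod z) * 1 \<le> 4 * ln (1 + cmod z) * x" using x by (intro mult_left_mono) auto
      moreover have "C * x \<le> C * 2" using x C(1) by (intro mult_left_mono) auto
      moreover have "(4 * ln (1 + cmod z) - C) * x \<le> q z * x" using x q4 by (intro mult_right_mono) auto
      ultimately have "- x * q z \<le> 2 * C + - (4 * ln (1 + cmod z))" by (simp add: algebra_simps)
      then have "exp (- x * q z) \<le> exp (2 * C + - (4 * ln (1 + cmod z)))" by simp
      also have "\<dots> = exp (2 * C) * exp (- (4 * ln (1 + cmod z)))" by (rule exp_add)
      also have "exp (4 * ln (1 + cmod z)) = (1 + cmod z) ^ 4"
        using exp_of_nat_mult[of 4 "ln (1 + cmod z)"] by (simp add: add_pos_nonneg)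
      then have "exp (- (4 * ln (1 + cmod z))) = 1 / (1 + cmod z) ^ 4" by (simp add: exp_minus inverse_eq_divide)
      finally show ?thesis .
    qed
    have pw: "ennreal (weight N z) * indicator {z. \<theta> < H N z} z \<le>
      ennreal (exp (- (1 - 1 / real N) * \<theta>)) * (\<Prod>i<N. ennreal (?g (z i)))" for z
    proof (cases "\<theta> < H N z \<and> inj_on z {..<N}")
      case True
      have "1 / real N \<le> 1" using N by simp
      then have "0 \<le> (1 - 1 / real N) * (H N z - \<theta>)" using True by (intro mult_nonneg_nonneg) auto
      moreover have "x * (\<Sum>k<N. q (z k)) \<le> H N z / real N"
        using divide_right_mono[OF H_ge[of N z], of "real N"] by (simp add: x_def field_simps)
      ultimately have "- H N z \<le> - (1 - 1 / real N) * \<theta> + (\<Sum>k<N. - x * q (z k))"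
        by (simp add: algebra_simps sum_negf sum_distrib_left)
      then have "weight N z \<le> exp (- (1 - 1 / real N) * \<theta> + (\<Sum>k<N. - x * q (z k)))"
        using True by (simp add: weight_eq_exp)
      also have "\<dots> = exp (- (1 - 1 / real N) * \<theta>) * (\<Prod>k<N. exp (- x * q (z k)))"
        by (subst exp_add) (simp add: exp_sum)
      also have "\<dots> \<le> exp (- (1 - 1 / real N) * \<theta>) * (\<Prod>k<N. ?g (z k))"
        using eq by (intro mult_left_mono prod_mono) auto
      finally have "ennreal (weight N z) \<le> ennreal (exp (- (1 - 1 / real N) * \<theta>) * (\<Prod>k<N. ?g (z k)))" by (rule ennreal_leI)
      also have "\<dots> = ennreal (exp (- (1 - 1 / real N) * \<theta>)) * (\<Prod>i<N. ennreal (?g (z i)))"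
        using g0 by (subst ennreal_mult) (auto simp: prod_ennreal prod_nonneg)
      finally show ?thesis using True by simp
    next
      case False
      then show ?thesis using weight_eq_0[of z N] by (auto simp: indicator_def)
    qed
    have gm: "?g \<in> borel_measurable borel" by measurable
    have pm: "(\<lambda>z. \<Prod>i<N. ennreal (?g (z i))) \<in> borel_measurable (lebN N)"
    proof -
      have "(\<lambda>z. \<Prod>i<N. ennreal (?g (z i))) \<in> borel_measurable (PiM {..<N} (\<lambda>_. borel))"
        using gm by (intro borel_measurable_prod_ennreal measurable_of_component[of "\<lambda>x. ennreal (?g x)"]) auto
      then show ?thesis by (simp only: measurable_cong_sets[OF sets_lebN refl])
    qed
    have "(\<integral>\<^sup>+z. ennreal (weight N z) * indicator {z. \<theta> < H N z} z \<partial>lebN N) \<le>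
      (\<integral>\<^sup>+z. ennreal (exp (- (1 - 1 / real N) * \<theta>)) * (\<Prod>i<N. ennreal (?g (z i))) \<partial>lebN N)"
      by (intro nn_integral_mono pw)
    also have "\<dots> = ennreal (exp (- (1 - 1 / real N) * \<theta>)) * (\<integral>\<^sup>+z. (\<Prod>i<N. ennreal (?g (z i))) \<partial>lebN N)"
      by (rule nn_integral_cmult[OF pm])
    also have "(\<integral>\<^sup>+z. (\<Prod>i<N. ennreal (?g (z i))) \<partial>lebN N) = (\<Prod>i<N. (\<integral>\<^sup>+z. ennreal (?g z) \<partial>lborel))"
      using gm by (intro LB.product_nn_integral_prod) auto
    also have "\<dots> = ennreal (K0 ^ N)" using K0 by (simp only: Kint prod_constant card_lessThan ennreal_power)
    also have "ennreal (exp (- (1 - 1 / real N) * \<theta>)) * ennreal (K0 ^ N) \<le> ennreal (exp (- (1 - 1 / real N) * \<theta>)) * ennreal (K ^ N)"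
      using K0 by (intro mult_left_mono ennreal_leI power_mono) (auto simp: K_def)
    also have "\<dots> = ennreal (exp (- (1 - 1 / real N) * \<theta>) * K ^ N)"
      using K0 by (subst ennreal_mult) (auto simp: K_def)
    finally show "(\<integral>\<^sup>+z. ennreal (weight N z) * indicator {z. \<theta> < H N z} z \<partial>lebN N) \<le> ennreal (exp (- (1 - 1 / real N) * \<theta>) * K ^ N)" .
  qed
qed

lemma Z_pos: "0 < Z N"
proof -
  have "compactly_supported_prob (disc 1)" "bounded_density (1 / (unit_ball_vol 2 * 1\<^sup>2)) (disc 1)"
    by (rule compactly_supported_disc bounded_density_disc, simp)+
  from Z_lower[OF this, of N] have "0 < ennreal (1 / (unit_ball_vol 2 * 1\<^sup>2)) ^ N * Z N"
    by (rule less_le_trans[rotated]) simp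
  then have "Z N \<noteq> 0" by (metis mult_zero_right less_irrefl)
  then show ?thesis by (simp only: zero_less_iff_neq_zero not_False_eq_True)
qed

lemma H_bounded_below: obtains c where "\<And>z. c < H N z"
proof (cases "N = 0")
  case True
  then show ?thesis using that[of "-1"] by (simp add: H_def)
next
  case False
  obtain C where C: "0 \<le> C" "\<And>z. 1 * ln (1 + cmod z) - C \<le> Q z" using growth[of 1] by auto
  have "2 * (real N - 1) * (\<Sum>k<N. - C) \<le> H N z" for z
  proof (rule order_trans[OF _ H_ge])
    show "2 * (real N - 1) * (\<Sum>k<N. - C) \<le> 2 * (real N - 1) * (\<Sum>k<N. q (z k))"
      using False C(2) by (intro mult_left_mono sum_mono) (auto simp: q_def algebra_simps)
  qed
  then show ?thesis using that[of "2 * (real N - 1) * (\<Sum>k<N. - C) - 1"] by (metis diff_add_cancel less_add_one less_le_trans)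
qed

text \<open>With a threshold below all values of H the tail is the whole integral.\<close>

lemma Z_finite: "2 \<le> N \<Longrightarrow> Z N < \<infinity>"
proof -
  assume N: "2 \<le> N"
  obtain c where c: "\<And>z. c < H N z" using H_bounded_below by blast
  obtain K where K0: "0 < K" and K: "\<And>N \<theta>. 2 \<le> N \<Longrightarrow>
    (\<integral>\<^sup>+z. ennreal (weight N z) * indicator {z. \<theta> < H N z} z \<partial>lebN N) \<le> ennreal (exp (- (1 - 1 / real N) * \<theta>) * K ^ N)"
    using tail_bound by blast
  have "Z N \<le> ennreal (exp (- (1 - 1 / real N) * c) * K ^ N)" using K[OF N, of c] c by (simp add: Z_def)
  then show ?thesis unfolding infinity_ennreal_def by (rule le_less_trans) (rule ennreal_less_top)
qed

abbreviation ens :: "nat \<Rightarrow> (nat \<Rightarrow> complex) measure" where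
  "ens N \<equiv> ensemble N ((real N - 1) / \<tau>) \<Phi>"

lemma measurable_weight_lebN: "weight N \<in> borel_measurable (lebN N)"
  using measurable_weight by (simp only: measurable_cong_sets[OF sets_lebN refl])

lemma sets_ens [measurable_cong]: "sets (ens N) = sets (PiM {..<N} (\<lambda>_. borel))"
  unfolding ensemble_eq sets_density by (rule sets_lebN)

lemma space_ens: "space (ens N) = PiE {..<N} (\<lambda>_. UNIV)"
  using sets_eq_imp_space_eq[OF sets_ens] by (simp add: space_PiM)

lemma emeasure_ens:
  assumes "A \<in> sets (PiM {..<N} (\<lambda>_. borel))"
  shows "emeasure (ens N) A = (\<integral>\<^sup>+z. ennreal (weight N z) * indicator A z \<partial>lebN N) / Z N"
proof -
  have A: "A \<in> sets (lebN N)" using assms sets_lebN by blast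
  have "emeasure (ens N) A = (\<integral>\<^sup>+z. ennreal (weight N z) / Z N * indicator A z \<partial>lebN N)"
    unfolding ensemble_eq using A measurable_weight_lebN by (intro emeasure_density) auto
  also have "\<dots> = (\<integral>\<^sup>+z. (ennreal (weight N z) * indicator A z) / Z N \<partial>lebN N)"
    by (intro nn_integral_cong) (simp add: divide_ennreal_def mult_ac)
  also have "\<dots> = (\<integral>\<^sup>+z. ennreal (weight N z) * indicator A z \<partial>lebN N) / Z N"
    using A measurable_weight_lebN by (intro nn_integral_divide) auto
  finally show ?thesis .
qed

lemma prob_space_ens: assumes "2 \<le> N" shows "prob_space (ens N)"
proof
  have "emeasure (ens N) (space (ens N)) = (\<integral>\<^sup>+z. ennreal (weight N z) * indicator (space (ens N)) z \<partial>lebN N) / Z N"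
    using sets.top[of "ens N"] sets_ens by (intro emeasure_ens) auto
  also have "(\<integral>\<^sup>+z. ennreal (weight N z) * indicator (space (ens N)) z \<partial>lebN N) = Z N"
    unfolding Z_def by (intro nn_integral_cong) (simp add: space_ens space_PiM)
  also have "Z N / Z N = 1" using Z_pos[of N] Z_finite[OF assms] by (simp add: ennreal_divide_self)
  finally show "emeasure (ens N) (space (ens N)) = 1" .
qed

text \<open>Positive weight expresses that the particles are distinct; without it a small H would
  carry no information, as coincidences contribute \<open>ln 0 = 0\<close>.\<close>

definition good :: "nat \<Rightarrow> real \<Rightarrow> (nat \<Rightarrow> complex) set" where
  "good N \<eta> = {z \<in> PiE {..<N} (\<lambda>_. UNIV). weight N z \<noteq> 0 \<and> H N z \<le> real N * (real N - 1) * (I + \<eta>)}"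

lemma goodD:
  assumes "z \<in> good N \<eta>"
  shows "inj_on z {..<N}" "H N z \<le> real N * (real N - 1) * (I + \<eta>)"
proof -
  have "weight N z \<noteq> 0" "H N z \<le> real N * (real N - 1) * (I + \<eta>)" using assms unfolding good_def by blast+
  then show "inj_on z {..<N}" "H N z \<le> real N * (real N - 1) * (I + \<eta>)" using weight_eq_0 by blast+
qed

lemma sets_good: "good N \<eta> \<in> sets (PiM {..<N} (\<lambda>_. borel))"
proof -
  let ?P = "PiM {..<N} (\<lambda>_. borel :: complex measure)"
  have "good N \<eta> = (weight N -` (- {0}) \<inter> space ?P) \<inter> (H N -` {..real N * (real N - 1) * (I + \<eta>)} \<inter> space ?P)"
    unfolding good_def space_PiM by auto
  also have "\<dots> \<in> sets ?P"
    by (intro sets.Int measurable_sets[OF measurable_weight] measurable_sets[OF measurable_H]) auto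
  finally show ?thesis .
qed

text \<open>The tail bound is divided by the lower bound on Z. The exponents of order N^2 combine to
  - (N - 1)^2 (I + \<eta>) + N (N - 1) (I + \<eta> / 2), of leading term - N^2 \<eta> / 2, which
  beats all factors exponential in N.\<close>

lemma bad_tendsto_0:
  assumes \<eta>: "0 < \<eta>" and \<nu>: "compactly_supported_prob \<nu>" "bounded_density M \<nu>" and E: "energy \<nu> \<le> I + \<eta> / 2"
  shows "(\<lambda>N. measure (ens N) (space (ens N) - good N \<eta>)) \<longlonglongrightarrow> 0"
proof -
  obtain K where K: "0 < K" "\<And>N \<theta>. 2 \<le> N \<Longrightarrow>
    (\<integral>\<^sup>+z. ennreal (weight N z) * indicator {z. \<theta> < H N z} z \<partial>lebN N) \<le> ennreal (exp (- (1 - 1 / real N) * \<theta>) * K ^ N)"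
    using tail_bound by blast
  \<comment> \<open>Strictly positive, so that the factor (K M')^N is an exponential with rate c =
    ln (K M').\<close>
  define M' where "M' = M + 1"
  have M: "0 \<le> M" using \<nu>(2) by (simp add: bounded_density_def)
  then have M': "0 < M'" by (simp add: M'_def)
  define c where "c = ln (K * M')"
  define b where "b N = exp (real N * c + (real N - 1) * ((I + \<eta>) - real N * (\<eta> / 2)))" for N :: nat
  have "measure (ens N) (space (ens N) - good N \<eta>) \<le> b N" if N: "2 \<le> N" for N
  proof -
    interpret prob_space "ens N" by (rule prob_space_ens[OF N])
    define \<theta> where "\<theta> = real N * (real N - 1) * (I + \<eta>)"
    have bm: "space (ens N) - good N \<eta> \<in> sets (PiM {..<N} (\<lambda>_. borel))"
    proof -
      have "space (ens N) \<in> sets (PiM {..<N} (\<lambda>_. borel))"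
        unfolding sets_ens[symmetric] by (rule sets.top)
      then show ?thesis using sets_good by (rule sets.Diff)
    qed
    obtain Zr where Zr: "Z N = ennreal Zr" "0 < Zr"
      using Z_pos[of N] Z_finite[OF N] by (cases "Z N" rule: ennreal_cases) auto
    have "(\<integral>\<^sup>+z. ennreal (weight N z) * indicator (space (ens N) - good N \<eta>) z \<partial>lebN N) \<le>
      (\<integral>\<^sup>+z. ennreal (weight N z) * indicator {z. \<theta> < H N z} z \<partial>lebN N)"
    proof (rule nn_integral_mono)
      fix z
      have "z \<in> good N \<eta>" if "z \<in> space (ens N)" "weight N z \<noteq> 0" "\<not> \<theta> < H N z"
        using that unfolding good_def \<theta>_def space_ens by simp
      then show "ennreal (weight N z) * indicator (space (ens N) - good N \<eta>) z \<le> ennreal (weight N z) * indicator {z. \<theta> < H N z} z"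
        by (cases "weight N z = 0"; cases "\<theta> < H N z"; cases "z \<in> space (ens N)") (simp_all add: indicator_def)
    qed
    also have "\<dots> \<le> ennreal (exp (- (1 - 1 / real N) * \<theta>) * K ^ N)" by (rule K(2)[OF N])
    finally have 1: "emeasure (ens N) (space (ens N) - good N \<eta>) \<le> ennreal (exp (- (1 - 1 / real N) * \<theta>) * K ^ N) / Z N"
      unfolding emeasure_ens[OF bm] by (intro divide_right_mono_ennreal)
    have "ennreal (exp (- (real N * (real N - 1) * energy \<nu>))) \<le> ennreal (M ^ N * Zr)"
      using Z_lower[OF \<nu>, of N] M Zr by (simp add: ennreal_power ennreal_mult)
    then have "exp (- (real N * (real N - 1) * energy \<nu>)) \<le> M ^ N * Zr"
      using M Zr by (subst (asm) ennreal_le_iff) auto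
    also have "\<dots> \<le> M' ^ N * Zr" using M Zr by (intro mult_right_mono power_mono) (auto simp: M'_def)
    finally have Zl: "exp (- (real N * (real N - 1) * energy \<nu>)) \<le> M' ^ N * Zr" .
    have 2: "1 / Zr \<le> M' ^ N * exp (real N * (real N - 1) * energy \<nu>)"
    proof -
      define x where "x = real N * (real N - 1) * energy \<nu>"
      have "exp (- x) * exp x \<le> M' ^ N * Zr * exp x" using Zl unfolding x_def by (rule mult_right_mono) simp
      then have "1 \<le> M' ^ N * exp x * Zr" by (simp add: exp_minus mult_ac)
      then show ?thesis unfolding x_def[symmetric] pos_divide_le_eq[OF Zr(2)] .
    qed
    have "emeasure (ens N) (space (ens N) - good N \<eta>) \<le> ennreal (exp (- (1 - 1 / real N) * \<theta>) * K ^ N / Zr)"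
    proof -
      have "ennreal (exp (- (1 - 1 / real N) * \<theta>) * K ^ N) / Z N = ennreal (exp (- (1 - 1 / real N) * \<theta>) * K ^ N / Zr)"
        unfolding Zr(1) using K(1) Zr(2) by (intro divide_ennreal mult_nonneg_nonneg) auto
      with 1 show ?thesis by (simp only:)
    qed
    then have "measure (ens N) (space (ens N) - good N \<eta>) \<le> exp (- (1 - 1 / real N) * \<theta>) * K ^ N / Zr"
    proof -
      have "0 \<le> exp (- (1 - 1 / real N) * \<theta>) * K ^ N / Zr"
        using K(1) Zr(2) by (intro divide_nonneg_pos mult_nonneg_nonneg) auto
      then show "emeasure (ens N) (space (ens N) - good N \<eta>) \<le> ennreal (exp (- (1 - 1 / real N) * \<theta>) * K ^ N / Zr) \<Longrightarrow> ?thesis"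
        unfolding emeasure_eq_measure by (simp only: ennreal_le_iff)
    qed
    also have "\<dots> = (exp (- (1 - 1 / real N) * \<theta>) * K ^ N) * (1 / Zr)" by simp
    also have "\<dots> \<le> (exp (- (1 - 1 / real N) * \<theta>) * K ^ N) * (M' ^ N * exp (real N * (real N - 1) * energy \<nu>))"
      using 2 K(1) by (intro mult_left_mono) auto
    also have "\<dots> = (K * M') ^ N * exp (- (1 - 1 / real N) * \<theta> + real N * (real N - 1) * energy \<nu>)"
      by (simp only: exp_add power_mult_distrib mult_ac)
    also have "(K * M') ^ N = exp (real N * c)" using K(1) M' by (simp add: c_def exp_of_nat_mult)
    also have "exp (real N * c) * exp (- (1 - 1 / real N) * \<theta> + real N * (real N - 1) * energy \<nu>) =
      exp (real N * c + (- (1 - 1 / real N) * \<theta> + real N * (real N - 1) * energy \<nu>))" by (rule exp_add[symmetric])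
    also have "\<dots> \<le> b N"
    proof -
      have e1: "- (1 - 1 / real N) * \<theta> = - ((real N - 1) * (real N - 1) * (I + \<eta>))"
        using N by (simp add: \<theta>_def field_simps)
      have "- ((real N - 1) * (real N - 1) * (I + \<eta>)) + real N * (real N - 1) * energy \<nu> \<le>
          - ((real N - 1) * (real N - 1) * (I + \<eta>)) + real N * (real N - 1) * (I + \<eta> / 2)"
        using N E by (intro add_left_mono mult_left_mono) auto
      also have "- ((real N - 1) * (real N - 1) * (I + \<eta>)) + real N * (real N - 1) * (I + \<eta> / 2) = (real N - 1) * ((I + \<eta>) - real N * (\<eta> / 2))"
      proof -
        have alg: "- ((m - 1) * (m - 1) * x) + m * (m - 1) * (x - h) = (m - 1) * (x - m * h)" for m x h :: real
          by (simp add: algebra_simps)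
        have half: "I + \<eta> / 2 = (I + \<eta>) - \<eta> / 2" by simp
        show ?thesis unfolding half by (rule alg)
      qed
      finally show ?thesis unfolding b_def exp_le_cancel_iff e1 by (intro add_left_mono)
    qed
    finally show ?thesis .
  qed
  then have ev: "eventually (\<lambda>N. measure (ens N) (space (ens N) - good N \<eta>) \<le> b N) sequentially"
    unfolding eventually_sequentially by blast
  have b0: "b \<longlonglongrightarrow> 0"
    unfolding b_def[abs_def] by (rule gaussian_rate_tendsto_0) (use \<eta> in simp)
  show ?thesis
    by (rule tendsto_sandwich[OF _ ev tendsto_const b0]) (intro always_eventually allI measure_nonneg)
qed

end

section \<open>Empirical measures of low-energy configurations\<close>

lemma mult_fraction_le:
  fixes C e k :: real
  assumes "0 \<le> C" "0 \<le> e" "0 < k"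
  shows "C * (e / (k * (C + 1))) \<le> e / k"
proof -
  have "C * (e / (k * (C + 1))) = (e / k) * (C / (C + 1))" by simp
  also have "\<dots> \<le> (e / k) * 1" using assms by (intro mult_left_mono) auto
  finally show ?thesis by simp
qed

lemma disc_average:
  fixes h :: "complex \<Rightarrow> real"
  assumes h: "continuous_on UNIV h" and e: "0 < e"
  obtains r0 where "0 < r0" "\<And>r x. 0 < r \<Longrightarrow> r \<le> r0 \<Longrightarrow> cmod x \<le> R \<Longrightarrow> \<bar>(\<integral>s. h (x + s) \<partial>disc r) - h x\<bar> \<le> e"
proof -
  have "uniformly_continuous_on (cball 0 (R + 1)) h"
    by (intro compact_uniformly_continuous continuous_on_subset[OF h]) auto
  then obtain d where d: "0 < d" "\<And>x y. x \<in> cball 0 (R + 1) \<Longrightarrow> y \<in> cball 0 (R + 1) \<Longrightarrow> dist y x < d \<Longrightarrow> dist (h y) (h x) < e"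
    using e unfolding uniformly_continuous_on_def by metis
  show ?thesis
  \<comment> \<open>Radius at most 1 keeps x + s in the disc of radius R + 1; half of d gives the
    strict inequality demanded by uniform continuity.\<close>
  proof (rule that[of "min 1 (d / 2)"])
    show "0 < min 1 (d / 2)" using d by simp
    fix r x assume r: "0 < r" "r \<le> min 1 (d / 2)" and x: "cmod (x::complex) \<le> R"
    interpret D: prob_space "disc r" using compactly_supported_probD[OF compactly_supported_disc[OF r(1)]] by simp
    have hi: "integrable (disc r) (\<lambda>s. h (x + s))"
      by (intro integrable_compactly_supported compactly_supported_disc r continuous_on_compose2[OF h] continuous_intros) auto
    have "\<bar>(\<integral>s. h (x + s) \<partial>disc r) - h x\<bar> = \<bar>\<integral>s. h (x + s) - h x \<partial>disc r\<bar>"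
      using hi by (simp add: D.prob_space)
    also have "\<dots> \<le> (\<integral>s. \<bar>h (x + s) - h x\<bar> \<partial>disc r)" by (rule integral_abs_bound)
    also have "\<dots> \<le> (\<integral>s. e \<partial>disc r)"
    proof (rule integral_mono_AE)
      show "AE s in disc r. \<bar>h (x + s) - h x\<bar> \<le> e"
        using AE_disc[OF r(1)]
      proof eventually_elim
        fix s assume s: "cmod s \<le> r"
        have "cmod (x + s) \<le> R + 1" using x s r norm_triangle_ineq[of x s] by (simp add: min_def split: if_splits)
        moreover have "dist (x + s) x < d" using s r d by (simp add: dist_norm min_def split: if_splits)
        ultimately show "\<bar>h (x + s) - h x\<bar> \<le> e" using d(2)[of x "x + s"] x by (simp add: dist_real_def)
      qed
    qed (use hi in auto)
    also have "\<dots> = e" by (simp add: D.prob_space)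
    finally show "\<bar>(\<integral>s. h (x + s) \<partial>disc r) - h x\<bar> \<le> e" .
  qed
qed

context extremal
begin

lemma integral_smoothed_approx:
  fixes h :: "complex \<Rightarrow> real"
  assumes h: "continuous_on UNIV h" and e: "0 < e"
  obtains r0 where "0 < r0" "\<And>r. 0 < r \<Longrightarrow> r \<le> r0 \<Longrightarrow> \<bar>(\<integral>x. h x \<partial>smoothed r) - (\<integral>x. h x \<partial>\<sigma>)\<bar> \<le> e"
proof -
  interpret s: prob_space \<sigma> by (rule prob_\<sigma>)
  obtain R where R: "R > 0" "AE x in \<sigma>. cmod x \<le> R" using compactly_supported_probD[OF \<sigma>] by auto
  obtain r0 where r0: "0 < r0" "\<And>r x. 0 < r \<Longrightarrow> r \<le> r0 \<Longrightarrow> cmod x \<le> R \<Longrightarrow> \<bar>(\<integral>s. h (x + s) \<partial>disc r) - h x\<bar> \<le> e"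
    using disc_average[OF h e, of R] by blast
  show ?thesis
  proof (rule that[OF r0(1)])
    fix r assume r: "0 < r" "r \<le> r0"
    interpret D: prob_space "disc r" using compactly_supported_probD[OF compactly_supported_disc[OF r(1)]] by simp
    interpret sd: pair_prob_space \<sigma> "disc r" ..
    have hi: "integrable (smoothed r) h" by (intro integrable_compactly_supported compactly_supported_smoothed r h)
    have hs: "integrable \<sigma> h" by (intro integrable_compactly_supported \<sigma> h)
    have "integrable (\<sigma> \<Otimes>\<^sub>M disc r) (case_prod (\<lambda>x s. h (x + s)))"
      using integral_smoothed(1)[OF r(1) hi] by (simp add: case_prod_beta')
    then have i: "integrable \<sigma> (\<lambda>x. \<integral>s. h (x + s) \<partial>disc r)" by (rule sd.integrable_fst)
    have "\<bar>(\<integral>x. h x \<partial>smoothed r) - (\<integral>x. h x \<partial>\<sigma>)\<bar> = \<bar>\<integral>x. (\<integral>s. h (x + s) \<partial>disc r) - h x \<partial>\<sigma>\<bar>"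
      using integral_smoothed(2)[OF r(1) hi] i hs by (simp add: Bochner_Integration.integral_diff)
    also have "\<dots> \<le> (\<integral>x. \<bar>(\<integral>s. h (x + s) \<partial>disc r) - h x\<bar> \<partial>\<sigma>)" by (rule integral_abs_bound)
    also have "\<dots> \<le> (\<integral>x. e \<partial>\<sigma>)"
    proof (rule integral_mono_AE)
      show "AE x in \<sigma>. \<bar>(\<integral>s. h (x + s) \<partial>disc r) - h x\<bar> \<le> e"
        using R(2) by eventually_elim (rule r0(2)[OF r])
    qed (use i hs in auto)
    also have "\<dots> = e" by (simp add: s.prob_space)
    finally show "\<bar>(\<integral>x. h x \<partial>smoothed r) - (\<integral>x. h x \<partial>\<sigma>)\<bar> \<le> e" .
  qed
qed

text \<open>Smoothing does not increase the logarithmic part, so only the integral of the continuous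
  Q has to be controlled.\<close>

lemma energy_smoothed_approx:
  assumes e: "0 < e"
  obtains r0 where "0 < r0" "\<And>r. 0 < r \<Longrightarrow> r \<le> r0 \<Longrightarrow> energy (smoothed r) \<le> I + e"
proof -
  obtain r0 where r0: "0 < r0" "\<And>r. 0 < r \<Longrightarrow> r \<le> r0 \<Longrightarrow> \<bar>(\<integral>x. Q x \<partial>smoothed r) - (\<integral>x. Q x \<partial>\<sigma>)\<bar> \<le> e / 2"
    using integral_smoothed_approx[OF cont_Q, of "e / 2"] e by auto
  show ?thesis
  proof (rule that[OF r0(1)])
    fix r assume r: "0 < r" "r \<le> r0"
    show "energy (smoothed r) \<le> I + e"
      using r0(2)[OF r] log_energy_smoothed_le[OF r(1)] unfolding I_def energy_def by argo
  qed
qed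

text \<open>On a large disc the average of Q around z is replaced by Q z through uniform continuity.
  Far out no such modulus is available, but there Q grows at least like 2 ln (1 + |z|) while the
  potential falls no faster than - ln (1 + |z|), so the inequality is trivial.\<close>

lemma smoothed_potential_approx:
  assumes e: "0 < e"
  obtains r0 where "0 < r0" "\<And>r z. 0 < r \<Longrightarrow> r \<le> r0 \<Longrightarrow>
    I - e \<le> (\<integral>y. - ln (cmod (z - y)) \<partial>smoothed r) + Q z + (\<integral>x. Q x \<partial>smoothed r)"
proof -
  obtain R where R: "R > 0" "AE x in \<sigma>. cmod x \<le> R" using compactly_supported_probD[OF \<sigma>] by auto
  obtain C where C: "0 \<le> C" "\<And>z. 2 * ln (1 + cmod z) - C \<le> Q z" using growth[of 2] by auto
  \<comment> \<open>All constants of the far region together: once ln (1 + |z|) exceeds B, the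
    growth of Q outweighs them.\<close>
  define B where "B = \<bar>I\<bar> + C + ln (2 + R) + e + \<bar>\<integral>x. Q x \<partial>\<sigma>\<bar>"
  obtain r1 where r1: "0 < r1" "\<And>r. 0 < r \<Longrightarrow> r \<le> r1 \<Longrightarrow> \<bar>(\<integral>x. Q x \<partial>smoothed r) - (\<integral>x. Q x \<partial>\<sigma>)\<bar> \<le> e / 2"
    using integral_smoothed_approx[OF cont_Q, of "e / 2"] e by auto
  \<comment> \<open>\<open>disc_average\<close> averages x + s, whereas Q is needed at z - s; this
    is Q (- (x + s)) at x = - z.\<close>
  have cQ': "continuous_on UNIV (\<lambda>x. Q (- x))" by (intro continuous_on_compose2[OF cont_Q] continuous_intros) auto
  obtain r2 where r2: "0 < r2" "\<And>r x. 0 < r \<Longrightarrow> r \<le> r2 \<Longrightarrow> cmod x \<le> exp B \<Longrightarrow> \<bar>(\<integral>s. Q (- (x + s)) \<partial>disc r) - Q (- x)\<bar> \<le> e / 2"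
    using disc_average[OF cQ', of "e / 2" "exp B"] e by auto
  show ?thesis
  proof (rule that[of "min 1 (min r1 r2)"])
    show "0 < min 1 (min r1 r2)" using r1 r2 by simp
    fix r z assume "0 < r" "r \<le> min 1 (min r1 r2)"
    then have r: "0 < r" "r \<le> 1" "r \<le> r1" "r \<le> r2" by auto
    let ?P = "\<integral>y. - ln (cmod (z - y)) \<partial>smoothed r"
    note \<nu> = compactly_supported_smoothed[OF r(1)] bounded_density_smoothed[OF r(1)]
    interpret n: prob_space "smoothed r" using compactly_supported_probD[OF \<nu>(1)] by simp
    note q1 = r1(2)[OF r(1,3)]
    show "I - e \<le> ?P + Q z + (\<integral>x. Q x \<partial>smoothed r)"
    proof (cases "cmod z \<le> exp B")
      case True
      have "\<bar>(\<integral>s. Q (z - s) \<partial>disc r) - Q z\<bar> \<le> e / 2"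
        using r2(2)[OF r(1,4), of "- z"] True by simp
      then show ?thesis using smoothed_potential_ge[OF r(1), of z] q1 by argo
    next
      case False
      then have "ln (exp B) \<le> ln (1 + cmod z)" by (subst ln_le_cancel_iff) (auto intro: add_pos_nonneg)
      then have lB: "B \<le> ln (1 + cmod z)" by simp
      have "AE p in \<sigma> \<Otimes>\<^sub>M disc r. cmod (fst p) \<le> R \<and> cmod (snd p) \<le> r"
        using prob_\<sigma> compactly_supported_probD[OF compactly_supported_disc[OF r(1)]]
        by (intro AE_pair_measure_fst_snd R(2) AE_disc[OF r(1)]) auto
      then have "AE p in \<sigma> \<Otimes>\<^sub>M disc r. cmod (fst p + snd p) \<le> R + 1"
      proof eventually_elim
        fix p :: "complex \<times> complex" assume "cmod (fst p) \<le> R \<and> cmod (snd p) \<le> r"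
        then show "cmod (fst p + snd p) \<le> R + 1" using norm_triangle_ineq[of "fst p" "snd p"] r(2) by linarith
      qed
      moreover note sets_disc[OF r(1), measurable_cong]
      ultimately have ae: "AE y in smoothed r. cmod y \<le> R + 1"
        unfolding smoothed_def by (subst AE_distr_iff) auto
      have "- (ln (1 + cmod z) + ln (2 + R)) = (\<integral>y. - (ln (1 + cmod z) + ln (2 + R)) \<partial>smoothed r)"
        by (simp add: n.prob_space)
      also have "\<dots> \<le> ?P"
      proof (rule integral_mono_AE)
        show "integrable (smoothed r) (\<lambda>y. - ln (cmod (z - y)))"
          using integrable_log_bounded_density(1)[OF \<nu>, of z] by simp
        show "AE y in smoothed r. - (ln (1 + cmod z) + ln (2 + R)) \<le> - ln (cmod (z - y))"
          using ae
        proof eventually_elim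
          fix y assume "cmod y \<le> R + 1"
          then have "ln (1 + cmod y) \<le> ln (2 + R)" using R(1) by (subst ln_le_cancel_iff) (auto intro: add_pos_nonneg)
          then show "- (ln (1 + cmod z) + ln (2 + R)) \<le> - ln (cmod (z - y))" using ln_dist_le[of z y] by linarith
        qed
      qed simp
      finally have "- (ln (1 + cmod z) + ln (2 + R)) \<le> ?P" .
      then show ?thesis using C(2)[of z] lB q1 e unfolding B_def by argo
    qed
  qed
qed

text \<open>Quadratic-in-N energy controls the average potential: since Q grows at least like 2 ln
  (1 + |z|), it is bounded by 2 q + C, and the lower bound of H by the values of q turns low energy
  into a bound on their sum.\<close>

lemma sum_Q_le:
  assumes C: "\<And>z. 2 * ln (1 + cmod z) - C \<le> Q z" and z: "z \<in> good N \<eta>" and N: "2 \<le> N"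
  shows "(\<Sum>k<N. Q (z k)) \<le> real N * (I + \<eta> + C)"
proof -
  have "Q x \<le> 2 * q x + C" for x using C[of x] by (simp add: q_def)
  then have "(\<Sum>k<N. Q (z k)) \<le> (\<Sum>k<N. 2 * q (z k) + C)" by (intro sum_mono)
  also have "\<dots> = 2 * (\<Sum>k<N. q (z k)) + real N * C" by (simp add: sum.distrib sum_distrib_left)
  also have "2 * (\<Sum>k<N. q (z k)) \<le> real N * (I + \<eta>)"
  proof -
    have N1: "0 < real N - 1" using N by simp
    have "(real N - 1) * (2 * (\<Sum>k<N. q (z k))) \<le> (real N - 1) * (real N * (I + \<eta>))"
    proof -
      have "(real N - 1) * (2 * (\<Sum>k<N. q (z k))) = 2 * (real N - 1) * (\<Sum>k<N. q (z k))" by (simp only: mult_ac)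
      also have "\<dots> \<le> H N z" by (rule H_ge)
      also have "\<dots> \<le> real N * (real N - 1) * (I + \<eta>)" by (rule goodD(2)[OF z])
      also have "\<dots> = (real N - 1) * (real N * (I + \<eta>))" by (simp only: mult_ac)
      finally show ?thesis .
    qed
    then show ?thesis using N1 by (simp only: mult_le_cancel_left_pos)
  qed
  finally show ?thesis by (simp add: algebra_simps)
qed

section \<open>The empirical measure minus a reference measure as a weighted family\<close>

definition particle_measures :: "complex measure \<Rightarrow> (nat \<Rightarrow> complex) \<Rightarrow> nat option \<Rightarrow> complex measure" where
  "particle_measures \<nu> z = case_option \<nu> (\<lambda>j. return borel (z j))"

text \<open>\<open>None\<close> stands for the reference measure with weight - 1,
  \<open>Some j\<close> for the point mass at the j-th particle. For N > 0 the total weight is 0, as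
  positivity of the regularised logarithm demands.\<close>

definition particle_weights :: "nat \<Rightarrow> nat option \<Rightarrow> real" where
  "particle_weights N = case_option (- 1) (\<lambda>_. 1 / real N)"

definition particles :: "nat \<Rightarrow> nat option set" where
  "particles N = insert None (Some ` {..<N})"

lemma finite_particles: "finite (particles N)"
  by (simp add: particles_def)

lemma sum_particles: "(\<Sum>i\<in>particles N. F i) = F None + (\<Sum>j<N. F (Some j))"
  by (simp add: particles_def sum.reindex)

lemma compactly_supported_particles:
  "compactly_supported_prob \<nu> \<Longrightarrow> compactly_supported_prob (particle_measures \<nu> z i)"
  by (auto simp: particle_measures_def compactly_supported_prob_return split: option.split)

lemma sum_particle_weights:
  assumes "0 < N"
  shows "(\<Sum>i\<in>particles N. particle_weights N i) = 0" "(\<Sum>i\<in>particles N. \<bar>particle_weights N i\<bar>) = 2"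
  using assms by (simp_all add: sum_particles particle_weights_def)

lemma quad_form_particles:
  assumes \<nu>: "compactly_supported_prob \<nu>" and a: "0 < a" and N: "0 < N"
  shows "quad_form (reg_log a) (particles N) (particle_weights N) (particle_measures \<nu> z) =
    ker_int (reg_log a) \<nu> \<nu> - 2 / real N * (\<Sum>j<N. (\<integral>y. reg_log a ((cmod (z j - y))\<^sup>2) \<partial>\<nu>))
      + 1 / (real N)\<^sup>2 * (\<Sum>i<N. \<Sum>j<N. reg_log a ((cmod (z i - z j))\<^sup>2))"
proof -
  let ?K = "reg_log a"
  note cont = continuous_on_reg_log[OF a]
  define p where "p j = (\<integral>y. ?K ((cmod (z j - y))\<^sup>2) \<partial>\<nu>)" for j
  have 1: "ker_int ?K (return borel (z j)) \<nu> = p j" for j unfolding p_def by (rule ker_int_return[OF \<nu> cont])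
  have 2: "ker_int ?K \<nu> (return borel (z j)) = p j" for j
    using ker_int_sym[OF compactly_supported_prob_return \<nu> cont, of "z j"] 1 by simp
  have "quad_form ?K (particles N) (particle_weights N) (particle_measures \<nu> z) =
    ker_int ?K \<nu> \<nu> + (\<Sum>j<N. - (1 / real N) * p j) +
      (\<Sum>i<N. (- (1 / real N) * p i + (\<Sum>j<N. 1 / real N * (1 / real N) * ?K ((cmod (z i - z j))\<^sup>2))))"
    unfolding quad_form_def sum_particles
    by (simp add: particle_weights_def particle_measures_def 1 2 ker_int_return_return[OF cont])
  also have "\<dots> = ker_int ?K \<nu> \<nu> - 2 / real N * (\<Sum>j<N. p j) + 1 / (real N)\<^sup>2 * (\<Sum>i<N. \<Sum>j<N. ?K ((cmod (z i - z j))\<^sup>2))"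
  proof -
    have "(\<Sum>j<N. - (1 / real N) * p j) = - (1 / real N) * (\<Sum>j<N. p j)"
      by (simp only: sum_distrib_left)
    moreover have "(\<Sum>i<N. (- (1 / real N) * p i + (\<Sum>j<N. 1 / real N * (1 / real N) * ?K ((cmod (z i - z j))\<^sup>2)))) =
        - (1 / real N) * (\<Sum>j<N. p j) + 1 / real N * (1 / real N) * (\<Sum>i<N. \<Sum>j<N. ?K ((cmod (z i - z j))\<^sup>2))"
      by (simp only: sum.distrib sum_distrib_left)
    ultimately show ?thesis by (simp add: power2_eq_square)
  qed
  finally show ?thesis unfolding p_def .
qed

text \<open>Three bounds meet: the self-energy of \<nu> by its near-minimality, the mixed term by
  the pointwise Euler--Lagrange inequality, the particle term by H. The leading contributions I, - 2
  I and I cancel, as do the integrals of Q; the sums of Q over the particles cancel up to a term of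
  order 1 / N.\<close>

lemma quad_form_good_le:
  assumes \<nu>: "compactly_supported_prob \<nu>" "finite_log_energy \<nu> \<nu>" and a: "0 < a" and N: "2 \<le> N"
    and C: "\<And>z. 2 * ln (1 + cmod z) - C \<le> Q z" and z: "z \<in> good N \<eta>"
    and e: "energy \<nu> \<le> I + e"
    and p: "\<And>w. I - e \<le> (\<integral>y. - ln (cmod (w - y)) \<partial>\<nu>) + Q w + (\<integral>x. Q x \<partial>\<nu>)"
    and k: "\<And>w. (\<integral>y. - ln (cmod (w - y)) \<partial>\<nu>) \<le> (\<integral>y. reg_log a ((cmod (w - y))\<^sup>2) \<partial>\<nu>) + d"
  shows "quad_form (reg_log a) (particles N) (particle_weights N) (particle_measures \<nu> z) \<le>
    3 * e + 2 * d + \<eta> + (I + \<eta> + 2 * C - ln a / 2) / real N"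
proof -
  let ?K = "reg_log a" and ?S = "\<Sum>k<N. Q (z k)"
  define n where "n = real N"
  have n: "2 \<le> n" "0 < n" using N by (auto simp: n_def)
  define Qn where "Qn = (\<integral>x. Q x \<partial>\<nu>)"
  have 1: "ker_int ?K \<nu> \<nu> \<le> I + e - 2 * Qn"
    using ker_int_reg_log_le_log_energy[OF \<nu>(1) \<nu>(1) \<nu>(2) a] e by (simp add: energy_def Qn_def)
  have "(\<Sum>j<N. I - e - d - Qn - Q (z j)) \<le> (\<Sum>j<N. (\<integral>y. ?K ((cmod (z j - y))\<^sup>2) \<partial>\<nu>))"
  proof (rule sum_mono)
    fix j
    show "I - e - d - Qn - Q (z j) \<le> (\<integral>y. ?K ((cmod (z j - y))\<^sup>2) \<partial>\<nu>)"
      using p[of "z j"] k[of "z j"] unfolding Qn_def by linarith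
  qed
  then have 2: "n * (I - e - d - Qn) - ?S \<le> (\<Sum>j<N. (\<integral>y. ?K ((cmod (z j - y))\<^sup>2) \<partial>\<nu>))"
    by (simp add: sum_subtractf n_def right_diff_distrib)
  have s1: "(\<Sum>i<N. \<Sum>j<N. ?K ((cmod (z i - z j))\<^sup>2)) = n * ?K 0 + 2 * (\<Sum>k<N. \<Sum>j<k. ?K ((cmod (z j - z k))\<^sup>2))"
    by (subst sum_square_triangle) (auto simp: n_def norm_minus_commute)
  have "(\<Sum>k<N. \<Sum>j<k. ?K ((cmod (z j - z k))\<^sup>2)) \<le> (\<Sum>k<N. \<Sum>j<k. - ln (cmod (z j - z k)))"
    using goodD(1)[OF z] by (intro sum_mono reg_log_le_ln[OF a]) (auto simp: inj_on_def)
  also have "\<dots> = - (\<Sum>k<N. \<Sum>j<k. ln (cmod (z j - z k)))" by (simp add: sum_negf)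
  finally have s2: "(\<Sum>k<N. \<Sum>j<k. ?K ((cmod (z j - z k))\<^sup>2)) \<le> - (\<Sum>k<N. \<Sum>j<k. ln (cmod (z j - z k)))" .
  have "(\<Sum>i<N. \<Sum>j<N. ?K ((cmod (z i - z j))\<^sup>2)) \<le> n * ?K 0 + H N z - 2 * (n - 1) * ?S"
    using s1 s2 unfolding H_eq n_def by argo
  also have "\<dots> \<le> n * ?K 0 + n * (n - 1) * (I + \<eta>) - 2 * (n - 1) * ?S"
    using goodD(2)[OF z] by (simp add: n_def)
  \<comment> \<open>The self-interaction of a particle, finite by regularisation; the N diagonal
    terms have total weight 1 / N.\<close>
  also have "?K 0 = - ln a / 2" by (simp add: reg_log_def)
  finally have 3: "(\<Sum>i<N. \<Sum>j<N. ?K ((cmod (z i - z j))\<^sup>2)) \<le> n * (- ln a / 2) + n * (n - 1) * (I + \<eta>) - 2 * (n - 1) * ?S" .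
  have 4: "?S / n \<le> I + \<eta> + C"
    using sum_Q_le[OF C z N] n by (simp add: n_def divide_le_eq mult.commute)
  have "quad_form ?K (particles N) (particle_weights N) (particle_measures \<nu> z) \<le>
    (I + e - 2 * Qn) - 2 / n * (n * (I - e - d - Qn) - ?S) + 1 / n\<^sup>2 * (n * (- ln a / 2) + n * (n - 1) * (I + \<eta>) - 2 * (n - 1) * ?S)"
    unfolding quad_form_particles[OF \<nu>(1) a less_le_trans[OF zero_less_numeral N]] n_def[symmetric]
    using n by (intro add_mono diff_mono mult_left_mono 1 2 3) auto
  \<comment> \<open>Replacing n by n - 1 in the particle term leaves - (I + \<eta>) / n from the
    energy and 2 ?S / n^2 from the potential.\<close>
  also have "\<dots> = 3 * e + 2 * d + \<eta> + (- (I + \<eta>) + 2 * (?S / n) - ln a / 2) / n"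
    using n by (simp add: field_simps power2_eq_square)
  also have "\<dots> \<le> 3 * e + 2 * d + \<eta> + (I + \<eta> + 2 * C - ln a / 2) / n"
    using n 4 by (intro add_left_mono divide_right_mono) argo+
  finally show ?thesis by (simp add: n_def)
qed

text \<open>The joint limit of growing N and vanishing energy excess, uniform over all good
  configurations. As a filter it gives deterministic statements about configurations the usual
  calculus of limits, with no probability involved.\<close>

definition good_filter :: "(nat \<times> (nat \<Rightarrow> complex)) filter" where
  "good_filter = Abs_filter (\<lambda>P. \<exists>\<eta>>0. \<exists>N0. \<forall>N\<ge>N0. \<forall>z\<in>good N \<eta>. P (N, z))"

lemma good_mono: "\<eta> \<le> \<eta>' \<Longrightarrow> good N \<eta> \<subseteq> good N \<eta>'"
proof
  fix z assume le: "\<eta> \<le> \<eta>'" and z: "z \<in> good N \<eta>"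
  have "0 \<le> real N * (real N - 1)" by (cases N) auto
  then have "real N * (real N - 1) * (I + \<eta>) \<le> real N * (real N - 1) * (I + \<eta>')"
    using le by (intro mult_left_mono) auto
  with z show "z \<in> good N \<eta>'" unfolding good_def by auto
qed

lemma eventually_good:
  "eventually P good_filter \<longleftrightarrow> (\<exists>\<eta>>0. \<exists>N0. \<forall>N\<ge>N0. \<forall>z\<in>good N \<eta>. P (N, z))"
  unfolding good_filter_def
proof (rule eventually_Abs_filter, rule is_filter.intro)
  show "\<exists>\<eta>>0. \<exists>N0. \<forall>N\<ge>N0. \<forall>z\<in>good N \<eta>. True" by (intro exI[of _ 1]) auto
next
  fix P P' :: "nat \<times> (nat \<Rightarrow> complex) \<Rightarrow> bool"
  assume "\<exists>\<eta>>0. \<exists>N0. \<forall>N\<ge>N0. \<forall>z\<in>good N \<eta>. P (N, z)" "\<exists>\<eta>>0. \<exists>N0. \<forall>N\<ge>N0. \<forall>z\<in>good N \<eta>. P' (N, z)"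
  then obtain \<eta>1 N1 \<eta>2 N2 where 1: "0 < \<eta>1" "\<And>N z. N1 \<le> N \<Longrightarrow> z \<in> good N \<eta>1 \<Longrightarrow> P (N, z)"
    and 2: "0 < \<eta>2" "\<And>N z. N2 \<le> N \<Longrightarrow> z \<in> good N \<eta>2 \<Longrightarrow> P' (N, z)" by blast
  have "P (N, z) \<and> P' (N, z)" if "max N1 N2 \<le> N" "z \<in> good N (min \<eta>1 \<eta>2)" for N z
    using that 1(2)[of N z] 2(2)[of N z] good_mono[of "min \<eta>1 \<eta>2" \<eta>1 N] good_mono[of "min \<eta>1 \<eta>2" \<eta>2 N] by auto
  then show "\<exists>\<eta>>0. \<exists>N0. \<forall>N\<ge>N0. \<forall>z\<in>good N \<eta>. P (N, z) \<and> P' (N, z)"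
    using 1(1) 2(1) by (intro exI[of _ "min \<eta>1 \<eta>2"] conjI exI[of _ "max N1 N2"]) auto
next
  fix P P' :: "nat \<times> (nat \<Rightarrow> complex) \<Rightarrow> bool"
  assume "\<forall>x. P x \<longrightarrow> P' x" "\<exists>\<eta>>0. \<exists>N0. \<forall>N\<ge>N0. \<forall>z\<in>good N \<eta>. P (N, z)"
  then show "\<exists>\<eta>>0. \<exists>N0. \<forall>N\<ge>N0. \<forall>z\<in>good N \<eta>. P' (N, z)" by blast
qed

definition empirical :: "(complex \<Rightarrow> real) \<Rightarrow> nat \<times> (nat \<Rightarrow> complex) \<Rightarrow> real" where
  "empirical g x = (\<Sum>j<fst x. g (snd x j)) / real (fst x)"

text \<open>The order of choices matters: b and C come from g, the tolerance D from C, the radius r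
  from D, then a from a constant belonging to the measure smoothed at radius r, and N0 last because
  the bound contains - ln a / 2.\<close>

lemma empirical_compact_support:
  assumes g: "continuous_on UNIV g" and supp: "\<And>z. R < cmod z \<Longrightarrow> g z = 0"
  shows "(empirical g \<longlongrightarrow> (\<integral>x. g x \<partial>\<sigma>)) good_filter"
proof (rule tendstoI)
  fix \<epsilon> :: real assume \<epsilon>: "0 < \<epsilon>"
  obtain b C where b: "0 < b" "0 \<le> C"
    "\<And>(J::nat option set) (c::nat option \<Rightarrow> real) (\<alpha>::nat option \<Rightarrow> complex measure). finite J \<Longrightarrow> (\<And>i. i \<in> J \<Longrightarrow> compactly_supported_prob (\<alpha> i)) \<Longrightarrow>
      \<bar>\<Sum>i\<in>J. c i * (\<integral>x. g x \<partial>\<alpha> i)\<bar> \<le> \<epsilon> / 8 * (\<Sum>i\<in>J. \<bar>c i\<bar>) + C * sqrt (quad_form (test_kernel b) J c \<alpha>)"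
  proof -
    have e8: "0 < \<epsilon> / 8" using \<epsilon> by simp
    show ?thesis
    proof (rule test_function_bound[OF g _ e8, where R = R and ?'i = "nat option"])
      fix z assume "R < cmod z" then show "g z = 0" by (rule supp)
    next
      fix b C
      assume "0 < b" "0 \<le> C"
        "\<And>(J::nat option set) c \<alpha>. finite J \<Longrightarrow> (\<And>i. i \<in> J \<Longrightarrow> compactly_supported_prob (\<alpha> i)) \<Longrightarrow>
          \<bar>\<Sum>i\<in>J. c i * (\<integral>x. g x \<partial>\<alpha> i)\<bar> \<le> \<epsilon> / 8 * (\<Sum>i\<in>J. \<bar>c i\<bar>) + C * sqrt (quad_form (test_kernel b) J c \<alpha>)"
      then show ?thesis by (rule that)
    qed
  qed
  \<comment> \<open>The admissible size of the quadratic form: C times its root must stay below a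
    quarter of \<epsilon>.\<close>
  define D where "D = (\<epsilon> / (4 * (C + 1)))\<^sup>2"
  have D: "0 < D" "C * sqrt D \<le> \<epsilon> / 4"
  proof -
    show "0 < D" using \<epsilon> b(2) by (simp add: D_def)
    have "sqrt D = \<epsilon> / (4 * (C + 1))" using \<epsilon> b(2) by (simp add: D_def)
    then show "C * sqrt D \<le> \<epsilon> / 4" using \<epsilon> b(2) mult_fraction_le[of C \<epsilon> 4] by simp
  qed
  obtain r1 where r1: "0 < r1" "\<And>r. 0 < r \<Longrightarrow> r \<le> r1 \<Longrightarrow> energy (smoothed r) \<le> I + D / 12"
    using energy_smoothed_approx[of "D / 12"] D by auto
  obtain r2 where r2: "0 < r2" "\<And>r z. 0 < r \<Longrightarrow> r \<le> r2 \<Longrightarrow>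
    I - D / 12 \<le> (\<integral>y. - ln (cmod (z - y)) \<partial>smoothed r) + Q z + (\<integral>x. Q x \<partial>smoothed r)"
    using smoothed_potential_approx[of "D / 12"] D by auto
  obtain r3 where r3: "0 < r3" "\<And>r. 0 < r \<Longrightarrow> r \<le> r3 \<Longrightarrow> \<bar>(\<integral>x. g x \<partial>smoothed r) - (\<integral>x. g x \<partial>\<sigma>)\<bar> \<le> \<epsilon> / 4"
    using integral_smoothed_approx[OF g, of "\<epsilon> / 4"] \<epsilon> by auto
  define r where "r = min r1 (min r2 r3)"
  have r: "0 < r" "r \<le> r1" "r \<le> r2" "r \<le> r3" using r1 r2 r3 by (auto simp: r_def)
  note \<nu> = compactly_supported_smoothed[OF r(1)] bounded_density_smoothed[OF r(1)]
  have fin: "finite_log_energy (smoothed r) (smoothed r)" by (rule finite_log_energy_bounded_density[OF \<nu>(1) \<nu>])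
  obtain C' where C': "0 \<le> C'" "\<And>a z. 0 < a \<Longrightarrow> (\<integral>y. - ln (cmod (z - y)) \<partial>smoothed r) \<le> (\<integral>y. reg_log a ((cmod (z - y))\<^sup>2) \<partial>smoothed r) + C' * sqrt a"
    using bounded_density_potential[OF \<nu>] by metis
  \<comment> \<open>At most b for the comparison with the test kernel, and small enough for the
    regularisation error 2 C' sqrt a to be at most D / 4.\<close>
  define a where "a = min b ((D / (8 * (C' + 1)))\<^sup>2)"
  have a: "0 < a" "a \<le> b" using b(1) D C'(1) by (auto simp: a_def)
  have sa: "2 * (C' * sqrt a) \<le> D / 4"
  proof -
    have "sqrt a \<le> sqrt ((D / (8 * (C' + 1)))\<^sup>2)" unfolding a_def by (intro real_sqrt_le_mono min.cobounded2)
    also have "\<dots> = D / (8 * (C' + 1))" using D(1) C'(1) by simp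
    finally have "C' * sqrt a \<le> C' * (D / (8 * (C' + 1)))" using C'(1) by (rule mult_left_mono)
    also have "\<dots> \<le> D / 8" using D(1) C'(1) by (intro mult_fraction_le) auto
    finally show ?thesis by simp
  qed
  obtain C2 where C2: "0 \<le> C2" "\<And>z. 2 * ln (1 + cmod z) - C2 \<le> Q z" using growth[of 2] by auto
  define \<eta> where "\<eta> = D / 4"
  have \<eta>: "0 < \<eta>" using D by (simp add: \<eta>_def)
  define T where "T = I + \<eta> + 2 * C2 - ln a / 2"
  \<comment> \<open>Makes T / N at most D / 4 from N0 on; the summand 2 ensures that there are at
    least two particles.\<close>
  define N0 where "N0 = 2 + nat \<lceil>4 * \<bar>T\<bar> / D\<rceil>"
  have "dist (empirical g (N, z)) (\<integral>x. g x \<partial>\<sigma>) < \<epsilon>" if N: "N0 \<le> N" and z: "z \<in> good N \<eta>" for N z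
  proof -
    have N2: "2 \<le> N" using N by (simp add: N0_def)
    have "4 * \<bar>T\<bar> / D \<le> real N" using N unfolding N0_def by linarith
    then have "4 * \<bar>T\<bar> \<le> real N * D" using D by (simp add: pos_divide_le_eq)
    then have "T \<le> real N * D / 4" by argo
    then have "T / real N \<le> (real N * D / 4) / real N" by (rule divide_right_mono) simp
    also have "\<dots> = D / 4" using N2 by simp
    finally have TN: "T / real N \<le> D / 4" .
    let ?c = "particle_weights N" and ?\<alpha> = "particle_measures (smoothed r) z"
    have \<alpha>: "compactly_supported_prob (?\<alpha> i)" for i by (rule compactly_supported_particles[OF \<nu>(1)])
    have c0: "(\<Sum>i\<in>particles N. ?c i) = 0" "(\<Sum>i\<in>particles N. \<bar>?c i\<bar>) = 2"
      using N2 by (auto intro: sum_particle_weights)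
    have "quad_form (test_kernel b) (particles N) ?c ?\<alpha> \<le> quad_form (reg_log a) (particles N) ?c ?\<alpha>"
      by (intro quad_form_test_le finite_particles \<alpha> c0 a)
    also have "\<dots> \<le> 3 * (D / 12) + 2 * (C' * sqrt a) + \<eta> + T / real N"
      unfolding T_def
      by (rule quad_form_good_le[OF \<nu>(1) fin a(1) N2 C2(2) z r1(2)[OF r(1,2)] r2(2)[OF r(1,3)] C'(2)[OF a(1)]])
    \<comment> \<open>Four quarters of D: minimality and Euler--Lagrange errors, regularisation,
      energy excess, and terms of order 1 / N.\<close>
    also have "\<dots> \<le> D" using sa TN unfolding \<eta>_def by argo
    finally have "sqrt (quad_form (test_kernel b) (particles N) ?c ?\<alpha>) \<le> sqrt D" by simp
    then have "C * sqrt (quad_form (test_kernel b) (particles N) ?c ?\<alpha>) \<le> \<epsilon> / 4"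
      using D(2) b(2) by (meson mult_left_mono order_trans)
    moreover have "\<bar>\<Sum>i\<in>particles N. ?c i * (\<integral>x. g x \<partial>?\<alpha> i)\<bar> \<le> \<epsilon> / 8 * 2 + C * sqrt (quad_form (test_kernel b) (particles N) ?c ?\<alpha>)"
    proof -
      have "\<bar>\<Sum>i\<in>particles N. ?c i * (\<integral>x. g x \<partial>?\<alpha> i)\<bar> \<le> \<epsilon> / 8 * (\<Sum>i\<in>particles N. \<bar>?c i\<bar>) + C * sqrt (quad_form (test_kernel b) (particles N) ?c ?\<alpha>)"
        by (rule b(3)[OF finite_particles]) (rule \<alpha>)
      then show ?thesis unfolding c0(2) .
    qed
    moreover have "(\<Sum>i\<in>particles N. ?c i * (\<integral>x. g x \<partial>?\<alpha> i)) = empirical g (N, z) - (\<integral>x. g x \<partial>smoothed r)"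
      using borel_measurable_continuous_onI[OF g]
      by (simp add: sum_particles particle_weights_def particle_measures_def empirical_def integral_return sum_divide_distrib)
    ultimately have "\<bar>empirical g (N, z) - (\<integral>x. g x \<partial>smoothed r)\<bar> \<le> \<epsilon> / 2" by argo
    then show ?thesis using r3(2)[OF r(1,4)] \<epsilon> unfolding dist_real_def by argo
  qed
  then show "eventually (\<lambda>x. dist (empirical g x) (\<integral>x. g x \<partial>\<sigma>) < \<epsilon>) good_filter"
    unfolding eventually_good using \<eta> by blast
qed

lemma eventually_pos_good: "eventually (\<lambda>x. 0 < fst x) good_filter"
  unfolding eventually_good by (intro exI[of _ 1]) (auto intro: exI[of _ 1])

definition cutoff :: "real \<Rightarrow> complex \<Rightarrow> real" where
  "cutoff R x = max 0 (min 1 (R + 1 - cmod x))"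

lemma cutoff: "continuous_on UNIV (cutoff R)" "0 \<le> cutoff R x" "cutoff R x \<le> 1"
  "cmod x \<le> R \<Longrightarrow> cutoff R x = 1" "R + 1 < cmod x \<Longrightarrow> cutoff R x = 0"
  unfolding cutoff_def by (auto intro!: continuous_intros)

text \<open>Tightness comes from the case of compact support: the empirical mean of the cutoff tends
  to its mean under \<sigma>, which is 1, so the share of particles where g and its truncation
  differ vanishes.\<close>

lemma empirical_bounded:
  assumes g: "continuous_on UNIV g" and G: "\<And>x. \<bar>g x\<bar> \<le> G"
  shows "(empirical g \<longlongrightarrow> (\<integral>x. g x \<partial>\<sigma>)) good_filter"
proof -
  interpret s: prob_space \<sigma> by (rule prob_\<sigma>)
  obtain R where R: "R > 0" "AE x in \<sigma>. cmod x \<le> R" using compactly_supported_probD[OF \<sigma>] by auto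
  have [measurable]: "g \<in> borel_measurable borel" "cutoff R \<in> borel_measurable borel"
    using g cutoff(1) by (auto intro: borel_measurable_continuous_onI)
  let ?h = "\<lambda>x. g x * cutoff R x"
  have h: "(empirical ?h \<longlongrightarrow> (\<integral>x. ?h x \<partial>\<sigma>)) good_filter"
    by (rule empirical_compact_support[of _ "R + 1"]) (auto intro!: continuous_intros g cutoff simp: cutoff(5))
  have hs: "(\<integral>x. ?h x \<partial>\<sigma>) = (\<integral>x. g x \<partial>\<sigma>)"
    by (intro integral_cong_AE) (use R(2) in \<open>auto elim!: eventually_mono simp: cutoff(4)\<close>)
  have c: "(empirical (cutoff R) \<longlongrightarrow> (\<integral>x. cutoff R x \<partial>\<sigma>)) good_filter"
    by (rule empirical_compact_support[of _ "R + 1"]) (auto intro!: cutoff)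
  have "(\<integral>x. cutoff R x \<partial>\<sigma>) = (\<integral>x. 1 \<partial>\<sigma>)"
    by (intro integral_cong_AE) (use R(2) in \<open>auto elim!: eventually_mono simp: cutoff(4)\<close>)
  then have c1: "(empirical (cutoff R) \<longlongrightarrow> 1) good_filter" using c by (simp add: s.prob_space)
  have "((\<lambda>x. empirical g x - empirical ?h x) \<longlongrightarrow> 0) good_filter"
  proof (rule Lim_null_comparison)
    show "eventually (\<lambda>x. norm (empirical g x - empirical ?h x) \<le> G * (1 - empirical (cutoff R) x)) good_filter"
      using eventually_pos_good
    proof eventually_elim
      fix x :: "nat \<times> (nat \<Rightarrow> complex)" assume x: "0 < fst x"
      have "empirical g x - empirical ?h x = (\<Sum>j<fst x. g (snd x j) * (1 - cutoff R (snd x j))) / real (fst x)"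
        by (simp add: empirical_def diff_divide_distrib sum_subtractf right_diff_distrib)
      also have "\<bar>\<dots>\<bar> \<le> (\<Sum>j<fst x. G * (1 - cutoff R (snd x j))) / real (fst x)"
        unfolding abs_divide abs_of_nat
      proof (intro divide_right_mono order_trans[OF sum_abs] sum_mono)
        fix j
        show "\<bar>g (snd x j) * (1 - cutoff R (snd x j))\<bar> \<le> G * (1 - cutoff R (snd x j))"
          using cutoff(3)[of R "snd x j"] G[of "snd x j"] by (simp add: abs_mult mult_right_mono)
      qed simp
      also have "\<dots> = G * (1 - empirical (cutoff R) x)"
      proof -
        have "(\<Sum>j<fst x. G * (1 - cutoff R (snd x j))) = G * (real (fst x) - (\<Sum>j<fst x. cutoff R (snd x j)))"
          by (simp add: sum_subtractf flip: sum_distrib_left)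
        then show ?thesis using x by (simp add: empirical_def field_simps)
      qed
      finally show "norm (empirical g x - empirical ?h x) \<le> G * (1 - empirical (cutoff R) x)" by simp
    qed
    have "((\<lambda>x. G * (1 - empirical (cutoff R) x)) \<longlongrightarrow> G * (1 - 1)) good_filter"
      by (intro tendsto_intros c1)
    then show "((\<lambda>x. G * (1 - empirical (cutoff R) x)) \<longlongrightarrow> 0) good_filter" by simp
  qed
  from tendsto_add[OF this h] show ?thesis by (simp add: hs)
qed

end

section \<open>Averages over tuples of particles\<close>

text \<open>Points of the n-fold product are functions equal to \<open>undefined\<close> beyond n.
  Precomposition with \<open>restrict\<close> moves the question to the space of all functions on
  nat, where product and Borel sigma-algebra agree; filling up with \<open>undefined\<close> leads
  back.\<close>

lemma borel_measurable_product_topology: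
  fixes f :: "(nat \<Rightarrow> complex) \<Rightarrow> 'a::topological_space"
  assumes f: "continuous_map (product_topology (\<lambda>_. euclidean) {..<n}) euclidean f"
  shows "continuous_on UNIV (\<lambda>w. f (restrict w {..<n}))"
    and "f \<in> borel_measurable (PiM {..<n} (\<lambda>_. borel))"
proof -
  have "continuous_map (product_topology (\<lambda>_::nat. euclidean :: complex topology) UNIV)
    (product_topology (\<lambda>_. euclidean) {..<n}) (\<lambda>w. restrict w {..<n})"
    unfolding continuous_map_componentwise
    by (auto simp: extensional_def intro!: continuous_map_product_projection)
  from continuous_map_compose[OF this f] show c: "continuous_on UNIV (\<lambda>w. f (restrict w {..<n}))"
    by (simp add: euclidean_product_topology comp_def)
  have s: "sets (PiM UNIV (\<lambda>_::nat. borel :: complex measure)) = sets borel" by (rule sets_PiM_equal_borel)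
  have "(\<lambda>w. f (restrict w {..<n})) \<in> borel_measurable borel" using c by (rule borel_measurable_continuous_onI)
  then have f0: "(\<lambda>w. f (restrict w {..<n})) \<in> borel_measurable (PiM UNIV (\<lambda>_. borel))"
    by (simp only: measurable_cong_sets[OF s refl])
  have id: "(\<lambda>w i. if i < n then w i else undefined) \<in> PiM {..<n} (\<lambda>_. borel :: complex measure) \<rightarrow>\<^sub>M PiM UNIV (\<lambda>_. borel)"
  proof (rule measurable_PiM_single')
    fix i
    show "(\<lambda>w. if i < n then w i else undefined) \<in> PiM {..<n} (\<lambda>_. borel :: complex measure) \<rightarrow>\<^sub>M borel"
      by (cases "i < n") (auto intro!: measurable_component_singleton)
  qed auto
  have "(\<lambda>w. f (restrict (\<lambda>i. if i < n then w i else undefined) {..<n})) \<in> borel_measurable (PiM {..<n} (\<lambda>_. borel))"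
    by (rule measurable_compose[OF id f0])
  moreover have "f (restrict (\<lambda>i. if i < n then w i else undefined) {..<n}) = f w"
    if "w \<in> space (PiM {..<n} (\<lambda>_. borel :: complex measure))" for w
  proof -
    have "restrict (\<lambda>i. if i < n then w i else undefined) {..<n} = w"
      using that by (auto simp: space_PiM PiE_def extensional_def restrict_def)
    then show ?thesis by simp
  qed
  ultimately show "f \<in> borel_measurable (PiM {..<n} (\<lambda>_. borel))"
    by (subst measurable_cong[where g = "\<lambda>w. f (restrict (\<lambda>i. if i < n then w i else undefined) {..<n})"]) auto
qed

section \<open>The algebra of product functions and averages over tuples\<close>

definition bdd_continuous :: "(complex \<Rightarrow> real) \<Rightarrow> bool" where
  "bdd_continuous h \<longleftrightarrow> continuous_on UNIV h \<and> (\<exists>G. \<forall>x. \<bar>h x\<bar> \<le> G)"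

text \<open>The algebra for Stone--Weierstrass. For n > 0 scalars are absorbed into a factor, and
  closure under multiplication follows by distributing. Its members have the tuple averages that
  factor into empirical means.\<close>

inductive product_sum :: "nat \<Rightarrow> ((nat \<Rightarrow> complex) \<Rightarrow> real) \<Rightarrow> bool" for n where
  prod: "(\<And>i. bdd_continuous (h i)) \<Longrightarrow> product_sum n (\<lambda>w. \<Prod>i<n. h i (w i))"
| add: "product_sum n f \<Longrightarrow> product_sum n g \<Longrightarrow> product_sum n (\<lambda>w. f w + g w)"

lemma bdd_continuous_mult: "bdd_continuous g \<Longrightarrow> bdd_continuous h \<Longrightarrow> bdd_continuous (\<lambda>x. g x * h x)"
  unfolding bdd_continuous_def
proof (elim conjE exE, intro conjI exI allI)
  fix G G' assume "\<forall>x. \<bar>g x\<bar> \<le> G" "\<forall>x. \<bar>h x\<bar> \<le> G'"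
  then show "\<bar>g x * h x\<bar> \<le> G * G'" for x
    unfolding abs_mult by (intro mult_mono) (auto intro: order_trans[OF abs_ge_zero])
qed (intro continuous_intros)

lemma bdd_continuous_const: "bdd_continuous (\<lambda>_. c)"
  unfolding bdd_continuous_def by (auto intro!: exI[of _ "\<bar>c\<bar>"])

lemma product_sum_mult:
  assumes "product_sum n f" "product_sum n g" shows "product_sum n (\<lambda>w. f w * g w)"
  using assms
proof (induction arbitrary: g)
  case (prod h)
  note h = this(1)
  from prod(2) show ?case
  proof induction
    case (prod h')
    have "product_sum n (\<lambda>w. \<Prod>i<n. (\<lambda>x. h i x * h' i x) (w i))"
      by (intro product_sum.prod bdd_continuous_mult h prod)
    then show ?case by (simp add: prod.distrib)
  next
    case (add f g)
    then show ?case using product_sum.add[OF add.IH] by (simp add: distrib_left)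
  qed
next
  case (add f f')
  have "product_sum n (\<lambda>w. f w * g w + f' w * g w)" by (intro product_sum.add add.IH add.prems)
  then show ?case by (simp add: distrib_right)
qed

lemma product_sum_coordinate:
  assumes "bdd_continuous h" "i < n" shows "product_sum n (\<lambda>w. h (w i))"
proof -
  have "product_sum n (\<lambda>w. \<Prod>j<n. (if j = i then h else (\<lambda>_. 1)) (w j))"
    using assms bdd_continuous_const by (intro product_sum.prod) auto
  moreover have "(\<Prod>j<n. (if j = i then h else (\<lambda>_. 1)) (w j)) = h (w i)" for w
  proof -
    have "(\<Prod>j<n. (if j = i then h else (\<lambda>_. 1)) (w j)) = (\<Prod>j<n. if j = i then h (w j) else 1)"
      by (intro prod.cong) auto
    then show ?thesis using assms by simp
  qed
  ultimately show ?thesis by simp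
qed

lemma product_sum_const: "0 < n \<Longrightarrow> product_sum n (\<lambda>_. c)"
  using product_sum_coordinate[OF bdd_continuous_const, of 0 n c] by simp

lemma product_sum_continuous: "product_sum n f \<Longrightarrow> continuous_on UNIV f"
proof (induction rule: product_sum.induct)
  case (prod h)
  have "continuous_on UNIV (\<lambda>w. h i (w i))" for i
  proof (rule continuous_on_compose2[of UNIV "h i" UNIV "\<lambda>w. w i"])
    show "continuous_on UNIV (h i)" using prod by (simp add: bdd_continuous_def)
    show "continuous_on UNIV (\<lambda>w::nat \<Rightarrow> complex. w i)" by (rule continuous_on_product_coordinates)
  qed simp
  then show ?case by (intro continuous_on_prod)
qed (intro continuous_intros)

definition tuple_average :: "nat \<Rightarrow> ((nat \<Rightarrow> complex) \<Rightarrow> real) \<Rightarrow> nat \<times> (nat \<Rightarrow> complex) \<Rightarrow> real" where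
  "tuple_average n f x = (\<Sum>\<phi>\<in>PiE {..<n} (\<lambda>_. {..<fst x}). f (\<lambda>i\<in>{..<n}. snd x (\<phi> i))) / real (fst x) ^ n"

lemma tuple_average_add: "tuple_average n (\<lambda>w. f w + g w) x = tuple_average n f x + tuple_average n g x"
  by (simp add: tuple_average_def sum.distrib add_divide_distrib)

lemma tuple_average_prod:
  "tuple_average n (\<lambda>w. \<Prod>i<n. h i (w i)) x = (\<Prod>i<n. (\<Sum>j<fst x. h i (snd x j)) / real (fst x))"
proof -
  have "(\<Sum>\<phi>\<in>PiE {..<n} (\<lambda>_. {..<fst x}). \<Prod>i<n. h i ((\<lambda>i\<in>{..<n}. snd x (\<phi> i)) i)) =
    (\<Sum>\<phi>\<in>PiE {..<n} (\<lambda>_. {..<fst x}). \<Prod>i<n. h i (snd x (\<phi> i)))"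
    by (intro sum.cong prod.cong) auto
  also have "\<dots> = (\<Prod>i<n. \<Sum>j<fst x. h i (snd x j))"
    by (rule prod_sum_PiE[symmetric]) auto
  finally show ?thesis by (simp add: tuple_average_def prod_dividef)
qed

lemma tuple_average_const: "0 < fst x \<Longrightarrow> tuple_average n (\<lambda>_. c) x = c"
  by (simp add: tuple_average_def card_PiE)

lemma tuple_average_mono:
  assumes "\<And>w. w \<in> PiE {..<n} (\<lambda>_. UNIV) \<Longrightarrow> f w \<le> g w"
  shows "tuple_average n f x \<le> tuple_average n g x"
  unfolding tuple_average_def using assms by (intro divide_right_mono sum_mono) auto

lemma tuple_average_diff: "tuple_average n (\<lambda>w. f w - g w) x = tuple_average n f x - tuple_average n g x"
  by (simp add: tuple_average_def sum_subtractf diff_divide_distrib)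

lemma tuple_average_cmult: "tuple_average n (\<lambda>w. c * f w) x = c * tuple_average n f x"
  by (simp add: tuple_average_def sum_distrib_left)

lemma abs_tuple_average_le: "\<bar>tuple_average n f x\<bar> \<le> tuple_average n (\<lambda>w. \<bar>f w\<bar>) x"
  unfolding tuple_average_def by (simp add: abs_divide divide_right_mono)

context extremal
begin

abbreviation \<sigma>n :: "nat \<Rightarrow> (nat \<Rightarrow> complex) measure" where
  "\<sigma>n n \<equiv> PiM {..<n} (\<lambda>_. \<sigma>)"

lemma sets_\<sigma>n [measurable_cong]: "sets (\<sigma>n n) = sets (PiM {..<n} (\<lambda>_. borel))"
  by (rule sets_PiM_cong) (simp_all add: sets_\<sigma>)

lemma prob_\<sigma>n: "prob_space (\<sigma>n n)"
  by (intro prob_space_PiM prob_\<sigma>)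

lemma bdd_continuous_integrable: "bdd_continuous h \<Longrightarrow> integrable \<sigma> h"
  unfolding bdd_continuous_def by (auto intro: integrable_compactly_supported \<sigma>)

lemma product_sum_tendsto:
  assumes "product_sum n f"
  shows "integrable (\<sigma>n n) f \<and> (tuple_average n f \<longlongrightarrow> (\<integral>w. f w \<partial>\<sigma>n n)) good_filter"
  using assms
proof (induction rule: product_sum.induct)
  case (prod h)
  interpret s: prob_space \<sigma> by (rule prob_\<sigma>)
  interpret P: product_sigma_finite "\<lambda>_::nat. \<sigma>" ..
  have i: "integrable (\<sigma>n n) (\<lambda>w. \<Prod>i<n. h i (w i))"
    by (intro P.product_integrable_prod bdd_continuous_integrable prod) auto
  have e: "(\<integral>w. (\<Prod>i<n. h i (w i)) \<partial>\<sigma>n n) = (\<Prod>i<n. \<integral>x. h i x \<partial>\<sigma>)"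
    by (intro P.product_integral_prod bdd_continuous_integrable prod) auto
  have "(empirical (h i) \<longlongrightarrow> (\<integral>x. h i x \<partial>\<sigma>)) good_filter" for i
  proof -
    obtain G where "continuous_on UNIV (h i)" "\<And>x. \<bar>h i x\<bar> \<le> G" using prod[of i] by (auto simp: bdd_continuous_def)
    then show ?thesis by (rule empirical_bounded)
  qed
  then have "((\<lambda>x. \<Prod>i<n. empirical (h i) x) \<longlongrightarrow> (\<Prod>i<n. \<integral>x. h i x \<partial>\<sigma>)) good_filter"
    by (intro tendsto_prod) auto
  moreover have "tuple_average n (\<lambda>w. \<Prod>i<n. h i (w i)) = (\<lambda>x. \<Prod>i<n. empirical (h i) x)"
    by (rule ext) (simp add: tuple_average_prod empirical_def)
  ultimately show ?case using i e by simp
next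
  case (add f g)
  have e: "(\<lambda>x. tuple_average n f x + tuple_average n g x) = tuple_average n (\<lambda>w. f w + g w)"
    by (rule ext) (simp add: tuple_average_add)
  have i: "integrable (\<sigma>n n) f" "integrable (\<sigma>n n) g"
    and t: "(tuple_average n f \<longlongrightarrow> (\<integral>w. f w \<partial>\<sigma>n n)) good_filter" "(tuple_average n g \<longlongrightarrow> (\<integral>w. g w \<partial>\<sigma>n n)) good_filter"
    using add.IH by blast+
  show ?case
  proof
    show "integrable (\<sigma>n n) (\<lambda>w. f w + g w)" using i by (rule Bochner_Integration.integrable_add)
    show "(tuple_average n (\<lambda>w. f w + g w) \<longlongrightarrow> (\<integral>w. f w + g w \<partial>\<sigma>n n)) good_filter"
      using tendsto_add[OF t] unfolding e Bochner_Integration.integral_add[OF i] .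
  qed
qed

text \<open>Stone--Weierstrass on a polydisc, regarded as a compact set in the space of all
  functions on nat.\<close>

lemma product_sum_approx:
  fixes f :: "(nat \<Rightarrow> complex) \<Rightarrow> real"
  assumes n: "0 < n" and f: "continuous_on UNIV (\<lambda>w. f (restrict w {..<n}))" and e: "0 < e"
  obtains P where "product_sum n P" "\<And>w. w \<in> PiE {..<n} (\<lambda>_. cball 0 R) \<Longrightarrow> \<bar>f w - P w\<bar> < e"
proof -
  \<comment> \<open>Coordinates beyond n range over a one-point set, which keeps the full product
    compact.\<close>
  define S where "S = PiE UNIV (\<lambda>i::nat. if i < n then cball (0::complex) R else {undefined})"
  have S: "S = PiE {..<n} (\<lambda>_. cball 0 R)"
  proof (intro set_eqI iffI)
    fix w assume w: "w \<in> S"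
    have "w i \<in> (if i < n then cball 0 R else {undefined})" for i
      using w unfolding S_def by (rule PiE_mem) simp
    then have "\<And>i. i < n \<Longrightarrow> w i \<in> cball 0 R" "\<And>i. \<not> i < n \<Longrightarrow> w i = undefined"
      by (metis, metis singletonD)
    then show "w \<in> PiE {..<n} (\<lambda>_. cball 0 R)" by (intro PiE_I) (simp_all del: mem_cball)
  next
    fix w assume w: "w \<in> PiE {..<n} (\<lambda>_. cball (0::complex) R)"
    have "\<And>i. i < n \<Longrightarrow> w i \<in> cball 0 R" using PiE_mem[OF w] by blast
    moreover have "\<And>i. \<not> i < n \<Longrightarrow> w i = undefined" using PiE_arb[OF w] by blast
    ultimately
    show "w \<in> S" unfolding S_def by (intro PiE_I) (simp_all del: mem_cball)
  qed
  have "compactin (product_topology (\<lambda>_. euclidean) UNIV) S"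
    unfolding S_def compactin_PiE by auto
  then have cS: "compact S" by (simp add: euclidean_product_topology)
  interpret function_ring_on "Collect (product_sum n)" S
  proof
    show "compact S" by (rule cS)
    show "continuous_on S f" if "f \<in> Collect (product_sum n)" for f
      using product_sum_continuous[of n f] that by (auto intro: continuous_on_subset)
    show "(\<lambda>x. f x + g x) \<in> Collect (product_sum n)" if "f \<in> Collect (product_sum n)" "g \<in> Collect (product_sum n)" for f g
      using that by (auto intro: product_sum.add)
    show "(\<lambda>x. f x * g x) \<in> Collect (product_sum n)" if "f \<in> Collect (product_sum n)" "g \<in> Collect (product_sum n)" for f g
      using that by (auto intro: product_sum_mult)
    show "(\<lambda>_. c) \<in> Collect (product_sum n)" for c using product_sum_const[OF n] by simp
    fix x y :: "nat \<Rightarrow> complex" assume xy: "x \<in> S" "y \<in> S" "x \<noteq> y"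
    then obtain i where i: "i < n" "x i \<noteq> y i" unfolding S by (metis PiE_ext lessThan_iff)
    \<comment> \<open>A bounded function vanishing at x i only, so it separates x from y in the
      coordinate i.\<close>
    let ?h = "\<lambda>u. min 1 (cmod (u - x i))"
    have "bdd_continuous ?h" unfolding bdd_continuous_def by (intro conjI continuous_intros exI[of _ 1]) auto
    then have "product_sum n (\<lambda>w. ?h (w i))" using i(1) by (rule product_sum_coordinate)
    moreover have "?h (x i) \<noteq> ?h (y i)" using i(2) by (auto simp: min_def)
    ultimately show "\<exists>f\<in>Collect (product_sum n). f x \<noteq> f y"
      by (intro bexI[of _ "\<lambda>w. ?h (w i)"] CollectI)
  qed
  from Stone_Weierstrass_basic[OF continuous_on_subset[OF f subset_UNIV] e]
  obtain P where P: "P \<in> Collect (product_sum n)" "\<forall>w\<in>S. \<bar>f (restrict w {..<n}) - P w\<bar> < e" by (rule bexE)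
  show ?thesis
  proof (rule that)
    show "product_sum n P" using P(1) by (rule CollectD)
    fix w assume w: "w \<in> PiE {..<n} (\<lambda>_. cball (0::complex) R)"
    then have "restrict w {..<n} = w" by (rule PiE_restrict)
    then show "\<bar>f w - P w\<bar> < e" using bspec[OF P(2), of w] w unfolding S by (simp only:)
  qed
qed

text \<open>P approximates f on a polydisc only, so it is multiplied by the product X of cutoffs.
  The price is B (1 - X) + e at every point, and the average of 1 - X tends to 0 because \<sigma>
  does not charge the region where X differs from 1.\<close>

lemma tuple_average_tendsto:
  fixes f :: "(nat \<Rightarrow> complex) \<Rightarrow> real"
  assumes n: "0 < n" and f: "continuous_map (product_topology (\<lambda>_. euclidean) {..<n}) euclidean f"
    and B: "\<And>w. w \<in> PiE {..<n} (\<lambda>_. UNIV) \<Longrightarrow> \<bar>f w\<bar> \<le> B"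
  shows "(tuple_average n f \<longlongrightarrow> (\<integral>w. f w \<partial>\<sigma>n n)) good_filter"
proof (rule tendstoI)
  fix \<epsilon> :: real assume "0 < \<epsilon>"
  \<comment> \<open>Four errors: the approximation before and in the limit, the mass cut off, and
    the convergence of the averages of P X.\<close>
  define e where "e = \<epsilon> / 4"
  have e: "0 < e" using \<open>0 < \<epsilon>\<close> by (simp add: e_def)
  interpret s: prob_space \<sigma> by (rule prob_\<sigma>)
  interpret sn: prob_space "\<sigma>n n" by (rule prob_\<sigma>n)
  interpret PS: product_sigma_finite "\<lambda>_::nat. \<sigma>" ..
  have B0: "0 \<le> B" using B[of "\<lambda>i\<in>{..<n}. 0"] by auto
  have sp: "space (\<sigma>n n) = PiE {..<n} (\<lambda>_. UNIV)"
    using sets_eq_imp_space_eq[OF sets_\<sigma>n] by (simp add: space_PiM)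
  have fm: "f \<in> borel_measurable (\<sigma>n n)"
    using borel_measurable_product_topology(2)[OF f] by (simp only: measurable_cong_sets[OF sets_\<sigma>n refl])
  have fi: "integrable (\<sigma>n n) f"
    by (rule sn.integrable_const_bound[OF _ fm, of B]) (use B sp in \<open>auto intro!: AE_I2\<close>)
  obtain R where R: "R > 0" "AE x in \<sigma>. cmod x \<le> R" using compactly_supported_probD[OF \<sigma>] by auto
  obtain P where P: "product_sum n P" "\<And>w. w \<in> PiE {..<n} (\<lambda>_. cball 0 (R + 1)) \<Longrightarrow> \<bar>f w - P w\<bar> < e"
    using product_sum_approx[OF n borel_measurable_product_topology(1)[OF f] e] by blast
  define X where "X w = (\<Prod>i<n. cutoff R (w i))" for w :: "nat \<Rightarrow> complex"
  have nc: "bdd_continuous (cutoff R)"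
    unfolding bdd_continuous_def using cutoff by (intro conjI exI[of _ 1]) auto
  have X: "product_sum n X" unfolding X_def using nc by (rule product_sum.prod)
  have PX: "product_sum n (\<lambda>w. P w * X w)" by (rule product_sum_mult[OF P(1) X])
  have X01: "0 \<le> X w" "X w \<le> 1" for w
    unfolding X_def using cutoff by (auto intro: prod_nonneg prod_le_1)
  have iX: "(\<integral>w. X w \<partial>\<sigma>n n) = 1"
  proof -
    have "(\<integral>x. cutoff R x \<partial>\<sigma>) = (\<integral>x. 1 \<partial>\<sigma>)"
    proof (rule integral_cong_AE)
      show "cutoff R \<in> borel_measurable \<sigma>" using bdd_continuous_integrable[OF nc] by auto
      show "AE x in \<sigma>. cutoff R x = 1" using R(2) by eventually_elim (rule cutoff(4))
    qed simp
    then have "(\<integral>x. cutoff R x \<partial>\<sigma>) = 1" by (simp add: s.prob_space)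
    then show ?thesis
      unfolding X_def using PS.product_integral_prod[of "{..<n}" "\<lambda>_. cutoff R"] bdd_continuous_integrable[OF nc] by simp
  qed
  have pw: "\<bar>f w - P w * X w\<bar> \<le> B * (1 - X w) + e" if w: "w \<in> PiE {..<n} (\<lambda>_. UNIV)" for w
  proof -
    have "\<bar>(f w - P w) * X w\<bar> \<le> e"
    proof (cases "w \<in> PiE {..<n} (\<lambda>_. cball 0 (R + 1))")
      case True
      have "\<bar>f w - P w\<bar> * X w \<le> e * 1" using P(2)[OF True] X01[of w] e by (intro mult_mono) auto
      then show ?thesis using X01[of w] by (simp add: abs_mult)
    next
      case False
      then obtain i where "i < n" "R + 1 < cmod (w i)" using w by (auto simp: PiE_iff)
      then have "X w = 0" unfolding X_def using cutoff(5) by (intro prod_zero) auto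
      then show ?thesis using e by simp
    qed
    moreover have "\<bar>f w * (1 - X w)\<bar> \<le> B * (1 - X w)"
      using B[OF w] X01[of w] by (simp add: abs_mult mult_right_mono)
    moreover have "f w - P w * X w = f w * (1 - X w) + (f w - P w) * X w" by (simp add: algebra_simps)
    ultimately show ?thesis by linarith
  qed
  have lim_int: "\<bar>(\<integral>w. f w \<partial>\<sigma>n n) - (\<integral>w. P w * X w \<partial>\<sigma>n n)\<bar> \<le> e"
  proof -
    have i1: "integrable (\<sigma>n n) (\<lambda>w. P w * X w)" "integrable (\<sigma>n n) X"
      using product_sum_tendsto PX X by auto
    have "(\<integral>w. f w \<partial>\<sigma>n n) - (\<integral>w. P w * X w \<partial>\<sigma>n n) = (\<integral>w. f w - P w * X w \<partial>\<sigma>n n)"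
      using fi i1 by simp
    also have "\<bar>\<dots>\<bar> \<le> (\<integral>w. \<bar>f w - P w * X w\<bar> \<partial>\<sigma>n n)" by (rule integral_abs_bound)
    also have "\<dots> \<le> (\<integral>w. B * (1 - X w) + e \<partial>\<sigma>n n)"
      using fi i1 by (intro integral_mono) (auto intro!: pw simp: sp)
    also have "\<dots> = e" using i1 by (simp add: sn.prob_space iX)
    finally show ?thesis .
  qed
  have tX: "((\<lambda>x. B * (1 - tuple_average n X x)) \<longlongrightarrow> B * (1 - 1)) good_filter"
    using product_sum_tendsto[OF X] iX by (intro tendsto_intros) auto
  have "eventually (\<lambda>x. B * (1 - tuple_average n X x) < e) good_filter"
    using order_tendstoD(2)[OF tX, of e] e by simp
  moreover have "eventually (\<lambda>x. dist (tuple_average n (\<lambda>w. P w * X w) x) (\<integral>w. P w * X w \<partial>\<sigma>n n) < e) good_filter"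
    using product_sum_tendsto[OF PX] e by (auto dest: tendstoD)
  ultimately show "eventually (\<lambda>x. dist (tuple_average n f x) (\<integral>w. f w \<partial>\<sigma>n n) < \<epsilon>) good_filter"
    using eventually_pos_good
  proof eventually_elim
    fix x :: "nat \<times> (nat \<Rightarrow> complex)"
    assume 1: "B * (1 - tuple_average n X x) < e"
      and 2: "dist (tuple_average n (\<lambda>w. P w * X w) x) (\<integral>w. P w * X w \<partial>\<sigma>n n) < e" and x: "0 < fst x"
    have "tuple_average n f x - tuple_average n (\<lambda>w. P w * X w) x = tuple_average n (\<lambda>w. f w - P w * X w) x"
      by (simp add: tuple_average_diff)
    also have "\<bar>\<dots>\<bar> \<le> tuple_average n (\<lambda>w. \<bar>f w - P w * X w\<bar>) x" by (rule abs_tuple_average_le)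
    also have "\<dots> \<le> tuple_average n (\<lambda>w. B * (1 - X w) + e) x" by (rule tuple_average_mono) (rule pw)
    also have "\<dots> = B * (1 - tuple_average n X x) + e"
      using x by (simp add: tuple_average_add tuple_average_cmult tuple_average_diff tuple_average_const)
    finally have 3: "\<bar>tuple_average n f x - tuple_average n (\<lambda>w. P w * X w) x\<bar> \<le> B * (1 - tuple_average n X x) + e" .
    have "\<bar>tuple_average n f x - (\<integral>w. f w \<partial>\<sigma>n n)\<bar> < 4 * e"
      using 1 2 3 lim_int unfolding dist_real_def by linarith
    then show "dist (tuple_average n f x) (\<integral>w. f w \<partial>\<sigma>n n) < \<epsilon>" by (simp add: dist_real_def e_def)
  qed
qed

end

section \<open>Symmetry of the ensemble\<close>

text \<open>The injective tuples number N (N - 1) ... (N - n + 1), so their share is a product of n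
  factors (N - i) / N, each tending to 1.\<close>

lemma noninjective_fraction_tendsto_0:
  "(\<lambda>N. real (card {\<phi> \<in> PiE {..<n} (\<lambda>_. {..<N}). \<not> inj_on \<phi> {..<n}}) / real N ^ n) \<longlonglongrightarrow> 0"
proof -
  have "(\<lambda>N. real (N - i) / real N) \<longlonglongrightarrow> 1" for i
  proof -
    have "(\<lambda>N. 1 - real i / real N) \<longlonglongrightarrow> 1 - 0" by (intro tendsto_diff tendsto_const lim_const_over_n)
    then have "(\<lambda>N. 1 - real i / real N) \<longlonglongrightarrow> 1" by simp
    then show ?thesis
    proof (rule Lim_transform_eventually[OF _ eventually_sequentiallyI[of "Suc i"]])
      fix N assume "Suc i \<le> N"
      then show "1 - real i / real N = real (N - i) / real N" by (simp add: field_simps of_nat_diff)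
    qed
  qed
  then have "(\<lambda>N. 1 - (\<Prod>i<n. real (N - i) / real N)) \<longlonglongrightarrow> 1 - (\<Prod>i<n. 1)"
    by (intro tendsto_diff tendsto_const tendsto_prod)
  then have lim: "(\<lambda>N. 1 - (\<Prod>i<n. real (N - i) / real N)) \<longlonglongrightarrow> 0" by simp
  show ?thesis
  proof (rule Lim_transform_eventually[OF lim eventually_sequentiallyI[of 1]])
    fix N :: nat assume N: "1 \<le> N"
    let ?T = "PiE {..<n} (\<lambda>_. {..<N})" and ?I = "{\<phi> \<in> PiE {..<n} (\<lambda>_. {..<N}). inj_on \<phi> {..<n}}"
    have "{\<phi> \<in> ?T. \<not> inj_on \<phi> {..<n}} = ?T - ?I" by blast
    moreover have "finite ?T" by (intro finite_PiE) auto
    then have "card ?I \<le> card ?T" "card (?T - ?I) = card ?T - card ?I"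
      by (auto intro!: card_mono card_Diff_subset)
    moreover have "card ?T = N ^ n" by (simp add: card_PiE)
    moreover have "card ?I = (\<Prod>i<n. N - i)"
      using card_inj_on_subset_funcset[of "{..<n}" "{..<N}" "{..<n}"] by (simp add: atLeast0LessThan)
    ultimately have "real (card {\<phi> \<in> ?T. \<not> inj_on \<phi> {..<n}}) = real N ^ n - (\<Prod>i<n. real (N - i))"
      by (simp add: of_nat_diff)
    then show "1 - (\<Prod>i<n. real (N - i) / real N) = real (card {\<phi> \<in> ?T. \<not> inj_on \<phi> {..<n}}) / real N ^ n"
      using N by (simp add: prod_dividef diff_divide_distrib)
  qed
qed

text \<open>The complements of domain and range have equal size. An injective choice of particles
  thereby becomes a relabelling of all particles, under which the ensemble is invariant.\<close>

lemma inj_on_extend_bij_betw: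
  fixes N :: nat
  assumes inj: "inj_on \<phi> {..<n}" and range: "\<phi> ` {..<n} \<subseteq> {..<N}" and n: "n \<le> N"
  obtains p where "bij_betw p {..<N} {..<N}" "\<And>i. i < n \<Longrightarrow> p i = \<phi> i"
proof -
  have "card ({..<N} - {..<n}) = card ({..<N} - \<phi> ` {..<n})"
    using inj range n by (simp add: card_Diff_subset card_image)
  then obtain h where h: "bij_betw h ({..<N} - {..<n}) ({..<N} - \<phi> ` {..<n})"
    using finite_same_card_bij[of "{..<N} - {..<n}" "{..<N} - \<phi> ` {..<n}"] by auto
  define p where "p i = (if i < n then \<phi> i else h i)" for i
  have "bij_betw p {..<n} (\<phi> ` {..<n})"
    using inj unfolding bij_betw_def p_def by (auto simp: inj_on_def)
  moreover have "bij_betw p ({..<N} - {..<n}) ({..<N} - \<phi> ` {..<n})"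
    using h by (rule bij_betw_cong[THEN iffD1, rotated]) (auto simp: p_def)
  ultimately have "bij_betw p ({..<n} \<union> ({..<N} - {..<n})) (\<phi> ` {..<n} \<union> ({..<N} - \<phi> ` {..<n}))"
    by (rule bij_betw_combine) auto
  moreover have "{..<n} \<union> ({..<N} - {..<n}) = {..<N}" "\<phi> ` {..<n} \<union> ({..<N} - \<phi> ` {..<n}) = {..<N}"
    using n range by auto
  ultimately have "bij_betw p {..<N} {..<N}" by simp
  then show ?thesis by (rule that) (simp add: p_def)
qed

lemma distr_PiM_permute:
  assumes M: "sigma_finite_measure M" and p: "bij_betw p I I" and I: "finite I"
  shows "distr (PiM I (\<lambda>_. M)) (PiM I (\<lambda>_. M)) (\<lambda>z. \<lambda>i\<in>I. z (p i)) = PiM I (\<lambda>_. M)"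
proof -
  interpret M: sigma_finite_measure M by (rule M)
  interpret P: product_sigma_finite "\<lambda>_. M" ..
  let ?T = "\<lambda>z. \<lambda>i\<in>I. z (p i)"
  have pI: "p i \<in> I" if "i \<in> I" for i using p that by (auto simp: bij_betw_def)
  have T: "?T \<in> PiM I (\<lambda>_. M) \<rightarrow>\<^sub>M PiM I (\<lambda>_. M)"
    by (intro measurable_restrict measurable_component_singleton pI)
  \<comment> \<open>The preimage of a box under relabelling is the box whose sides are permuted by
    the inverse.\<close>
  define p' where "p' = the_inv_into I p"
  have p': "bij_betw p' I I" "\<And>i. i \<in> I \<Longrightarrow> p' (p i) = i" "\<And>i. i \<in> I \<Longrightarrow> p (p' i) = i"
    unfolding p'_def using p by (rule bij_betw_the_inv_into)
      (use p in \<open>auto simp: the_inv_into_f_f f_the_inv_into_f bij_betw_def\<close>)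
  have p'I: "p' i \<in> I" if "i \<in> I" for i using p'(1) that by (auto simp: bij_betw_def)
  show ?thesis
  proof (rule P.PiM_eqI[OF I])
    fix A assume A: "\<And>i. i \<in> I \<Longrightarrow> A i \<in> sets M"
    then have A': "PiE I A \<in> sets (PiM I (\<lambda>_. M))" by (intro sets_PiM_I_finite I)
    have "?T -` PiE I A \<inter> space (PiM I (\<lambda>_. M)) = PiE I (\<lambda>j. A (p' j))"
    proof (intro set_eqI iffI)
      fix z assume "z \<in> ?T -` PiE I A \<inter> space (PiM I (\<lambda>_. M))"
      then have z: "\<And>i. i \<in> I \<Longrightarrow> z (p i) \<in> A i" "z \<in> extensional I"
        by (auto simp: space_PiM PiE_iff)
      show "z \<in> PiE I (\<lambda>j. A (p' j))"
      proof (rule PiE_I)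
        fix j assume j: "j \<in> I"
        show "z j \<in> A (p' j)" using z(1)[OF p'I[OF j]] p'(3)[OF j] by simp
      next
        fix j assume "j \<notin> I" then show "z j = undefined" using z(2) by (simp add: extensional_def)
      qed
    next
      fix z assume z: "z \<in> PiE I (\<lambda>j. A (p' j))"
      have "z (p i) \<in> A i" if "i \<in> I" for i using PiE_mem[OF z pI[OF that]] p'(2)[OF that] by simp
      moreover have "z \<in> space (PiM I (\<lambda>_. M))"
        using z sets.sets_into_space[OF A] p'I by (fastforce simp: space_PiM PiE_iff)
      ultimately show "z \<in> ?T -` PiE I A \<inter> space (PiM I (\<lambda>_. M))" by (auto simp: PiE_iff)
    qed
    then have "emeasure (distr (PiM I (\<lambda>_. M)) (PiM I (\<lambda>_. M)) ?T) (PiE I A) = (\<Prod>j\<in>I. emeasure M (A (p' j)))"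
      using A p'I by (simp add: emeasure_distr[OF T A'] P.emeasure_PiM[OF I])
    also have "\<dots> = (\<Prod>i\<in>I. emeasure M (A i))" by (rule prod.reindex_bij_betw[OF p'(1)])
    finally show "emeasure (distr (PiM I (\<lambda>_. M)) (PiM I (\<lambda>_. M)) ?T) (PiE I A) = (\<Prod>i\<in>I. emeasure M (A i))" .
  qed simp
qed

context extremal
begin

text \<open>The determinant itself changes sign, and sums over j < k are not visibly symmetric.
  Doubling them into sums over the full square, where rows and columns can be reindexed separately,
  shows the invariance of H; coincidences are invariant by themselves.\<close>

lemma weight_permute:
  assumes p: "bij_betw p {..<N} {..<N}"
  shows "weight N (\<lambda>i\<in>{..<N}. z (p i)) = weight N z"
proof -
  let ?w = "\<lambda>i\<in>{..<N}. z (p i)"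
  have p_inj: "inj_on p {..<N}" and p_img: "p ` {..<N} = {..<N}" using p by (auto simp: bij_betw_def)
  have inj: "inj_on ?w {..<N} \<longleftrightarrow> inj_on z {..<N}"
  proof -
    have "inj_on ?w {..<N} \<longleftrightarrow> inj_on (z \<circ> p) {..<N}" by (intro inj_on_cong) auto
    then show ?thesis using comp_inj_on_iff[OF p_inj, of z] by (simp add: p_img)
  qed
  \<comment> \<open>The diagonal of the square contributes nothing, because
    \<open>ln 0 = 0\<close>.\<close>
  have tri: "2 * (\<Sum>k<N. \<Sum>j<k. ln (cmod (u j - u k))) = (\<Sum>i<N. \<Sum>j<N. ln (cmod (u i - u j)))" for u :: "nat \<Rightarrow> complex"
    by (subst sum_square_triangle) (auto simp: norm_minus_commute)
  have 1: "(\<Sum>i<N. \<Sum>j<N. ln (cmod (?w i - ?w j))) = (\<Sum>i<N. \<Sum>j<N. ln (cmod (z i - z j)))"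
  proof -
    have "(\<Sum>i<N. \<Sum>j<N. ln (cmod (?w i - ?w j))) = (\<Sum>i<N. \<Sum>j<N. ln (cmod (z (p i) - z (p j))))"
      by (intro sum.cong) auto
    also have "\<dots> = (\<Sum>i<N. \<Sum>j<N. ln (cmod (z (p i) - z j)))"
      by (intro sum.cong refl sum.reindex_bij_betw[OF p, of "\<lambda>j. ln (cmod (z (p i) - z j))" for i])
    also have "\<dots> = (\<Sum>i<N. \<Sum>j<N. ln (cmod (z i - z j)))"
      by (rule sum.reindex_bij_betw[OF p, of "\<lambda>i. \<Sum>j<N. ln (cmod (z i - z j))"])
    finally show ?thesis .
  qed
  have 2: "(\<Sum>k<N. Q (?w k)) = (\<Sum>k<N. Q (z k))"
  proof -
    have "(\<Sum>k<N. Q (?w k)) = (\<Sum>k<N. Q (z (p k)))" by (intro sum.cong) auto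
    also have "\<dots> = (\<Sum>k<N. Q (z k))" by (rule sum.reindex_bij_betw[OF p, of "\<lambda>k. Q (z k)"])
    finally show ?thesis .
  qed
  have "H N ?w = H N z" using tri[of ?w] tri[of z] 1 2 unfolding H_eq by simp
  then show ?thesis using inj weight_eq_exp[of ?w N] weight_eq_exp[of z N] weight_eq_0[of ?w N] weight_eq_0[of z N]
    by (cases "inj_on z {..<N}") simp_all
qed

lemma integral_ens_permute:
  fixes h :: "(nat \<Rightarrow> complex) \<Rightarrow> real"
  assumes p: "bij_betw p {..<N} {..<N}" and h: "h \<in> borel_measurable (PiM {..<N} (\<lambda>_. borel))"
  shows "(\<integral>z. h (\<lambda>i\<in>{..<N}. z (p i)) \<partial>ens N) = (\<integral>z. h z \<partial>ens N)"
proof -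
  let ?T = "\<lambda>z::nat \<Rightarrow> complex. \<lambda>i\<in>{..<N}. z (p i)"
  have pI: "p i \<in> {..<N}" if "i \<in> {..<N}" for i using p that by (auto simp: bij_betw_def)
  have T: "?T \<in> lebN N \<rightarrow>\<^sub>M lebN N"
    by (intro measurable_restrict measurable_component_singleton pI)
  have d: "distr (lebN N) (lebN N) ?T = lebN N"
    by (rule distr_PiM_permute[OF _ p]) (auto intro: sigma_finite_lborel)
  have w: "(\<lambda>z. ennreal (weight N z) / Z N) \<in> borel_measurable (lebN N)"
    using measurable_weight_lebN by measurable
  have hm: "h \<in> borel_measurable (lebN N)"
    using h by (simp only: measurable_cong_sets[OF sets_lebN refl])
  have "ens N = density (distr (lebN N) (lebN N) ?T) (\<lambda>z. ennreal (weight N z) / Z N)"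
    unfolding d by (rule ensemble_eq)
  also have "\<dots> = distr (ens N) (lebN N) ?T"
    unfolding density_distr[OF w T] weight_permute[OF p] ensemble_eq ..
  finally have e: "distr (ens N) (lebN N) ?T = ens N" ..
  have T': "?T \<in> ens N \<rightarrow>\<^sub>M lebN N"
    using T by (simp only: measurable_cong_sets[OF sets_ens refl] measurable_cong_sets[OF sets_lebN refl])
  show ?thesis using integral_distr[OF T' hm] unfolding e ..
qed

text \<open>The passage from deterministic limits to expectations: on good configurations X is
  within \<epsilon> / 2 of c, and the others have vanishing probability while X stays
  bounded.\<close>

lemma integral_ens_tendsto:
  fixes X :: "nat \<times> (nat \<Rightarrow> complex) \<Rightarrow> real"
  assumes X: "(X \<longlongrightarrow> c) good_filter"
    and meas: "\<And>N. (\<lambda>z. X (N, z)) \<in> borel_measurable (PiM {..<N} (\<lambda>_. borel))"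
    and B: "\<And>N z. z \<in> PiE {..<N} (\<lambda>_. UNIV) \<Longrightarrow> \<bar>X (N, z)\<bar> \<le> B"
  shows "(\<lambda>N. \<integral>z. X (N, z) \<partial>ens N) \<longlonglongrightarrow> c"
proof (rule tendstoI)
  fix \<epsilon> :: real assume \<epsilon>: "0 < \<epsilon>"
  have "eventually (\<lambda>x. dist (X x) c < \<epsilon> / 2) good_filter" using X \<epsilon> by (intro tendstoD) auto
  then obtain \<eta> N0 where \<eta>: "0 < \<eta>" and N0: "\<And>N z. N0 \<le> N \<Longrightarrow> z \<in> good N \<eta> \<Longrightarrow> \<bar>X (N, z) - c\<bar> < \<epsilon> / 2"
    unfolding eventually_good dist_real_def by blast
  \<comment> \<open>A smoothed measure with energy excess at most \<eta> / 2 serves as the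
    comparison measure in the lower bound on the partition function.\<close>
  obtain r0 where r0: "0 < r0" "\<And>r. 0 < r \<Longrightarrow> r \<le> r0 \<Longrightarrow> energy (smoothed r) \<le> I + \<eta> / 2"
    using energy_smoothed_approx[of "\<eta> / 2"] \<eta> by auto
  define D where "D = B + \<bar>c\<bar>"
  have "(\<lambda>N. D * measure (ens N) (space (ens N) - good N \<eta>)) \<longlonglongrightarrow> D * 0"
    by (intro tendsto_mult tendsto_const bad_tendsto_0[OF \<eta> compactly_supported_smoothed bounded_density_smoothed r0(2)])
      (use r0(1) in auto)
  then have "eventually (\<lambda>N. D * measure (ens N) (space (ens N) - good N \<eta>) < \<epsilon> / 2) sequentially"
    using \<epsilon> by (intro order_tendstoD(2)) auto
  then show "eventually (\<lambda>N. dist (\<integral>z. X (N, z) \<partial>ens N) c < \<epsilon>) sequentially"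
    using eventually_ge_at_top[of 2] eventually_ge_at_top[of N0]
  proof eventually_elim
    fix N assume bad: "D * measure (ens N) (space (ens N) - good N \<eta>) < \<epsilon> / 2" and N: "2 \<le> N" "N0 \<le> N"
    interpret E: prob_space "ens N" by (rule prob_space_ens[OF N(1)])
    let ?A = "space (ens N) - good N \<eta>"
    have "good N \<eta> \<in> sets (ens N)" unfolding sets_ens by (rule sets_good)
    then have A: "?A \<in> sets (ens N)" by (rule sets.Diff[OF sets.top])
    have Xm: "(\<lambda>z. X (N, z)) \<in> borel_measurable (ens N)"
      using meas by (simp only: measurable_cong_sets[OF sets_ens refl])
    have Xi: "integrable (ens N) (\<lambda>z. X (N, z))"
      by (rule E.integrable_const_bound[OF _ Xm, of B]) (use B in \<open>auto intro!: AE_I2 simp: space_ens\<close>)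
    have "(\<integral>z. X (N, z) \<partial>ens N) - c = (\<integral>z. X (N, z) - c \<partial>ens N)"
      using Xi by (simp add: E.prob_space)
    also have "\<bar>\<dots>\<bar> \<le> (\<integral>z. \<bar>X (N, z) - c\<bar> \<partial>ens N)" by (rule integral_abs_bound)
    also have "\<dots> \<le> (\<integral>z. \<epsilon> / 2 + D * indicator ?A z \<partial>ens N)"
    proof (rule integral_mono)
      fix z assume z: "z \<in> space (ens N)"
      show "\<bar>X (N, z) - c\<bar> \<le> \<epsilon> / 2 + D * indicator ?A z"
      proof (cases "z \<in> good N \<eta>")
        case True
        then show ?thesis using N0[OF N(2) True] by simp
      next
        case False
        have "\<bar>X (N, z)\<bar> \<le> B" using B z by (simp add: space_ens)
        then show ?thesis using False z \<epsilon> unfolding D_def by simp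
      qed
    qed (use Xi A in \<open>auto simp: E.emeasure_eq_measure\<close>)
    also have "\<dots> = \<epsilon> / 2 + D * measure (ens N) ?A"
      using A by (simp add: E.prob_space E.emeasure_eq_measure)
    finally show "dist (\<integral>z. X (N, z) \<partial>ens N) c < \<epsilon>" using bad unfolding dist_real_def by argo
  qed
qed

lemma measurable_tuple:
  assumes f: "f \<in> borel_measurable (PiM {..<n} (\<lambda>_. borel :: complex measure))" and \<phi>: "\<phi> \<in> PiE {..<n} (\<lambda>_. {..<N})"
  shows "(\<lambda>z. f (\<lambda>i\<in>{..<n}. z (\<phi> i))) \<in> borel_measurable (PiM {..<N} (\<lambda>_. borel))"
proof (rule measurable_compose[OF _ f])
  show "(\<lambda>z. \<lambda>i\<in>{..<n}. z (\<phi> i)) \<in> PiM {..<N} (\<lambda>_. borel :: complex measure) \<rightarrow>\<^sub>M PiM {..<n} (\<lambda>_. borel)"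
    using \<phi> by (intro measurable_restrict measurable_component_singleton) (auto simp: PiE_iff)
qed

lemma abs_tuple_average_bound:
  assumes B: "\<And>w. w \<in> PiE {..<n} (\<lambda>_. UNIV) \<Longrightarrow> \<bar>f w\<bar> \<le> B" and n: "0 < n"
  shows "\<bar>tuple_average n f x\<bar> \<le> B"
proof (cases "fst x = 0")
  case True
  \<comment> \<open>With no particles and n > 0 there are no tuples, and the average is 0.\<close>
  have "0 \<le> B" using B[of "\<lambda>i\<in>{..<n}. 0"] by auto
  then show ?thesis using True n by (simp add: tuple_average_def)
next
  case False
  have "\<bar>tuple_average n f x\<bar> \<le> tuple_average n (\<lambda>w. \<bar>f w\<bar>) x" by (rule abs_tuple_average_le)
  also have "\<dots> \<le> tuple_average n (\<lambda>_. B) x" using B by (rule tuple_average_mono)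
  also have "\<dots> = B" using False by (simp add: tuple_average_const)
  finally show ?thesis .
qed

text \<open>By symmetry, every injective choice of particles contributes the same expectation.\<close>

lemma marginal_vs_tuple_average:
  fixes f :: "(nat \<Rightarrow> complex) \<Rightarrow> real"
  assumes f: "f \<in> borel_measurable (PiM {..<n} (\<lambda>_. borel))"
    and B: "\<And>w. w \<in> PiE {..<n} (\<lambda>_. UNIV) \<Longrightarrow> \<bar>f w\<bar> \<le> B" and N: "2 \<le> N" "n \<le> N"
  shows "\<bar>(\<integral>z. f (restrict z {..<n}) \<partial>ens N) - (\<integral>z. tuple_average n f (N, z) \<partial>ens N)\<bar> \<le>
    2 * B * (real (card {\<phi> \<in> PiE {..<n} (\<lambda>_. {..<N}). \<not> inj_on \<phi> {..<n}}) / real N ^ n)"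
proof -
  interpret E: prob_space "ens N" by (rule prob_space_ens[OF N(1)])
  let ?T = "PiE {..<n} (\<lambda>_. {..<N})"
  have fT: "finite ?T" by (intro finite_PiE) auto
  define m where "m = (\<integral>z. f (restrict z {..<n}) \<partial>ens N)"
  define c where "c \<phi> = (\<integral>z. f (\<lambda>i\<in>{..<n}. z (\<phi> i)) \<partial>ens N)" for \<phi>
  have B0: "0 \<le> B" using B[of "\<lambda>i\<in>{..<n}. 0"] by auto
  have meas: "(\<lambda>z. f (\<lambda>i\<in>{..<n}. z (\<phi> i))) \<in> borel_measurable (ens N)" if "\<phi> \<in> ?T" for \<phi>
    using measurable_tuple[OF f that] by (simp only: measurable_cong_sets[OF sets_ens refl])
  have int: "integrable (ens N) (\<lambda>z. f (\<lambda>i\<in>{..<n}. z (\<phi> i)))" if "\<phi> \<in> ?T" for \<phi>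
    by (rule E.integrable_const_bound[OF _ meas[OF that], of B]) (use B in \<open>auto intro!: AE_I2\<close>)
  have cB: "\<bar>c \<phi>\<bar> \<le> B" if "\<phi> \<in> ?T" for \<phi>
  proof -
    have "\<bar>c \<phi>\<bar> \<le> (\<integral>z. \<bar>f (\<lambda>i\<in>{..<n}. z (\<phi> i))\<bar> \<partial>ens N)" unfolding c_def by (rule integral_abs_bound)
    also have "\<dots> \<le> (\<integral>z. B \<partial>ens N)" using int[OF that] B by (intro integral_mono) auto
    finally show ?thesis by (simp add: E.prob_space)
  qed
  \<comment> \<open>The tuple of the first n particles; its expectation is the marginal
    integral.\<close>
  define \<iota> where "\<iota> = (\<lambda>i\<in>{..<n}. i)"
  have \<iota>: "\<iota> \<in> ?T" using N(2) by (auto simp: \<iota>_def)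
  have "(\<lambda>i\<in>{..<n}. z (\<iota> i)) = restrict z {..<n}" for z :: "nat \<Rightarrow> complex" by (auto simp: \<iota>_def)
  then have m\<iota>: "m = c \<iota>" unfolding m_def c_def by simp
  have inj: "c \<phi> = m" if \<phi>: "\<phi> \<in> ?T" "inj_on \<phi> {..<n}" for \<phi>
  proof -
    have "\<phi> ` {..<n} \<subseteq> {..<N}" using \<phi>(1) by (auto simp: PiE_iff)
    then obtain p where p: "bij_betw p {..<N} {..<N}" "\<And>i. i < n \<Longrightarrow> p i = \<phi> i"
      using inj_on_extend_bij_betw[OF \<phi>(2) _ N(2)] by blast
    have "restrict (\<lambda>i\<in>{..<N}. z (p i)) {..<n} = (\<lambda>i\<in>{..<n}. z (\<phi> i))" for z :: "nat \<Rightarrow> complex"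
      using p(2) N(2) by (auto simp: restrict_def fun_eq_iff)
    moreover have "(\<integral>z. f (restrict (\<lambda>i\<in>{..<N}. z (p i)) {..<n}) \<partial>ens N) = m"
      unfolding m_def
    proof (rule integral_ens_permute[OF p(1)])
      show "(\<lambda>z. f (restrict z {..<n})) \<in> borel_measurable (PiM {..<N} (\<lambda>_. borel))"
        using N(2) by (intro measurable_compose[OF measurable_restrict_subset f]) auto
    qed
    ultimately show ?thesis unfolding c_def by simp
  qed
  have "(\<integral>z. tuple_average n f (N, z) \<partial>ens N) = (\<Sum>\<phi>\<in>?T. c \<phi>) / real N ^ n"
    unfolding tuple_average_def c_def using int by simp
  moreover have "m = (\<Sum>\<phi>\<in>?T. m) / real N ^ n" using N by (simp add: card_PiE)
  ultimately have "m - (\<integral>z. tuple_average n f (N, z) \<partial>ens N) = (\<Sum>\<phi>\<in>?T. m - c \<phi>) / real N ^ n"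
    by (simp add: sum_subtractf diff_divide_distrib)
  \<comment> \<open>Injective tuples have expectation m and drop out; each of the others costs at
    most 2 B.\<close>
  also have "(\<Sum>\<phi>\<in>?T. m - c \<phi>) = (\<Sum>\<phi>\<in>{\<phi> \<in> ?T. \<not> inj_on \<phi> {..<n}}. m - c \<phi>)"
    using inj by (intro sum.mono_neutral_right fT) auto
  also have "\<bar>\<dots> / real N ^ n\<bar> \<le> (\<Sum>\<phi>\<in>{\<phi> \<in> ?T. \<not> inj_on \<phi> {..<n}}. 2 * B) / real N ^ n"
    unfolding abs_divide
  proof (intro frac_le order_trans[OF sum_abs] sum_mono sum_nonneg)
    fix \<phi> assume "\<phi> \<in> {\<phi> \<in> ?T. \<not> inj_on \<phi> {..<n}}"
    then show "\<bar>m - c \<phi>\<bar> \<le> 2 * B" using cB[of \<phi>] cB[OF \<iota>] m\<iota> by (simp add: abs_le_iff)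
  qed (use N B0 in auto)
  finally show ?thesis by (simp add: m_def mult_ac)
qed

lemma integral_marginal:
  fixes f :: "(nat \<Rightarrow> complex) \<Rightarrow> 'a::{banach, second_countable_topology}"
  assumes f: "f \<in> borel_measurable (PiM {..<n} (\<lambda>_. borel))" and n: "n \<le> N"
  shows "(\<integral>z. f z \<partial>marginal n N ((real N - 1) / \<tau>) \<Phi>) = (\<integral>z. f (restrict z {..<n}) \<partial>ens N)"
proof -
  have "(\<lambda>z. restrict z {..<n}) \<in> ens N \<rightarrow>\<^sub>M PiM {..<n} (\<lambda>_. borel)"
    unfolding measurable_cong_sets[OF sets_ens refl] using n by (intro measurable_restrict_subset) auto
  then show ?thesis unfolding marginal_def using f by (rule integral_distr)
qed

lemma marginal_tendsto_real:
  fixes f :: "(nat \<Rightarrow> complex) \<Rightarrow> real"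
  assumes n: "0 < n" and f: "continuous_map (product_topology (\<lambda>_. euclidean) {..<n}) euclidean f"
    and B: "\<And>w. w \<in> PiE {..<n} (\<lambda>_. UNIV) \<Longrightarrow> \<bar>f w\<bar> \<le> B"
  shows "(\<lambda>N. \<integral>z. f z \<partial>marginal n N ((real N - 1) / \<tau>) \<Phi>) \<longlonglongrightarrow> (\<integral>w. f w \<partial>\<sigma>n n)"
proof -
  note fm = borel_measurable_product_topology(2)[OF f]
  have "(\<lambda>N. \<integral>z. tuple_average n f (N, z) \<partial>ens N) \<longlonglongrightarrow> (\<integral>w. f w \<partial>\<sigma>n n)"
  proof (rule integral_ens_tendsto[OF tuple_average_tendsto[OF n f B]])
    show "(\<lambda>z. tuple_average n f (N, z)) \<in> borel_measurable (PiM {..<N} (\<lambda>_. borel))" for N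
      unfolding tuple_average_def fst_conv snd_conv
      by (intro borel_measurable_divide borel_measurable_sum borel_measurable_const measurable_tuple[OF fm])
    show "\<bar>tuple_average n f (N, z)\<bar> \<le> B" for N z
      using B n by (rule abs_tuple_average_bound)
  qed
  moreover have "(\<lambda>N. (\<integral>z. f z \<partial>marginal n N ((real N - 1) / \<tau>) \<Phi>) - (\<integral>z. tuple_average n f (N, z) \<partial>ens N)) \<longlonglongrightarrow> 0"
  proof (rule Lim_null_comparison)
    show "(\<lambda>N. 2 * B * (real (card {\<phi> \<in> PiE {..<n} (\<lambda>_. {..<N}). \<not> inj_on \<phi> {..<n}}) / real N ^ n)) \<longlonglongrightarrow> 0"
      by (rule tendsto_mult_right_zero[OF noninjective_fraction_tendsto_0])
    show "eventually (\<lambda>N. norm ((\<integral>z. f z \<partial>marginal n N ((real N - 1) / \<tau>) \<Phi>) - (\<integral>z. tuple_average n f (N, z) \<partial>ens N)) \<le>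
      2 * B * (real (card {\<phi> \<in> PiE {..<n} (\<lambda>_. {..<N}). \<not> inj_on \<phi> {..<n}}) / real N ^ n)) sequentially"
      using eventually_ge_at_top[of "max n 2"]
    proof eventually_elim
      fix N assume "max n 2 \<le> N"
      then have N: "2 \<le> N" "n \<le> N" by auto
      show "norm ((\<integral>z. f z \<partial>marginal n N ((real N - 1) / \<tau>) \<Phi>) - (\<integral>z. tuple_average n f (N, z) \<partial>ens N)) \<le>
        2 * B * (real (card {\<phi> \<in> PiE {..<n} (\<lambda>_. {..<N}). \<not> inj_on \<phi> {..<n}}) / real N ^ n)"
        unfolding integral_marginal[OF fm N(2)] real_norm_def
        by (rule marginal_vs_tuple_average[OF fm _ N]) (rule B)
    qed
  qed
  ultimately show ?thesis using tendsto_add by fastforce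
qed

lemma marginal_tendsto:
  fixes f :: "(nat \<Rightarrow> complex) \<Rightarrow> complex"
  assumes n: "0 < n" and f: "continuous_map (product_topology (\<lambda>_. euclidean) {..<n}) euclidean f"
    and bnd: "bounded (f ` PiE {..<n} (\<lambda>_. UNIV))"
  shows "(\<lambda>N. \<integral>z. f z \<partial>marginal n N ((real N - 1) / \<tau>) \<Phi>) \<longlonglongrightarrow> (\<integral>w. f w \<partial>\<sigma>n n)"
proof -
  note fm = borel_measurable_product_topology(2)[OF f]
  obtain B where B: "\<And>w. w \<in> PiE {..<n} (\<lambda>_. UNIV) \<Longrightarrow> cmod (f w) \<le> B"
    using bnd unfolding bounded_iff by blast
  have cRe: "continuous_map euclidean euclidean Re" and cIm: "continuous_map euclidean euclidean Im"
    by (auto intro: continuous_intros)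
  note fRe = continuous_map_compose[OF f cRe] and fIm = continuous_map_compose[OF f cIm]
  have BRe: "\<bar>(Re \<circ> f) w\<bar> \<le> B" and BIm: "\<bar>(Im \<circ> f) w\<bar> \<le> B" if "w \<in> PiE {..<n} (\<lambda>_. UNIV)" for w
    using B[OF that] abs_Re_le_cmod[of "f w"] abs_Im_le_cmod[of "f w"] by auto
  have fi: "integrable M f" if M: "prob_space M" "sets M = sets (PiM {..<n} (\<lambda>_. borel))" for M
  proof -
    interpret prob_space M by (rule M)
    have "space M = PiE {..<n} (\<lambda>_. UNIV)" using sets_eq_imp_space_eq[OF M(2)] by (simp add: space_PiM)
    moreover have "f \<in> borel_measurable M" using fm by (simp only: measurable_cong_sets[OF M(2) refl])
    ultimately show ?thesis using B by (intro integrable_const_bound[of _ B]) (auto intro!: AE_I2)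
  qed
  \<comment> \<open>Only from max n 2 on is the marginal known to be a probability measure, so real
    and imaginary parts are exchanged with the integral eventually, not for every N.\<close>
  have fiN: "integrable (marginal n N ((real N - 1) / \<tau>) \<Phi>) f" if "max n 2 \<le> N" for N
  proof (rule fi)
    have N: "2 \<le> N" "n \<le> N" using that by auto
    interpret E: prob_space "ens N" by (rule prob_space_ens[OF N(1)])
    have "(\<lambda>z. restrict z {..<n}) \<in> ens N \<rightarrow>\<^sub>M PiM {..<n} (\<lambda>_. borel)"
      unfolding measurable_cong_sets[OF sets_ens refl] using N by (intro measurable_restrict_subset) auto
    then show "prob_space (marginal n N ((real N - 1) / \<tau>) \<Phi>)" unfolding marginal_def by (rule E.prob_space_distr)
  qed (simp add: marginal_def)
  have fi\<sigma>: "integrable (\<sigma>n n) f" by (rule fi[OF prob_\<sigma>n sets_\<sigma>n])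
  show ?thesis unfolding tendsto_complex_iff
  proof
    have "(\<lambda>N. \<integral>z. (Re \<circ> f) z \<partial>marginal n N ((real N - 1) / \<tau>) \<Phi>) \<longlonglongrightarrow> (\<integral>w. (Re \<circ> f) w \<partial>\<sigma>n n)"
      using n fRe BRe by (rule marginal_tendsto_real)
    then have "(\<lambda>N. \<integral>z. (Re \<circ> f) z \<partial>marginal n N ((real N - 1) / \<tau>) \<Phi>) \<longlonglongrightarrow> Re (\<integral>w. f w \<partial>\<sigma>n n)"
      using fi\<sigma> by simp
    then show "(\<lambda>N. Re (\<integral>z. f z \<partial>marginal n N ((real N - 1) / \<tau>) \<Phi>)) \<longlonglongrightarrow> Re (\<integral>w. f w \<partial>\<sigma>n n)"
      by (rule Lim_transform_eventually) (use eventually_ge_at_top[of "max n 2"] fiN in \<open>auto elim!: eventually_mono\<close>)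
    have "(\<lambda>N. \<integral>z. (Im \<circ> f) z \<partial>marginal n N ((real N - 1) / \<tau>) \<Phi>) \<longlonglongrightarrow> (\<integral>w. (Im \<circ> f) w \<partial>\<sigma>n n)"
      using n fIm BIm by (rule marginal_tendsto_real)
    then have "(\<lambda>N. \<integral>z. (Im \<circ> f) z \<partial>marginal n N ((real N - 1) / \<tau>) \<Phi>) \<longlonglongrightarrow> Im (\<integral>w. f w \<partial>\<sigma>n n)"
      using fi\<sigma> by simp
    then show "(\<lambda>N. Im (\<integral>z. f z \<partial>marginal n N ((real N - 1) / \<tau>) \<Phi>)) \<longlonglongrightarrow> Im (\<integral>w. f w \<partial>\<sigma>n n)"
      by (rule Lim_transform_eventually) (use eventually_ge_at_top[of "max n 2"] fiN in \<open>auto elim!: eventually_mono\<close>)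
  qed
qed

end

theorem theorem1p1:
  fixes \<Phi> :: "complex \<Rightarrow> real" and \<tau> :: real and n :: nat
    and \<sigma> :: "complex measure" and f :: "(nat \<Rightarrow> complex) \<Rightarrow> complex"
  assumes "C2_smooth \<Phi>"
    and "superlog_growth \<Phi>"
    and "\<tau> > 0"
    and "n \<ge> 1"
    and "is_extremal_measure \<Phi> \<tau> \<sigma>"
    and "continuous_map (product_topology (\<lambda>_. euclidean) {..<n}) euclidean f"
    and "bounded (f ` (\<Pi>\<^sub>E j\<in>{..<n}. UNIV))"
  shows "(\<lambda>N. \<integral>z. f z \<partial>(marginal n N ((real N - 1) / \<tau>) \<Phi>))
    \<longlonglongrightarrow> (\<integral>z. f z \<partial>(\<Pi>\<^sub>M j\<in>{..<n}. \<sigma>))"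
proof -
  have "isCont \<Phi> z" for z
    using assms(1) unfolding C2_smooth_def by (metis has_derivative_continuous)
  then have "continuous_on UNIV \<Phi>" by (simp add: continuous_at_imp_continuous_on)
  then interpret extremal \<Phi> \<tau> \<sigma> by (rule extremal.intro) (rule assms)+
  show ?thesis by (rule marginal_tendsto) (use assms in auto)
qed

end
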